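(* Let $\Omega$ be any open set in $\mathbb R^n$, $n\geq2$. Assume that $\mu$ is a Borel measure in $\Omega$ such that $\mu(B_r(x)\cap\Omega)\leq C_\mu r^\alpha$ for $x\in\Omega$ and $r>0$, for some exponent $\alpha\in(n-1,n]$ and some constant $C_\mu>0$. Assume, in addition, that $\mathcal L^n(\Omega)<\infty$, $\mu(\Omega)<\infty$ and $\mathcal H^{n-1}(\partial\Omega)<\infty$. Then there exists a constant $C=C(n,\alpha,C_\mu,\mathcal L^n(\Omega),\mu(\Omega),\mathcal H^{n-1}(\partial\Omega))$ such that $$\|\mathbf u\|_{\exp L^{\frac n{n-1}}(\Omega,\mu)}\leq C\Big(\|\mathcal E\mathbf u\|_{L^n(\Omega)}+\|\mathbf u\|_{\exp L^{\frac n{n-1}}(\partial\Omega)}\Big)$$ for every $\mathbf u\in E^{1,n}(\Omega)\cap C_b(\overline\Omega)$. Moreover, there exists a constant $C$, depending on the same quantities, such that $$\|\mathbf u\|_{L^{\infty,n;-1}(\Omega,\mu)}\leq C\Big(\|\mathcal E\mathbf u\|_{L^n(\Omega)}+\|\mathbf u\|_{L^{\infty,n;-1}(\partial\Omega)}\Big)$$ for every $\mathbf u\in E^{1,n}(\Omega)\cap C_b(\overline\Omega)$.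
   Context: Functions $\mathbf u$ are $\mathbb R^n$-valued. $\mathcal E\mathbf u=\tfrac12(\nabla\mathbf u+(\nabla\mathbf u)^T)$ is the symmetric part of the distributional gradient. $E^{1,n}(\Omega)=\{\mathbf u\in L^1_{\rm loc}(\Omega):|\mathcal E\mathbf u|\in L^n(\Omega)\}$. $C_b(\overline\Omega)$ is the set of functions that are continuous in $\overline\Omega$ and have bounded support. $B_r(x)$ is the ball centered at $x$ with radius $r$; $\mathcal L^n$ is Lebesgue measure and $\mathcal H^{n-1}$ the $(n-1)$-dimensional Hausdorff measure. Norms over $\Omega$ with no measure indicated are with respect to $\mathcal L^n$; norms over $\partial\Omega$ are with respect to $\mathcal H^{n-1}$ and are applied to the restriction of $\mathbf u$ to $\partial\Omega$. Let $\mathcal R$ be a measure space with a finite non-atomic measure $\nu$. A Young function is a left-continuous convex function $A:[0,\infty)\to[0,\infty]$ that is neither identically $0$ nor identically $\infty$ (with $A(0)=0$); the Orlicz space $L^A(\mathcal R)$ has the Luxemburg norm $\|\phi\|_{L^A(\mathcal R)}=\inf\{\lambda>0:\int_{\mathcal R}A(|\phi|/\lambda)\,d\nu\leq1\}$. For $\sigma>0$, $\exp L^\sigma(\mathcal R)$ is the Orlicz space built on a Young function equivalent to $e^{t^\sigma}-1$ near infinity (two functions $A,B$ are equivalent near infinity if $A(t/k)\le B(t)\le A(kt)$ for large $t$ and some $k\geq 1$). The decreasing rearrangement is $\phi^*_\nu(s)=\inf\{t\geq0:\nu(\{|\phi|>t\})\leq s\}$. For $1<q<\infty$, the Lorentz–Zygmund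 space $L^{\infty,q;-1}(\mathcal R)$ has the norm $$\|\phi\|_{L^{\infty,q;-1}(\mathcal R)}=\Big\|s^{-\frac1q}\log^{-1}\!\big(1+\tfrac{\nu(\mathcal R)}{s}\big)\phi^*_\nu(s)\Big\|_{L^q(0,\nu(\mathcal R))}.$$ *)

theory Defs
  imports "HOL-Analysis.Analysis"
begin

section \<open>Hausdorff measure\<close>

text \<open>
  The normalisation makes the \<open>m\<close>-dimensional measure agree with Lebesgue measure on
  \<open>m\<close>-dimensional planes. The library's \<^const>\<open>diameter\<close> is unspecified on unbounded sets, hence
  the boundedness condition on covers; the empty set is given weight zero separately because
  \<open>0 ^ 0 = 1\<close>.
\<close>

definition hausdorff_weight :: "nat \<Rightarrow> 'a::metric_space set \<Rightarrow> ennreal" where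
  "hausdorff_weight m S =
     (if S = {} then 0 else ennreal (unit_ball_vol (real m) * (diameter S / 2) ^ m))"

definition hausdorff_pre :: "nat \<Rightarrow> real \<Rightarrow> 'a::metric_space set \<Rightarrow> ennreal" where
  "hausdorff_pre m \<delta> A =
     Inf {(\<Sum>i. hausdorff_weight m (S i)) | S :: nat \<Rightarrow> 'a set.
            A \<subseteq> (\<Union>i. S i) \<and> (\<forall>i. bounded (S i) \<and> diameter (S i) \<le> \<delta>)}"

definition hausdorff_outer :: "nat \<Rightarrow> 'a::metric_space set \<Rightarrow> ennreal" where
  "hausdorff_outer m A = (SUP \<delta>\<in>{0<..}. hausdorff_pre m \<delta> A)"

text \<open>
  \<^const>\<open>measure_of\<close> returns the null measure unless the given set function is countably additive;
  \<open>emeasure_hausdorff\<close> below excludes this.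
\<close>

definition hausdorff :: "nat \<Rightarrow> 'a::metric_space measure" where
  "hausdorff m = measure_of UNIV (sets borel) (hausdorff_outer m)"

lemma hausdorff_weight_empty [simp]: "hausdorff_weight m {} = 0"
  by (simp add: hausdorff_weight_def)

lemma hausdorff_pre_le:
  assumes "A \<subseteq> (\<Union>i. S i)" "\<And>i. bounded (S i)" "\<And>i. diameter (S i) \<le> \<delta>"
  shows "hausdorff_pre m \<delta> A \<le> (\<Sum>i. hausdorff_weight m (S i))"
  unfolding hausdorff_pre_def using assms by (intro Inf_lower) blast

lemma hausdorff_pre_greatest:
  assumes "\<And>S. A \<subseteq> (\<Union>i. S i) \<Longrightarrow> (\<And>i. bounded (S i)) \<Longrightarrow> (\<And>i. diameter (S i) \<le> \<delta>) \<Longrightarrow>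
             z \<le> (\<Sum>i. hausdorff_weight m (S i))"
  shows "z \<le> hausdorff_pre m \<delta> A"
  unfolding hausdorff_pre_def using assms by (intro Inf_greatest) blast

lemma hausdorff_pre_mono: "A \<subseteq> B \<Longrightarrow> hausdorff_pre m \<delta> A \<le> hausdorff_pre m \<delta> B"
  by (intro hausdorff_pre_greatest hausdorff_pre_le) auto

lemma hausdorff_pre_antimono: "\<delta> \<le> \<epsilon> \<Longrightarrow> hausdorff_pre m \<epsilon> A \<le> hausdorff_pre m \<delta> A"
  by (intro hausdorff_pre_greatest hausdorff_pre_le) (auto intro: order_trans)

lemma hausdorff_pre_empty: "0 \<le> \<delta> \<Longrightarrow> hausdorff_pre m \<delta> {} = 0"
  using hausdorff_pre_le[of "{}" "\<lambda>_. {}" \<delta> m] by simp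

lemma hausdorff_pre_UN:
  "hausdorff_pre m \<delta> (\<Union>i. A i) \<le> (\<Sum>i. hausdorff_pre m \<delta> (A (i::nat)))"
proof (rule ennreal_le_epsilon)
  fix e :: real
  assume e: "0 < e" and fin: "(\<Sum>i. hausdorff_pre m \<delta> (A i)) < top"
  have "\<exists>S. A i \<subseteq> (\<Union>k. S k) \<and> (\<forall>k. bounded (S k) \<and> diameter (S k) \<le> \<delta>) \<and>
          (\<Sum>k. hausdorff_weight m (S k)) \<le> hausdorff_pre m \<delta> (A i) + ennreal (e * (1/2) ^ Suc i)" for i
  proof (rule ccontr)
    assume "\<not> ?thesis"
    then have "hausdorff_pre m \<delta> (A i) + ennreal (e * (1/2) ^ Suc i) \<le> hausdorff_pre m \<delta> (A i)"
      by (intro hausdorff_pre_greatest) (meson linear)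
    moreover have "hausdorff_pre m \<delta> (A i) < top"
      using fin ennreal_suminf_lessD by blast
    moreover have "0 < ennreal (e * (1/2) ^ Suc i)"
      using e by simp
    ultimately show False
      using ennreal_add_left_cancel_le[of "hausdorff_pre m \<delta> (A i)" "ennreal (e * (1/2) ^ Suc i)" 0]
      by (auto simp del: power_Suc)
  qed
  then obtain S where S: "\<And>i. A i \<subseteq> (\<Union>k. S i k)" "\<And>i k. bounded (S i k)"
      "\<And>i k. diameter (S i k) \<le> \<delta>"
      "\<And>i. (\<Sum>k. hausdorff_weight m (S i k)) \<le> hausdorff_pre m \<delta> (A i) + ennreal (e * (1/2) ^ Suc i)"
    by metis
  define T where "T n = (case prod_decode n of (i, k) \<Rightarrow> S i k)" for n
  have "hausdorff_pre m \<delta> (\<Union>i. A i) \<le> (\<Sum>n. hausdorff_weight m (T n))"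
  proof (rule hausdorff_pre_le)
    show "(\<Union>i. A i) \<subseteq> (\<Union>n. T n)"
    proof
      fix x assume "x \<in> (\<Union>i. A i)"
      then obtain i k where "x \<in> S i k" using S(1) by blast
      then have "x \<in> T (prod_encode (i, k))" by (simp add: T_def)
      then show "x \<in> (\<Union>n. T n)" by blast
    qed
  qed (auto simp: T_def S split: prod.split)
  also have "\<dots> = (\<Sum>n. (\<lambda>(i, k). hausdorff_weight m (S i k)) (prod_decode n))"
    by (intro suminf_cong) (simp add: T_def split: prod.split)
  also have "\<dots> = (\<Sum>i. \<Sum>k. hausdorff_weight m (S i k))"
    by (rule suminf_ennreal_2dimen) simp
  also have "\<dots> \<le> (\<Sum>i. hausdorff_pre m \<delta> (A i) + ennreal (e * (1/2) ^ Suc i))"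
    by (intro suminf_le S) auto
  also have "\<dots> = (\<Sum>i. hausdorff_pre m \<delta> (A i)) + (\<Sum>i. ennreal (e * (1/2) ^ Suc i))"
    by (intro suminf_add[symmetric]) auto
  also have "(\<Sum>i. ennreal (e * (1/2) ^ Suc i)) = ennreal e"
    using e sums_mult[OF power_half_series, of e]
    by (intro suminf_ennreal_eq) auto
  finally show "hausdorff_pre m \<delta> (\<Union>i. A i) \<le> (\<Sum>i. hausdorff_pre m \<delta> (A i)) + ennreal e" .
qed

lemma hausdorff_outer_empty: "hausdorff_outer m {} = 0"
  unfolding hausdorff_outer_def by (subst SUP_cong[OF refl hausdorff_pre_empty]) auto

lemma hausdorff_outer_mono: "A \<subseteq> B \<Longrightarrow> hausdorff_outer m A \<le> hausdorff_outer m B"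
  unfolding hausdorff_outer_def by (intro SUP_mono) (auto intro: hausdorff_pre_mono)

lemma hausdorff_outer_UN:
  "hausdorff_outer m (\<Union>i. A i) \<le> (\<Sum>i. hausdorff_outer m (A (i::nat)))"
  unfolding hausdorff_outer_def
  by (intro SUP_least order_trans[OF hausdorff_pre_UN] suminf_le SUP_upper) auto

lemma hausdorff_outer_Un: "hausdorff_outer m (A \<union> B) \<le> hausdorff_outer m A + hausdorff_outer m B"
proof -
  have "hausdorff_outer m (\<Union>i. binaryset A B i) \<le> (\<Sum>i. hausdorff_outer m (binaryset A B i))"
    by (rule hausdorff_outer_UN)
  also have "\<dots> = hausdorff_outer m A + hausdorff_outer m B"
    by (rule suminf_binaryset_eq) (rule hausdorff_outer_empty)
  finally show ?thesis by (simp add: UN_binaryset_eq)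
qed

lemma hausdorff_outer_separated:
  assumes "0 < e" and sep: "\<And>x y. x \<in> A \<Longrightarrow> y \<in> B \<Longrightarrow> e \<le> dist x y"
  shows "hausdorff_outer m A + hausdorff_outer m B \<le> hausdorff_outer m (A \<union> B)"
proof -
  have pre: "hausdorff_pre m \<delta> A + hausdorff_pre m \<delta> B \<le> hausdorff_pre m \<delta> (A \<union> B)"
    if "0 < \<delta>" "\<delta> < e" for \<delta>
  proof (rule hausdorff_pre_greatest)
    fix S :: "nat \<Rightarrow> 'a set"
    assume S: "A \<union> B \<subseteq> (\<Union>i. S i)" "\<And>i. bounded (S i)" "\<And>i. diameter (S i) \<le> \<delta>"
    define P Q where "P i = (if S i \<inter> A = {} then {} else S i)"
      and "Q i = (if S i \<inter> B = {} then {} else S i)" for i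
    have disj: "S i \<inter> A = {} \<or> S i \<inter> B = {}" for i
    proof (rule ccontr)
      assume "\<not> ?thesis"
      then obtain x y where xy: "x \<in> S i" "x \<in> A" "y \<in> S i" "y \<in> B" by blast
      then have "dist x y \<le> diameter (S i)" by (intro diameter_bounded_bound S)
      with sep[of x y] xy S(3)[of i] that show False by linarith
    qed
    have "hausdorff_pre m \<delta> A \<le> (\<Sum>i. hausdorff_weight m (P i))"
    proof (rule hausdorff_pre_le)
      show "A \<subseteq> (\<Union>i. P i)"
      proof
        fix x assume x: "x \<in> A"
        then obtain i where "x \<in> S i" using S(1) by blast
        then have "x \<in> P i" using x by (auto simp: P_def)
        then show "x \<in> (\<Union>i. P i)" by blast
      qed
    qed (use S that in \<open>auto simp: P_def\<close>)
    moreover have "hausdorff_pre m \<delta> B \<le> (\<Sum>i. hausdorff_weight m (Q i))"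
    proof (rule hausdorff_pre_le)
      show "B \<subseteq> (\<Union>i. Q i)"
      proof
        fix x assume x: "x \<in> B"
        then obtain i where "x \<in> S i" using S(1) by blast
        then have "x \<in> Q i" using x by (auto simp: Q_def)
        then show "x \<in> (\<Union>i. Q i)" by blast
      qed
    qed (use S that in \<open>auto simp: Q_def\<close>)
    ultimately have "hausdorff_pre m \<delta> A + hausdorff_pre m \<delta> B
        \<le> (\<Sum>i. hausdorff_weight m (P i)) + (\<Sum>i. hausdorff_weight m (Q i))"
      by (rule add_mono)
    also have "\<dots> = (\<Sum>i. hausdorff_weight m (P i) + hausdorff_weight m (Q i))"
      by (intro suminf_add) auto
    also have "\<dots> \<le> (\<Sum>i. hausdorff_weight m (S i))"
      by (intro suminf_le) (use disj in \<open>auto simp: P_def Q_def\<close>)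
    finally show "hausdorff_pre m \<delta> A + hausdorff_pre m \<delta> B \<le> (\<Sum>i. hausdorff_weight m (S i))" .
  qed
  have "hausdorff_outer m A + hausdorff_outer m B
      = (SUP \<delta>\<in>{0<..}. hausdorff_pre m \<delta> A + hausdorff_pre m \<delta> B)"
    unfolding hausdorff_outer_def
  proof (rule SUP_add_directed_ennreal[symmetric])
    fix i j :: real assume "i \<in> {0<..}" "j \<in> {0<..}"
    then show "\<exists>k\<in>{0<..}. hausdorff_pre m i A + hausdorff_pre m j B
        \<le> hausdorff_pre m k A + hausdorff_pre m k B"
      by (intro bexI[of _ "min i j"] add_mono hausdorff_pre_antimono) auto
  qed
  also have "\<dots> \<le> hausdorff_outer m (A \<union> B)"
  proof (rule SUP_least)
    fix \<delta> :: real assume \<delta>: "\<delta> \<in> {0<..}"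
    define k where "k = min \<delta> (e / 2)"
    have k: "0 < k" "k < e" "k \<le> \<delta>" using \<delta> \<open>0 < e\<close> by (auto simp: k_def)
    have "hausdorff_pre m \<delta> A + hausdorff_pre m \<delta> B \<le> hausdorff_pre m k A + hausdorff_pre m k B"
      using k by (intro add_mono hausdorff_pre_antimono)
    also have "\<dots> \<le> hausdorff_pre m k (A \<union> B)" by (rule pre) (use k in auto)
    also have "\<dots> \<le> hausdorff_outer m (A \<union> B)"
      unfolding hausdorff_outer_def using k by (intro SUP_upper) auto
    finally show "hausdorff_pre m \<delta> A + hausdorff_pre m \<delta> B \<le> hausdorff_outer m (A \<union> B)" .
  qed
  finally show ?thesis .
qed

lemma hausdorff_outer_closed:
  fixes F X :: "'a::metric_space set"
  assumes "closed F"
  shows "hausdorff_outer m (X \<inter> F) + hausdorff_outer m (X - F) \<le> hausdorff_outer m X"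
proof (cases "F = {} \<or> hausdorff_outer m X = top")
  case True
  then show ?thesis by (auto simp: hausdorff_outer_empty)
next
  case False
  then have F: "F \<noteq> {}" and fin: "hausdorff_outer m X < top" by (auto simp: less_top)
  let ?h = "hausdorff_outer m"
  define Y where "Y k = {x \<in> X. 1 / real (Suc k) \<le> infdist x F}" for k
  define R where "R k = Y (Suc k) - Y k" for k
  have incY: "Y i \<subseteq> Y j" if "i \<le> j" for i j
  proof -
    have "1 / real (Suc j) \<le> 1 / real (Suc i)" using that by (intro divide_left_mono) auto
    then show ?thesis by (auto simp only: Y_def intro: order_trans)
  qed
  have R_le: "infdist x F < 1 / real (Suc k)" if "x \<in> R k" for x k
    using that by (auto simp: R_def Y_def)
  have R_ge: "1 / real (Suc (Suc k)) \<le> infdist x F" if "x \<in> R k" for x k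
    using that by (simp add: R_def Y_def)
  have dist_R: "1 / real (Suc (Suc j)) - 1 / real (Suc k) \<le> dist x y"
    if "x \<in> R j" "y \<in> R k" for x y j k
    using R_ge[OF that(1)] R_le[OF that(2)] infdist_triangle[of x F y] by linarith
  have step: "(\<Sum>i<N. ?h (R (2 * i + c))) \<le> ?h (\<Union>i<N. R (2 * i + c))" for c N
  proof (induction N)
    case 0
    show ?case by (simp add: hausdorff_outer_empty)
  next
    case (Suc N)
    have "?h (\<Union>i<N. R (2 * i + c)) + ?h (R (2 * N + c)) \<le> ?h ((\<Union>i<N. R (2 * i + c)) \<union> R (2 * N + c))"
    proof (cases "N = 0")
      case True
      then show ?thesis by (simp add: hausdorff_outer_empty)
    next
      case N: False
      show ?thesis
      proof (rule hausdorff_outer_separated)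
        show "0 < 1 / real (2 * N + c) - 1 / real (Suc (2 * N + c))"
          using N by (simp add: divide_simps)
      next
        fix x y
        assume "x \<in> (\<Union>i<N. R (2 * i + c))" and y: "y \<in> R (2 * N + c)"
        then obtain i where i: "i < N" "x \<in> R (2 * i + c)" by blast
        have "1 / real (2 * N + c) \<le> 1 / real (Suc (Suc (2 * i + c)))"
          using i by (intro divide_left_mono) auto
        with dist_R[OF i(2) y]
        show "1 / real (2 * N + c) - 1 / real (Suc (2 * N + c)) \<le> dist x y" by linarith
      qed
    qed
    moreover have "(\<Union>i<Suc N. R (2 * i + c)) = (\<Union>i<N. R (2 * i + c)) \<union> R (2 * N + c)"
      by (auto simp: lessThan_Suc)
    moreover have "(\<Sum>i<Suc N. ?h (R (2 * i + c))) \<le> ?h (\<Union>i<N. R (2 * i + c)) + ?h (R (2 * N + c))"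
      using Suc.IH by (simp add: add_right_mono)
    ultimately show ?case
      by (simp only:)
  qed
  have RX: "R k \<subseteq> X" for k by (auto simp: R_def Y_def)
  have part: "(\<Sum>i<N. ?h (R (2 * i + c))) \<le> ?h X" for c N
    using RX by (intro order_trans[OF step] hausdorff_outer_mono) blast
  have split: "(\<Sum>i<2 * N. f i) = (\<Sum>i<N. f (2 * i + 0)) + (\<Sum>i<N. f (2 * i + 1))"
    for f :: "nat \<Rightarrow> ennreal" and N
    by (induction N) (auto simp: algebra_simps)
  have "(\<Sum>i. ?h (R i)) \<le> ?h X + ?h X"
  proof (rule suminf_le_const)
    fix N
    have "(\<Sum>i<N. ?h (R i)) \<le> (\<Sum>i<2 * N. ?h (R i))"
      by (rule sum_mono2) auto
    also have "\<dots> \<le> ?h X + ?h X"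
      unfolding split by (intro add_mono part)
    finally show "(\<Sum>i<N. ?h (R i)) \<le> ?h X + ?h X" .
  qed auto
  also have "\<dots> < top" using fin by simp
  finally have sum_fin: "(\<Sum>i. ?h (R i)) < top" .
  define r where "r i = enn2real (?h (R i))" for i
  have r: "?h (R i) = ennreal (r i)" for i
    using ennreal_suminf_lessD[OF sum_fin, of i] by (simp add: r_def)
  have r0: "0 \<le> r i" for i by (simp add: r_def)
  have sr: "summable r"
    using sum_fin r0 unfolding r by (intro summable_suminf_not_top) auto
  have main: "?h (X \<inter> F) + ?h (X - F) \<le> ?h X + (\<Sum>i. ?h (R (i + k)))" for k
  proof -
    have "X - F \<subseteq> Y k \<union> (\<Union>i. R (i + k))"
    proof
      fix x assume x: "x \<in> X - F"
      then have "0 < infdist x F"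
        using assms F infdist_pos_not_in_closed by blast
      then obtain n where "inverse (real (Suc n)) < infdist x F"
        using reals_Archimedean by blast
      then have "x \<in> Y n" using x by (simp add: Y_def inverse_eq_divide)
      then have n: "x \<in> Y (n + k)" using incY[of n "n + k"] by auto
      show "x \<in> Y k \<union> (\<Union>i. R (i + k))"
        using n by (induction n) (auto simp: R_def)
    qed
    then have "?h (X - F) \<le> ?h (Y k) + ?h (\<Union>i. R (i + k))"
      by (rule order_trans[OF hausdorff_outer_mono hausdorff_outer_Un])
    also have "\<dots> \<le> ?h (Y k) + (\<Sum>i. ?h (R (i + k)))"
      by (intro add_left_mono hausdorff_outer_UN)
    finally have "?h (X \<inter> F) + ?h (X - F) \<le> (?h (X \<inter> F) + ?h (Y k)) + (\<Sum>i. ?h (R (i + k)))"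
      by (simp add: add.assoc add_left_mono)
    also have "?h (X \<inter> F) + ?h (Y k) \<le> ?h ((X \<inter> F) \<union> Y k)"
    proof (rule hausdorff_outer_separated)
      fix x y assume x: "x \<in> X \<inter> F" and y: "y \<in> Y k"
      then have "1 / real (Suc k) \<le> infdist y F" by (simp add: Y_def)
      also have "\<dots> \<le> dist y x" using x by (intro infdist_le) auto
      finally show "1 / real (Suc k) \<le> dist x y" by (simp add: dist_commute)
    qed simp
    also have "\<dots> \<le> ?h X" by (intro hausdorff_outer_mono) (auto simp: Y_def)
    finally show ?thesis by (simp add: add_right_mono)
  qed
  show ?thesis
  proof (rule ennreal_le_epsilon)
    fix e :: real assume "0 < e"
    then obtain k where "norm (\<Sum>i. r (i + k)) < e"
      using suminf_exist_split[OF _ sr] by blast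
    moreover have "(\<Sum>i. ?h (R (i + k))) = ennreal (\<Sum>i. r (i + k))"
      unfolding r using sr r0 by (intro suminf_ennreal2) (auto intro: summable_ignore_initial_segment)
    ultimately have "(\<Sum>i. ?h (R (i + k))) \<le> ennreal e"
      by (auto intro!: ennreal_leI)
    then show "?h (X \<inter> F) + ?h (X - F) \<le> ?h X + ennreal e"
      using main[of k] by (meson add_left_mono order_trans)
  qed
qed

lemma measure_space_hausdorff: "measure_space UNIV (sets borel) (hausdorff_outer m)"
proof -
  let ?L = "lambda_system UNIV (Pow UNIV) (hausdorff_outer m)"
  have "outer_measure_space (Pow UNIV) (hausdorff_outer m)"
    by (auto simp: outer_measure_space_def positive_def increasing_def countably_subadditive_def
        hausdorff_outer_empty intro: hausdorff_outer_mono hausdorff_outer_UN)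
  then have L: "measure_space UNIV ?L (hausdorff_outer m)"
    by (rule sigma_algebra.caratheodory_lemma[OF sigma_algebra_Pow])
  have "F \<in> ?L" if "closed F" for F
  proof -
    have "hausdorff_outer m (X \<inter> F) + hausdorff_outer m (X - F) = hausdorff_outer m X" for X
      using hausdorff_outer_closed[OF that, of m X] hausdorff_outer_Un[of m "X \<inter> F" "X - F"]
      by (simp add: Int_Diff_Un antisym)
    then show ?thesis
      by (simp add: algebra.lambda_system_eq[OF algebra_Pow] del: Pow_UNIV)
  qed
  then have "sigma_sets UNIV (Collect closed) \<subseteq> ?L"
    using L by (intro sigma_algebra.sigma_sets_subset) (auto simp: measure_space_def)
  then have "sets borel \<subseteq> ?L"
    by (simp add: borel_eq_closed)
  with L show ?thesis
    using sets.sigma_algebra_axioms[of "borel :: 'a measure"]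
    unfolding measure_space_def countably_additive_def positive_def space_borel by blast
qed

lemma sets_hausdorff [simp]: "sets (hausdorff m) = sets borel"
  using sets.sigma_sets_eq[of borel] by (simp add: hausdorff_def)

lemma space_hausdorff [simp]: "space (hausdorff m) = UNIV"
  by (simp add: hausdorff_def)

lemma emeasure_hausdorff: "A \<in> sets borel \<Longrightarrow> emeasure (hausdorff m) A = hausdorff_outer m A"
  using measure_space_hausdorff[of m] sets.sigma_sets_eq[of "borel :: 'a measure"]
  by (intro emeasure_measure_of[OF hausdorff_def]) (auto simp: measure_space_def)


section \<open>Norms with values in \<open>[0, \<infinity>]\<close>\<close>

text \<open>Only meant for positive exponents.\<close>

definition epowr :: "ennreal \<Rightarrow> real \<Rightarrow> ennreal" where
  "epowr x p = (if x = top then top else ennreal (enn2real x powr p))"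

definition Lp_enorm :: "real \<Rightarrow> 'a measure \<Rightarrow> ('a \<Rightarrow> ennreal) \<Rightarrow> ennreal" where
  "Lp_enorm p M f = epowr (\<integral>\<^sup>+x. epowr (f x) p \<partial>M) (1 / p)"

text \<open>
  Functions on \<open>[0,\<infinity>)\<close> are functions on the reals whose values at negative arguments are
  irrelevant. Since \<open>A 0 = 0\<close>, ``not identically \<open>\<infinity>\<close>'' refers to positive arguments.
\<close>

definition young_function :: "(real \<Rightarrow> ennreal) \<Rightarrow> bool" where
  "young_function A \<longleftrightarrow>
     A 0 = 0 \<and>
     (\<forall>s\<ge>0. \<forall>t\<ge>0. \<forall>\<theta>\<in>{0..1}.
        A (\<theta> * s + (1 - \<theta>) * t) \<le> ennreal \<theta> * A s + ennreal (1 - \<theta>) * A t) \<and>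
     (\<forall>t>0. (A \<longlongrightarrow> A t) (at_left t)) \<and>
     (\<exists>t>0. A t \<noteq> 0) \<and> (\<exists>t>0. A t \<noteq> top)"

definition equivalent_near_infinity :: "(real \<Rightarrow> ennreal) \<Rightarrow> (real \<Rightarrow> ennreal) \<Rightarrow> bool" where
  "equivalent_near_infinity A B \<longleftrightarrow>
     (\<exists>k\<ge>1. eventually (\<lambda>t. A (t / k) \<le> B t \<and> B t \<le> A (k * t)) at_top)"

text \<open>The Young functions generating the space \<open>exp L\<^sup>\<sigma>\<close>.\<close>

definition exp_young :: "real \<Rightarrow> (real \<Rightarrow> ennreal) \<Rightarrow> bool" where
  "exp_young \<sigma> A \<longleftrightarrow>
     young_function A \<and> equivalent_near_infinity A (\<lambda>t. ennreal (exp (t powr \<sigma>) - 1))"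

definition luxemburg_norm ::
  "(real \<Rightarrow> ennreal) \<Rightarrow> 'a measure \<Rightarrow> ('a \<Rightarrow> 'b::real_normed_vector) \<Rightarrow> ennreal" where
  "luxemburg_norm A M f =
     Inf {ennreal l | l. 0 < l \<and> (\<integral>\<^sup>+x. A (norm (f x) / l) \<partial>M) \<le> 1}"

definition decreasing_rearrangement ::
  "'a measure \<Rightarrow> ('a \<Rightarrow> 'b::real_normed_vector) \<Rightarrow> real \<Rightarrow> ennreal" where
  "decreasing_rearrangement M f s =
     Inf {ennreal t | t. 0 \<le> t \<and> emeasure M {x \<in> space M. t < norm (f x)} \<le> ennreal s}"

text \<open>The norm of \<open>L\<^bsup>\<infinity>,q;-1\<^esup>(M)\<close>, for a finite measure \<open>M\<close>.\<close>

definition lorentz_zygmund_norm ::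
  "real \<Rightarrow> 'a measure \<Rightarrow> ('a \<Rightarrow> 'b::real_normed_vector) \<Rightarrow> ennreal" where
  "lorentz_zygmund_norm q M f =
     Lp_enorm q (lebesgue_on {0<..<measure M (space M)})
       (\<lambda>s. ennreal (s powr (- 1 / q) / ln (1 + measure M (space M) / s))
              * decreasing_rearrangement M f s)"


section \<open>Distributional symmetric gradient\<close>

definition partial :: "'n \<Rightarrow> (real^'n \<Rightarrow> real) \<Rightarrow> real^'n \<Rightarrow> real" where
  "partial j \<phi> x = frechet_derivative \<phi> (at x) (axis j 1)"

fun iterated_partial :: "'n list \<Rightarrow> (real^'n \<Rightarrow> real) \<Rightarrow> real^'n \<Rightarrow> real" where
  "iterated_partial [] \<phi> = \<phi>"
| "iterated_partial (j # js) \<phi> = partial j (iterated_partial js \<phi>)"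

text \<open>
  \<open>\<phi>\<close> is of class \<open>C\<^sup>\<infinity>\<close> iff all its iterated partial derivatives are (Frechet) differentiable.
\<close>

definition test_functions :: "(real^'n) set \<Rightarrow> (real^'n \<Rightarrow> real) set" where
  "test_functions \<Omega> = {\<phi>.
     (\<forall>js x. iterated_partial js \<phi> differentiable (at x)) \<and>
     compact (closure {x. \<phi> x \<noteq> 0}) \<and> closure {x. \<phi> x \<noteq> 0} \<subseteq> \<Omega>}"

definition L1_loc :: "(real^'n) set \<Rightarrow> (real^'n \<Rightarrow> 'b::{banach, second_countable_topology}) set" where
  "L1_loc \<Omega> = {f. \<forall>K. compact K \<and> K \<subseteq> \<Omega> \<longrightarrow> set_integrable lebesgue K f}"

text \<open>The \<open>(i,j)\<close> entry \<open>\<partial>\<^sub>j u\<^sub>i\<close> of the distributional gradient, as a functional on test functions.\<close>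

definition distr_grad ::
  "(real^'n) set \<Rightarrow> (real^'n \<Rightarrow> real^'n) \<Rightarrow> 'n \<Rightarrow> 'n \<Rightarrow> (real^'n \<Rightarrow> real) \<Rightarrow> real" where
  "distr_grad \<Omega> u i j \<phi> = - (LINT x:\<Omega>|lebesgue. u x $ i * partial j \<phi> x)"

definition distr_sym_grad ::
  "(real^'n) set \<Rightarrow> (real^'n \<Rightarrow> real^'n) \<Rightarrow> 'n \<Rightarrow> 'n \<Rightarrow> (real^'n \<Rightarrow> real) \<Rightarrow> real" where
  "distr_sym_grad \<Omega> u i j \<phi> = (distr_grad \<Omega> u i j \<phi> + distr_grad \<Omega> u j i \<phi>) / 2"

definition has_sym_grad ::
  "(real^'n) set \<Rightarrow> (real^'n \<Rightarrow> real^'n) \<Rightarrow> (real^'n \<Rightarrow> real^'n^'n) \<Rightarrow> bool" where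
  "has_sym_grad \<Omega> u E \<longleftrightarrow>
     E \<in> L1_loc \<Omega> \<and>
     (\<forall>\<phi>\<in>test_functions \<Omega>. \<forall>i j.
        distr_sym_grad \<Omega> u i j \<phi> = (LINT x:\<Omega>|lebesgue. E x $ i $ j * \<phi> x))"

text \<open>
  A representative of the (almost everywhere unique) density; \<^const>\<open>norm\<close> on matrices is the
  Frobenius norm. Unspecified if the distribution is not a locally integrable function.
\<close>

definition sym_grad :: "(real^'n) set \<Rightarrow> (real^'n \<Rightarrow> real^'n) \<Rightarrow> real^'n \<Rightarrow> real^'n^'n" where
  "sym_grad \<Omega> u = (SOME E. has_sym_grad \<Omega> u E)"

definition sym_grad_norm :: "real \<Rightarrow> (real^'n) set \<Rightarrow> (real^'n \<Rightarrow> real^'n) \<Rightarrow> ennreal" where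
  "sym_grad_norm p \<Omega> u = Lp_enorm p (lebesgue_on \<Omega>) (\<lambda>x. ennreal (norm (sym_grad \<Omega> u x)))"

definition E1 :: "real \<Rightarrow> (real^'n) set \<Rightarrow> (real^'n \<Rightarrow> real^'n) set" where
  "E1 p \<Omega> = {u \<in> L1_loc \<Omega>. (\<exists>E. has_sym_grad \<Omega> u E) \<and> sym_grad_norm p \<Omega> u < top}"

text \<open>
  Elements of \<open>C\<^sub>b(S)\<close>, for closed \<open>S\<close>, are total functions constrained on \<open>S\<close> only.
\<close>

definition C_b :: "(real^'n) set \<Rightarrow> (real^'n \<Rightarrow> real^'n) set" where
  "C_b S = {u. continuous_on S u \<and> bounded {x \<in> S. u x \<noteq> 0}}"

definition boundary_measure :: "(real^'n) set \<Rightarrow> (real^'n) measure" where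
  "boundary_measure \<Omega> = restrict_space (hausdorff (CARD('n) - 1)) (frontier \<Omega>)"

end

theory Submission
  imports Defs
begin

text \<open>
  Along a ray \<open>x + s v\<close> the derivative of \<open>u \<cdot> v\<close> is \<open>\<E>u v \<cdot> v\<close>. Integrating from \<open>x\<close> to the first
  point \<open>\<zeta>\<close> at which the ray meets the boundary (or to infinity, where \<open>u\<close> vanishes), and then averaging
  over \<open>v\<close> in the unit ball, bounds \<open>\<bar>u(x)\<bar>\<close> by the Riesz potential of order one of \<open>\<bar>\<E>u\<bar>\<close> plus the average
  of \<open>\<bar>u(\<zeta>)\<bar>\<close>.

  The cone over a set of diameter \<open>\<rho>\<close> at distance \<open>R\<close> has measure \<open>O((\<rho> / R)\<^sup>n\<^sup>-\<^sup>1)\<close>, and \<open>\<bar>x - y\<bar>\<^sup>1\<^sup>-\<^sup>n\<close> has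
  bounded \<open>\<mu>\<close>-integral because \<open>\<alpha> > n - 1\<close>. So the push-forward of \<open>\<mu> \<otimes> dv\<close> under the hitting point
  is at most a multiple of \<open>\<H>\<^sup>n\<^sup>-\<^sup>1\<close>, which is used through coverings only.

  Averaging over a superlevel set \<open>G\<close> with \<open>\<mu>(G) \<ge> 2\<^sup>-\<^sup>k\<close> and splitting \<open>\<bar>\<E>u\<bar>\<close> into dyadic levels
  of norms \<open>c\<^sub>j\<close> (with \<open>\<Sum> c\<^sub>j\<^sup>n \<le> 1\<close> after normalisation by \<open>\<Lambda>\<close>) and \<open>u\<close> on the boundary into the levels
  \<open>a\<^sub>j = u\<^sup>*(2\<^sup>-\<^sup>j)\<close> gives
  \<open>u\<^sup>*\<^sub>\<mu>(2\<^sup>-\<^sup>k) \<le> C (\<Lambda> (1 + \<Sum>\<^sub>j\<^sub><\<^sub>k c\<^sub>j + \<Sum>\<^sub>i 2\<^sup>-\<^sup>i c\<^sub>k\<^sub>+\<^sub>i) + \<Sum>\<^sub>i 2\<^sup>-\<^sup>i a\<^sub>k\<^sub>+\<^sub>i)\<close>.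
  The exponential estimate follows from \<open>\<Sum>\<^sub>j\<^sub><\<^sub>k c\<^sub>j \<le> k\<^sup>1\<^sup>-\<^sup>1\<^sup>/\<^sup>n\<close>, the Lorentz--Zygmund estimate from the
  discrete Hardy inequality.
\<close>

section \<open>Smooth bump functions\<close>

text \<open>Only the symmetric part of the gradient is controlled and the boundary has no
  regularity, so the argument cannot rest on Korn or trace inequalities. Contraction with
  \<open>v $ i * v $ j\<close> does not see the difference between the two gradients; this is why
  only the component \<open>u \<bullet> v\<close> is followed, and only along \<open>v\<close>. A
  density known almost everywhere says nothing about one fixed ray, hence mollified rays and a lower
  limit. Measurability of the hitting point is never discussed: it is replaced by Borel sets of
  directions from which a small piece of the boundary is visible at all, and the size of these sets
  by a measurable majorant in \<open>x\<close>. The exponent \<open>n\<close> is critical for the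
  Riesz potential: integrating the kernel in \<open>y\<close>, a level \<open>j\<close> costs
  \<open>c j\<close> with no decay in \<open>j\<close>. For levels above \<open>k\<close>,
  integrating in \<open>x\<close> over \<open>G\<close> gains \<open>2 ^ (k - j)\<close>, so that
  only the \<open>k\<close> lower levels accumulate, and these produce the logarithm. The strict
  inequality \<open>\<alpha> > n - 1\<close> enters as the convergence of a geometric series of
  ratio \<open>2 powr (n - 1 - \<alpha>)\<close>.\<close>

definition flat :: "nat \<Rightarrow> real \<Rightarrow> real" where
  "flat k t = (if 0 < t then exp (- 1 / t) / t ^ k else 0)"

lemma flat_nonneg: "0 \<le> flat k t"
  by (simp add: flat_def)

lemma flat_tendsto_0: "(flat k \<longlongrightarrow> 0) (at_right 0)"
proof -
  have "((\<lambda>s::real. s ^ k / exp s) \<longlongrightarrow> 0) at_top"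
    by (rule tendsto_power_div_exp_0)
  then have "((\<lambda>t::real. inverse t ^ k / exp (inverse t)) \<longlongrightarrow> 0) (at_right 0)"
    by (rule filterlim_compose[OF _ filterlim_inverse_at_top_right])
  moreover have "eventually (\<lambda>t::real. inverse t ^ k / exp (inverse t) = flat k t) (at_right 0)"
    by (intro eventually_at_right_less[THEN eventually_mono])
       (simp add: flat_def field_simps exp_minus power_inverse)
  ultimately show ?thesis
    by (rule Lim_transform_eventually)
qed

text \<open>The index \<open>k\<close> is there so that the span of the family is closed under
  differentiation: a derivative only adds powers of \<open>1 / t\<close>. At 0 the right difference
  quotient of \<open>flat k\<close> is \<open>flat (Suc k)\<close>, which tends to 0, and the left
  one vanishes.\<close>

lemma flat_has_derivative:
  "(flat k has_real_derivative flat (k + 2) t - real k * flat (k + 1) t) (at t)"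
proof -
  consider "t < 0" | "t = 0" | "0 < t" by linarith
  then show ?thesis
  proof cases
    case 1
    have "((\<lambda>_. 0) has_real_derivative 0) (at t)" by simp
    moreover have "eventually (\<lambda>s. s < 0) (nhds t)"
      using 1 by (rule order_tendstoD(2)[OF filterlim_ident])
    then have "eventually (\<lambda>s. 0 = flat k s) (nhds t)"
      by (rule eventually_mono) (simp add: flat_def)
    ultimately have "(flat k has_real_derivative 0) (at t)"
      using DERIV_cong_ev[OF refl, of "\<lambda>_. 0" "flat k" t 0 0] by simp
    then show ?thesis using 1 by (simp add: flat_def)
  next
    case 2
    have "((\<lambda>h. (flat k h - flat k 0) / h) \<longlongrightarrow> 0) (at_right 0)"
    proof (rule Lim_transform_eventually[OF flat_tendsto_0[of "Suc k"]])
      show "eventually (\<lambda>h. flat (Suc k) h = (flat k h - flat k 0) / h) (at_right 0)"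
        by (intro eventually_at_right_less[THEN eventually_mono]) (simp add: flat_def)
    qed
    moreover have "((\<lambda>h. (flat k h - flat k 0) / h) \<longlongrightarrow> 0) (at_left 0)"
    proof (rule Lim_transform_eventually[of "\<lambda>_. 0"])
      show "eventually (\<lambda>h. 0 = (flat k h - flat k 0) / h) (at_left 0)"
        unfolding eventually_at_filter by (intro always_eventually) (auto simp: flat_def)
    qed simp
    ultimately have "(\<lambda>h. (flat k h - flat k 0) / h) \<midarrow>0\<rightarrow> 0"
      by (simp add: filterlim_split_at)
    then show ?thesis
      unfolding DERIV_def using 2 by (simp add: flat_def)
  next
    case 3
    have "((\<lambda>t. exp (- 1 / t) / t ^ k) has_real_derivative
           flat (k + 2) t - real k * flat (k + 1) t) (at t)"
    proof (cases k)
      case 0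
      show ?thesis
        unfolding 0 by (rule derivative_eq_intros refl | use 3 in \<open>simp add: flat_def power2_eq_square\<close>)+
    next
      case (Suc m)
      show ?thesis
        unfolding Suc
        by (rule derivative_eq_intros refl
            | use 3 in \<open>simp add: flat_def power2_eq_square field_simps\<close>)+
    qed
    moreover have "eventually (\<lambda>s. 0 < s) (nhds t)"
      using 3 by (rule order_tendstoD(1)[OF filterlim_ident])
    then have "eventually (\<lambda>s. exp (- 1 / s) / s ^ k = flat k s) (nhds t)"
      by (rule eventually_mono) (simp add: flat_def)
    ultimately show ?thesis
      by (simp add: DERIV_cong_ev[OF refl _ refl])
  qed
qed

lemma continuous_on_flat: "continuous_on S (flat k)"
  using flat_has_derivative DERIV_isCont continuous_at_imp_continuous_on by blast

definition bump :: "real \<Rightarrow> real^'n \<Rightarrow> real^'n \<Rightarrow> real" where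
  "bump r c x = flat 0 (r\<^sup>2 - (norm (x - c))\<^sup>2)"

text \<open>Membership in \<open>test_functions\<close> asks for differentiability of all iterated
  partial derivatives. The rules generate a class that contains the bump and is closed under
  \<open>partial\<close>, so this becomes an induction on the list of indices and no higher
  derivative is ever computed.\<close>

inductive_set bump_derivs :: "real \<Rightarrow> real^'n \<Rightarrow> (real^'n \<Rightarrow> real) set" for r c where
  flat: "(\<lambda>x. flat k (r\<^sup>2 - (norm (x - c))\<^sup>2)) \<in> bump_derivs r c"
| coord: "f \<in> bump_derivs r c \<Longrightarrow> (\<lambda>x. (x - c) $ i * f x) \<in> bump_derivs r c"
| scale: "f \<in> bump_derivs r c \<Longrightarrow> (\<lambda>x. a * f x) \<in> bump_derivs r c"
| add: "f \<in> bump_derivs r c \<Longrightarrow> g \<in> bump_derivs r c \<Longrightarrow> (\<lambda>x. f x + g x) \<in> bump_derivs r c"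

lemma bump_in_derivs: "bump r c \<in> bump_derivs r c"
  unfolding bump_def[abs_def] by (rule bump_derivs.flat)

lemma bump_derivs_has_derivative:
  assumes "f \<in> bump_derivs r (c::real^'n)"
  shows "\<exists>g. (\<forall>j. g j \<in> bump_derivs r c) \<and>
             (\<forall>x. (f has_derivative (\<lambda>h. \<Sum>j\<in>UNIV. h $ j * g j x)) (at x))"
  using assms
proof induction
  case (flat k)
  \<comment> \<open>The coefficient from the chain rule, bracketed so that it is literally built by
    \<open>scale\<close>, \<open>coord\<close>, \<open>add\<close> and \<open>flat\<close>.\<close>
  define g where "g j x = (- 2) * ((x - c) $ j * (flat (k + 2) (r\<^sup>2 - (norm (x - c))\<^sup>2)
      + (- real k) * flat (k + 1) (r\<^sup>2 - (norm (x - c))\<^sup>2)))" for j x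
  have "g j \<in> bump_derivs r c" for j
    unfolding g_def by (intro bump_derivs.intros)
  moreover have "((\<lambda>x. flat k (r\<^sup>2 - (norm (x - c))\<^sup>2)) has_derivative
      (\<lambda>h. \<Sum>j\<in>UNIV. h $ j * g j x)) (at x)" for x
  proof -
    have "((\<lambda>x. r\<^sup>2 - (x - c) \<bullet> (x - c)) has_derivative (\<lambda>h. - (2 * (h \<bullet> (x - c))))) (at x)"
      by (rule derivative_eq_intros refl | simp add: inner_commute)+
    from has_derivative_compose[OF this flat_has_derivative[unfolded has_field_derivative_def]]
    have d: "((\<lambda>x. flat k (r\<^sup>2 - (norm (x - c))\<^sup>2)) has_derivative
       (\<lambda>h. (flat (k + 2) (r\<^sup>2 - (norm (x - c))\<^sup>2) - real k * flat (k + 1) (r\<^sup>2 - (norm (x - c))\<^sup>2))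
              * (- (2 * (h \<bullet> (x - c)))))) (at x)"
      by (simp add: power2_norm_eq_inner)
    have e: "h \<bullet> (x - c) = (\<Sum>j\<in>UNIV. h $ j * (x - c) $ j)" for h
      by (simp add: inner_vec_def)
    have "w * - (2 * (h \<bullet> (x - c))) = (\<Sum>j\<in>UNIV. h $ j * (- 2 * ((x - c) $ j * w)))" for h and w :: real
      unfolding e sum_distrib_left sum_negf[symmetric] by (intro sum.cong refl) (simp del: vector_minus_component)
    then show ?thesis
      by (intro has_derivative_eq_rhs[OF d]) (simp add: g_def del: vector_minus_component)
  qed
  ultimately show ?case by blast
next
  case (coord f i)
  then obtain g where g: "\<And>j. g j \<in> bump_derivs r c"
    "\<And>x. (f has_derivative (\<lambda>h. \<Sum>j\<in>UNIV. h $ j * g j x)) (at x)" by blast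
  \<comment> \<open>Product rule; the Kronecker delta is kept as a scalar factor so that
    \<open>scale\<close> covers both of its values.\<close>
  define g' where "g' j x = (if j = i then 1 else 0) * f x + (x - c) $ i * g j x" for j x
  have "g' j \<in> bump_derivs r c" for j
    unfolding g'_def by (intro bump_derivs.intros g coord)
  moreover have "((\<lambda>x. (x - c) $ i * f x) has_derivative (\<lambda>h. \<Sum>j\<in>UNIV. h $ j * g' j x)) (at x)" for x
  proof -
    have d: "((\<lambda>x. (x - c) $ i) has_derivative (\<lambda>h. h $ i)) (at x)"
      by (rule derivative_eq_intros refl bounded_linear.has_derivative[OF bounded_linear_vec_nth] | simp)+
    have "(\<Sum>j\<in>UNIV. h $ j * ((if j = i then 1 else 0) * f x)) = h $ i * f x" for h :: "real^'n"
      by (simp add: if_distrib[of "\<lambda>x. x * _"] if_distrib[of "\<lambda>x. _ * x"] sum.delta cong: if_cong)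
    then have e: "(\<Sum>j\<in>UNIV. h $ j * g' j x) = h $ i * f x + (\<Sum>j\<in>UNIV. h $ j * ((x - c) $ i * g j x))" for h
      unfolding g'_def distrib_left sum.distrib by simp
    show ?thesis
      by (rule has_derivative_eq_rhs[OF has_derivative_mult[OF d g(2)]])
         (simp add: e sum_distrib_left mult.left_commute add.commute del: vector_minus_component)
  qed
  ultimately show ?case by blast
next
  case (scale f a)
  then obtain g where g: "\<And>j. g j \<in> bump_derivs r c"
    "\<And>x. (f has_derivative (\<lambda>h. \<Sum>j\<in>UNIV. h $ j * g j x)) (at x)" by blast
  have "((\<lambda>x. a * f x) has_derivative (\<lambda>h. \<Sum>j\<in>UNIV. h $ j * (a * g j x))) (at x)" for x
    by (rule has_derivative_eq_rhs[OF has_derivative_mult_right[OF g(2)]])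
       (auto simp: sum_distrib_left algebra_simps)
  with g(1) show ?case by (intro exI[of _ "\<lambda>j x. a * g j x"]) (auto intro: bump_derivs.intros)
next
  case (add f f')
  then obtain g g' where g: "\<And>j. g j \<in> bump_derivs r c" "\<And>j. g' j \<in> bump_derivs r c"
    "\<And>x. (f has_derivative (\<lambda>h. \<Sum>j\<in>UNIV. h $ j * g j x)) (at x)"
    "\<And>x. (f' has_derivative (\<lambda>h. \<Sum>j\<in>UNIV. h $ j * g' j x)) (at x)" by blast
  have "((\<lambda>x. f x + f' x) has_derivative (\<lambda>h. \<Sum>j\<in>UNIV. h $ j * (g j x + g' j x))) (at x)" for x
    by (rule has_derivative_eq_rhs[OF has_derivative_add[OF g(3,4)]])
       (auto simp: sum.distrib algebra_simps)
  with g(1,2) show ?case by (intro exI[of _ "\<lambda>j x. g j x + g' j x"]) (auto intro: bump_derivs.intros)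
qed

lemma partial_bump_derivs:
  assumes "f \<in> bump_derivs r (c::real^'n)"
  shows "partial j f \<in> bump_derivs r c" "f differentiable (at x)"
proof -
  obtain g where g: "\<And>j. g j \<in> bump_derivs r c"
    "\<And>x. (f has_derivative (\<lambda>h. \<Sum>j\<in>UNIV. h $ j * g j x)) (at x)"
    using bump_derivs_has_derivative[OF assms] by blast
  have "partial j f = g j"
    unfolding partial_def fun_eq_iff frechet_derivative_at[OF g(2), symmetric]
    by (auto simp: axis_def if_distrib[of "\<lambda>x. x * _"] sum.delta cong: if_cong)
  then show "partial j f \<in> bump_derivs r c" using g(1) by simp
  show "f differentiable (at x)" using g(2) differentiableI by blast
qed

lemma bump_smooth: "iterated_partial js (bump r c) differentiable (at x)"
proof -
  have "iterated_partial js (bump r c) \<in> bump_derivs r c"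
    by (induction js) (simp_all add: bump_in_derivs partial_bump_derivs)
  then show ?thesis by (rule partial_bump_derivs)
qed

lemma bump_nonzero_iff: "0 < r \<Longrightarrow> bump r c x \<noteq> 0 \<longleftrightarrow> x \<in> ball c r"
  using power_strict_mono[of "dist c x" r 2] power_mono[of r "dist c x" 2]
  by (auto simp: bump_def flat_def dist_norm norm_minus_commute not_less[symmetric])

lemma bump_nonneg: "0 \<le> bump r c x"
  by (simp add: bump_def flat_nonneg)

lemma bump_test_function:
  assumes "0 < r" "cball c r \<subseteq> \<Omega>"
  shows "bump r c \<in> test_functions \<Omega>"
proof -
  have *: "closure {x. bump r c x \<noteq> 0} = cball c r"
    using closure_ball[OF assms(1), of c] by (simp add: bump_nonzero_iff[OF assms(1)] ball_def)
  then show ?thesis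
    unfolding test_functions_def mem_Collect_eq * using assms bump_smooth by auto
qed

lemma bump_translate: "bump r (c + d) x = bump r c (x - d)"
  by (simp add: bump_def algebra_simps)

lemma bump_has_derivative:
  "(bump r c has_derivative (\<lambda>h. \<Sum>j\<in>UNIV. h $ j * partial j (bump r c) x)) (at x)"
proof -
  obtain g where g:
    "\<And>x. (bump r c has_derivative (\<lambda>h. \<Sum>j\<in>UNIV. h $ j * g j x)) (at x)"
    using bump_derivs_has_derivative[OF bump_in_derivs] by blast
  have "partial j (bump r c) = g j" for j
    unfolding partial_def fun_eq_iff frechet_derivative_at[OF g, symmetric]
    by (auto simp: axis_def if_distrib[of "\<lambda>x. x * _"] sum.delta cong: if_cong)
  then show ?thesis using g by simp
qed

text \<open>The chain rule for \<open>k = 0\<close>, where only \<open>flat 2\<close> survives. The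
  closed form yields joint continuity in centre and argument, vanishing off the ball, and
  translation invariance.\<close>

lemma partial_bump:
  "partial j (bump r c) x = - 2 * flat 2 (r\<^sup>2 - (norm (x - c))\<^sup>2) * (x - c) $ j"
proof -
  have "((\<lambda>x. r\<^sup>2 - (x - c) \<bullet> (x - c)) has_derivative (\<lambda>h. - (2 * (h \<bullet> (x - c))))) (at x)"
    by (rule derivative_eq_intros refl | simp add: inner_commute)+
  from has_derivative_compose[OF this flat_has_derivative[of 0, unfolded has_field_derivative_def]]
  have "(bump r c has_derivative (\<lambda>h. flat 2 (r\<^sup>2 - (norm (x - c))\<^sup>2) * (- (2 * (h \<bullet> (x - c)))))) (at x)"
    by (simp only: bump_def[abs_def] power2_norm_eq_inner) (simp add: numeral_2_eq_2)
  from fun_cong[OF frechet_derivative_at[OF this], of "axis j 1"] show ?thesis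
    unfolding partial_def by (simp add: inner_axis' algebra_simps)
qed

section \<open>The Riesz kernel and cones\<close>

text \<open>Dyadic shells about \<open>y\<close>: where
  \<open>r / 2 ^ Suc i \<le> dist x y < r / 2 ^ i\<close>, the kernel is at most
  \<open>(2 ^ Suc i / r) ^ m\<close>, and the shell lies in a ball of measure at most
  \<open>K * (r / 2 ^ i) powr b\<close>. The products form a geometric series of ratio
  \<open>2 powr (m - b)\<close>, convergent because \<open>m < b\<close>. The part of
  \<open>D\<close> outside the ball of radius \<open>r\<close> gives the last term.\<close>

lemma nn_integral_kernel_le:
  fixes \<nu> :: "'a::euclidean_space measure"
  assumes sets: "sets \<nu> = sets borel"
    and growth: "\<And>r. 0 < r \<Longrightarrow> emeasure \<nu> (ball y r) \<le> ennreal (K * r powr b)"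
    and K: "0 \<le> K" and b: "real m < b" and r: "0 < r" and D: "D \<in> sets borel"
  shows "(\<integral>\<^sup>+x\<in>D. ennreal (1 / dist x y ^ m) \<partial>\<nu>)
    \<le> ennreal (2 ^ m * K * r powr (b - m) / (1 - 2 powr (m - b))) + ennreal (1 / r ^ m) * emeasure \<nu> D"
proof -
  have key: "ennreal (1 / dist x y ^ m) * indicator D x
     \<le> (\<Sum>i. ennreal ((2 ^ Suc i / r) ^ m) * indicator (ball y (r / 2 ^ i)) x) + ennreal (1 / r ^ m) * indicator D x"
    (is "?l \<le> (\<Sum>i. ?t i) + ?r") for x
  \<comment> \<open>For \<open>m = 0\<close> the kernel is 1. For \<open>x = y\<close> and
    \<open>m > 0\<close> it is \<open>1 / 0 = 0\<close>, so the pole itself costs nothing.\<close>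
  proof (cases "m = 0 \<or> x \<notin> D \<or> dist x y \<ge> r \<or> x = y")
    case True
    moreover have "?l \<le> ?r" if "m = 0" using that by simp
    moreover have "?l \<le> ?r" if "x \<notin> D" using that by simp
    moreover have "?l \<le> ?r" if "dist x y \<ge> r"
      using r that by (intro mult_right_mono ennreal_leI divide_left_mono power_mono mult_pos_pos zero_less_power) auto
    moreover have "?l \<le> ?r" if "x = y" "m \<noteq> 0"
      using that by (simp add: power_0_left)
    ultimately have "?l \<le> ?r" using True by blast
    then show ?thesis by (rule add_increasing[OF zero_le])
  next
    case False
    then have xy: "x \<noteq> y" "dist x y < r" "0 < dist x y" by auto
    \<comment> \<open>\<open>P i\<close> says that the ball of radius \<open>r / 2 ^ i\<close> still
      contains \<open>x\<close>; the least index at which it fails is \<open>Suc i\<close> for the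
      shell \<open>i\<close> of \<open>x\<close>.\<close>
    define P where "P i \<longleftrightarrow> dist x y < r / 2 ^ i" for i :: nat
    have "\<exists>i. \<not> P i"
    proof -
      obtain i :: nat where "r / dist x y < 2 ^ i"
        using real_arch_pow[of 2 "r / dist x y"] by auto
      then show ?thesis using xy by (intro exI[of _ i]) (simp add: P_def field_simps)
    qed
    then have ex: "\<not> P (LEAST i. \<not> P i)" and least: "\<And>i. i < (LEAST i. \<not> P i) \<Longrightarrow> P i"
      using LeastI_ex[of "\<lambda>i. \<not> P i"] not_less_Least[of _ "\<lambda>i. \<not> P i"] by blast+
    have "P 0" using xy by (simp add: P_def)
    then have "(LEAST i. \<not> P i) \<noteq> 0"
      using ex by metis
    then obtain i where i: "(LEAST i. \<not> P i) = Suc i" by (meson not0_implies_Suc)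
    have Pi: "dist x y < r / 2 ^ i" "r / 2 ^ Suc i \<le> dist x y"
    proof -
      have "P i" "\<not> P (Suc i)" using ex least[of i] by (simp_all add: i)
      then show "dist x y < r / 2 ^ i" "r / 2 ^ Suc i \<le> dist x y" by (auto simp: P_def)
    qed
    have "1 / dist x y ^ m \<le> (2 ^ Suc i / r) ^ m"
    proof -
      have "1 / dist x y \<le> 2 ^ Suc i / r"
        using Pi(2) xy r by (simp add: field_simps)
      then have "(1 / dist x y) ^ m \<le> (2 ^ Suc i / r) ^ m"
        using xy by (intro power_mono) auto
      then show ?thesis by (simp add: power_divide)
    qed
    then have "?l \<le> ?t i"
      using Pi by (auto simp: indicator_def dist_commute intro: ennreal_leI)
    also have "\<dots> \<le> (\<Sum>i. ?t i)"
      using sum_le_suminf[OF summableI, of "{i}" ?t] by (simp del: sum_mult_indicator)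
    finally show ?thesis by (simp add: add_increasing2)
  qed
  have t_le: "ennreal ((2 ^ Suc i / r) ^ m) * emeasure \<nu> (ball y (r / 2 ^ i))
      \<le> ennreal (2 ^ m * K * r powr (b - m) * (2 powr (m - b)) ^ i)" for i
  proof -
    have "ennreal ((2 ^ Suc i / r) ^ m) * emeasure \<nu> (ball y (r / 2 ^ i))
      \<le> ennreal ((2 ^ Suc i / r) ^ m) * ennreal (K * (r / 2 ^ i) powr b)"
      using r by (intro mult_left_mono growth) auto
    also have "\<dots> = ennreal ((2 ^ Suc i / r) ^ m * (K * (r / 2 ^ i) powr b))"
      using r by (intro ennreal_mult'[symmetric]) simp
    also have "(2 ^ Suc i / r) ^ m * (K * (r / 2 ^ i) powr b)
        = 2 ^ m * K * r powr (b - m) * (2 powr (m - b)) ^ i"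
    proof -
      have "(2 ^ Suc i / r) ^ m = (2 powr (real (Suc i)) / r) powr m"
        using r powr_realpow[of 2 "Suc i"] powr_realpow[of "2 ^ Suc i / r" m] by (simp del: of_nat_Suc)
      also have "\<dots> = 2 powr (real (Suc i) * m) / r powr m"
        using r by (simp add: powr_divide powr_powr)
      also have "2 powr (real (Suc i) * m) = 2 powr m * 2 powr (m * real i)"
        by (simp add: algebra_simps powr_add)
      finally have e1: "(2 ^ Suc i / r) ^ m = 2 powr m * 2 powr (m * real i) / r powr m" .
      have "(r / 2 ^ i) powr b = (r / 2 powr (real i)) powr b"
        by (simp add: powr_realpow)
      also have "\<dots> = r powr b / 2 powr (real i * b)"
        using r by (simp add: powr_divide powr_powr)
      finally have e2: "(r / 2 ^ i) powr b = r powr b / 2 powr (real i * b)" .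
      have "(2 powr (m - b)) ^ i = (2 powr (m - b)) powr real i"
        by (simp only: powr_realpow[OF powr_gt_zero[THEN iffD2]] zero_neq_numeral[symmetric] not_False_eq_True)
      also have "\<dots> = 2 powr (m * real i - real i * b)"
        by (simp only: powr_powr left_diff_distrib mult.commute[of b])
      finally have e3: "(2 powr (m - b)) ^ i = 2 powr (m * real i) / 2 powr (real i * b)"
        by (simp only: powr_diff)
      show ?thesis
        unfolding e1 e2 e3 using r by (simp add: powr_diff powr_realpow)
    qed
    finally show ?thesis .
  qed
  have sb: "ball y t \<in> sets \<nu>" "D \<in> sets \<nu>" for t by (simp_all add: sets D)
  have q: "2 powr (m - b) < 1" "0 < 2 powr (m - b)" using b by (auto simp: powr_less_one)
  have "(\<integral>\<^sup>+x\<in>D. ennreal (1 / dist x y ^ m) \<partial>\<nu>)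
      \<le> (\<integral>\<^sup>+x. (\<Sum>i. ennreal ((2 ^ Suc i / r) ^ m) * indicator (ball y (r / 2 ^ i)) x)
            + ennreal (1 / r ^ m) * indicator D x \<partial>\<nu>)"
    by (intro nn_integral_mono key)
  also have "\<dots> = (\<integral>\<^sup>+x. (\<Sum>i. ennreal ((2 ^ Suc i / r) ^ m) * indicator (ball y (r / 2 ^ i)) x) \<partial>\<nu>)
      + (\<integral>\<^sup>+x. ennreal (1 / r ^ m) * indicator D x \<partial>\<nu>)"
    by (intro nn_integral_add borel_measurable_suminf_order borel_measurable_times_ennreal
          borel_measurable_const borel_measurable_indicator sb)
  also have "(\<integral>\<^sup>+x. ennreal (1 / r ^ m) * indicator D x \<partial>\<nu>) = ennreal (1 / r ^ m) * emeasure \<nu> D"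
    by (rule nn_integral_cmult_indicator) (simp add: sets D)
  also have "(\<integral>\<^sup>+x. (\<Sum>i. ennreal ((2 ^ Suc i / r) ^ m) * indicator (ball y (r / 2 ^ i)) x) \<partial>\<nu>)
      = (\<Sum>i. \<integral>\<^sup>+x. ennreal ((2 ^ Suc i / r) ^ m) * indicator (ball y (r / 2 ^ i)) x \<partial>\<nu>)"
    by (intro nn_integral_suminf borel_measurable_times_ennreal borel_measurable_const
          borel_measurable_indicator sb)
  also have "(\<Sum>i. \<integral>\<^sup>+x. ennreal ((2 ^ Suc i / r) ^ m) * indicator (ball y (r / 2 ^ i)) x \<partial>\<nu>)
      = (\<Sum>i. ennreal ((2 ^ Suc i / r) ^ m) * emeasure \<nu> (ball y (r / 2 ^ i)))"
    by (intro suminf_cong nn_integral_cmult_indicator) (simp add: sets)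
  also have "\<dots> \<le> (\<Sum>i. ennreal (2 ^ m * K * r powr (b - m) * (2 powr (m - b)) ^ i))"
    by (intro suminf_le t_le) auto
  also have "\<dots> = ennreal (2 ^ m * K * r powr (b - m) / (1 - 2 powr (m - b)))"
    using q K geometric_sums[of "2 powr (m - b)"] sums_mult[of _ _ "2 ^ m * K * r powr (b - m)"]
    by (intro suminf_ennreal_eq) (auto simp: divide_inverse)
  finally show ?thesis by (simp add: add_right_mono)
qed

text \<open>When \<open>r powr b\<close> is at most the measure of \<open>D\<close>, the near part,
  of order \<open>r powr (b - m)\<close>, is at most a multiple of
  \<open>emeasure \<nu> D / r ^ m\<close> and so takes the form of the far part.\<close>

lemma nn_integral_kernel_le_emeasure:
  fixes \<nu> :: "'a::euclidean_space measure"
  assumes sets: "sets \<nu> = sets borel"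
    and growth: "\<And>r. 0 < r \<Longrightarrow> emeasure \<nu> (ball y r) \<le> ennreal (K * r powr b)"
    and K: "0 \<le> K" and b: "real m < b" and r: "0 < r" and D: "D \<in> sets borel"
    and large: "ennreal (r powr b) \<le> emeasure \<nu> D"
  shows "(\<integral>\<^sup>+x\<in>D. ennreal (1 / dist x y ^ m) \<partial>\<nu>)
    \<le> ennreal (2 ^ m * K / (1 - 2 powr (m - b)) + 1) * ennreal (1 / r ^ m) * emeasure \<nu> D"
proof -
  let ?c = "2 ^ m * K / (1 - 2 powr (m - b))"
  have q: "2 powr (m - b) < 1" using b by (auto simp: powr_less_one)
  have c: "0 \<le> ?c" using q K by simp
  have "2 ^ m * K * r powr (b - m) / (1 - 2 powr (m - b)) = ?c * (1 / r ^ m) * r powr b"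
    using r by (simp add: powr_diff powr_realpow)
  then have "ennreal (2 ^ m * K * r powr (b - m) / (1 - 2 powr (m - b)))
      = ennreal ?c * ennreal (1 / r ^ m) * ennreal (r powr b)"
    using c r by (simp add: ennreal_mult' del: times_divide_eq_left times_divide_eq_right)
  also have "\<dots> \<le> ennreal ?c * ennreal (1 / r ^ m) * emeasure \<nu> D"
    by (intro mult_left_mono large) auto
  finally have "(\<integral>\<^sup>+x\<in>D. ennreal (1 / dist x y ^ m) \<partial>\<nu>)
    \<le> ennreal ?c * ennreal (1 / r ^ m) * emeasure \<nu> D + ennreal (1 / r ^ m) * emeasure \<nu> D"
    using nn_integral_kernel_le[OF sets growth K b r D] by (meson add_right_mono order_trans)
  also have "\<dots> = ennreal (?c + 1) * ennreal (1 / r ^ m) * emeasure \<nu> D"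
    using c by (simp add: distrib_right)
  finally show ?thesis .
qed

lemma emeasure_lborel_ball_le:
  "0 < r \<Longrightarrow> emeasure lborel (ball (y::'a::euclidean_space) r)
     \<le> ennreal (unit_ball_vol (real DIM('a)) * r powr real DIM('a))"
  by (simp add: emeasure_ball powr_realpow)

text \<open>With \<open>r ^ n = d\<close> for the dimension \<open>n\<close>, the quotient
  \<open>d / r ^ (n - 1)\<close> is \<open>r\<close>, and the geometric series has ratio
  \<open>1 / 2\<close>. A null set is treated apart because \<open>r\<close> has to be
  positive.\<close>

lemma nn_integral_kernel_lborel:
  fixes y :: "'a::euclidean_space"
  assumes D: "D \<in> sets borel" and d: "emeasure lborel D = ennreal d" "0 \<le> d"
  shows "(\<integral>\<^sup>+x\<in>D. ennreal (1 / dist x y ^ (DIM('a) - 1)) \<partial>lborel)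
    \<le> ennreal ((2 ^ DIM('a) * unit_ball_vol (real DIM('a)) + 1) * root DIM('a) d)"
proof (cases "d = 0")
  case True
  then have "AE x in lborel. x \<notin> D" using d D by (intro AE_not_in) (auto simp: null_sets_def)
  then have "(\<integral>\<^sup>+x\<in>D. ennreal (1 / dist x y ^ (DIM('a) - 1)) \<partial>lborel) = 0"
    by (subst nn_integral_0_iff_AE) (use D in \<open>auto elim!: eventually_mono\<close>)
  then show ?thesis by simp
next
  case False
  define m where "m = DIM('a) - 1"
  have n: "DIM('a) = Suc m" using DIM_positive[where 'a='a] by (simp add: m_def)
  define r where "r = root DIM('a) d"
  have r: "0 < r" "r ^ DIM('a) = d"
    using False d DIM_positive[where 'a='a] by (auto simp: r_def real_root_gt_zero)
  have "(\<integral>\<^sup>+x\<in>D. ennreal (1 / dist x y ^ m) \<partial>lborel)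
      \<le> ennreal (2 ^ m * unit_ball_vol (real DIM('a)) / (1 - 2 powr (m - real DIM('a))) + 1)
          * ennreal (1 / r ^ m) * emeasure lborel D"
    using D r d by (intro nn_integral_kernel_le_emeasure emeasure_lborel_ball_le)
       (auto simp: n powr_realpow[of _ "Suc m", simplified])
  also have "1 - 2 powr (m - real DIM('a)) = 1 / 2"
    by (simp add: n powr_minus)
  also have "ennreal (2 ^ m * unit_ball_vol (real DIM('a)) / (1/2) + 1) * ennreal (1 / r ^ m) * emeasure lborel D
     = ennreal ((2 ^ m * unit_ball_vol (real DIM('a)) / (1/2) + 1) * (1 / r ^ m) * d)"
    using d r by (simp add: ennreal_mult' del: times_divide_eq_left times_divide_eq_right ennreal_plus)
  also have "(2 ^ m * unit_ball_vol (real DIM('a)) / (1/2) + 1) * (1 / r ^ m) * d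
     = (2 ^ DIM('a) * unit_ball_vol (real DIM('a)) + 1) * r"
    using r(1) unfolding r(2)[symmetric] n by simp
  finally show ?thesis by (simp add: m_def r_def)
qed

section \<open>Averages over directions, cones of directions and Hausdorff measure\<close>

text \<open>It suffices to integrate over the ball of radius \<open>1 / 4\<close> about
  \<open>c = w / (2 * norm w)\<close>: it lies in the unit ball, and there the inner product is at
  least \<open>norm w / 4\<close>. Its volume supplies the other powers of 4.\<close>

lemma norm_le_integral_inner:
  fixes w :: "'a::euclidean_space"
  shows "ennreal (unit_ball_vol (real DIM('a)) / 4 ^ Suc DIM('a) * norm w)
    \<le> (\<integral>\<^sup>+v\<in>ball 0 1. ennreal \<bar>v \<bullet> w\<bar> \<partial>lborel)"
proof (cases "w = 0")
  case False
  define c where "c = (1 / (2 * norm w)) *\<^sub>R w"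
  have c: "norm c = 1 / 2" "c \<bullet> w = norm w / 2"
    using False by (auto simp: c_def power2_norm_eq_inner[symmetric] power2_eq_square)
  have sub: "ball c (1/4) \<subseteq> ball 0 1"
  proof
    fix v assume "v \<in> ball c (1/4)"
    then have "norm (c - v) < 1/4" by (simp add: dist_norm)
    then show "v \<in> ball 0 1"
      using norm_triangle_ineq4[of c "c - v"] c(1) by simp
  qed
  have ge: "norm w / 4 \<le> \<bar>v \<bullet> w\<bar>" if "v \<in> ball c (1/4)" for v
  proof -
    have "\<bar>(c - v) \<bullet> w\<bar> \<le> norm (c - v) * norm w" by (rule Cauchy_Schwarz_ineq2)
    also have "\<dots> \<le> 1 / 4 * norm w"
      using that by (intro mult_right_mono) (auto simp: dist_norm)
    finally show ?thesis using c(2) unfolding inner_diff_left by linarith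
  qed
  have "ennreal (unit_ball_vol (real DIM('a)) / 4 ^ Suc DIM('a) * norm w)
      = ennreal (norm w / 4) * emeasure lborel (ball c (1/4))"
    by (simp add: emeasure_ball ennreal_mult[symmetric] power_divide)
  also have "\<dots> = (\<integral>\<^sup>+v. ennreal (norm w / 4) * indicator (ball c (1/4)) v \<partial>lborel)"
    by (rule nn_integral_cmult_indicator[symmetric]) simp
  also have "\<dots> \<le> (\<integral>\<^sup>+v\<in>ball 0 1. ennreal \<bar>v \<bullet> w\<bar> \<partial>lborel)"
    by (intro nn_integral_mono) (use sub ge in \<open>auto simp: indicator_def intro!: ennreal_leI\<close>)
  finally show ?thesis .
qed simp

definition cone_const :: "nat \<Rightarrow> real" where
  "cone_const n = 3 ^ Suc n * 2 ^ n * unit_ball_vol (real n)"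

lemma cone_const_pos: "0 < cone_const n"
  by (simp add: cone_const_def)

text \<open>Put \<open>t = 1 / s\<close> and \<open>w = y - x\<close>: the ray passes within
  \<open>\<rho>\<close> of \<open>y\<close> only if \<open>v\<close> is within
  \<open>t * \<rho>\<close> of \<open>t *\<^sub>R w\<close>. If \<open>2 * \<rho> < R\<close>, then
  \<open>t \<le> 2 / R\<close>, so \<open>v\<close> lies within \<open>q\<close> of a segment of
  length 2. This tube is covered by about \<open>1 / q\<close> balls of radius of order
  \<open>q\<close>, of total volume of order \<open>q ^ (n - 1)\<close>. For
  \<open>q \<ge> 1\<close> the unit ball itself obeys the bound. Only a Borel superset is claimed,
  so measurability of the cone does not come up.\<close>

lemma cone_cover_pos:
  fixes x y :: "'a::euclidean_space"
  assumes xy: "x \<noteq> y" and \<rho>: "0 < \<rho>"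
  shows "\<exists>N\<in>sets borel. {v \<in> ball 0 1. \<exists>s>0. dist (x + s *\<^sub>R v) y \<le> \<rho>} \<subseteq> N \<and>
    emeasure lborel N \<le> ennreal (cone_const DIM('a) * (\<rho> / dist x y) ^ (DIM('a) - 1))"
proof -
  define m where "m = DIM('a) - 1"
  have n: "DIM('a) = Suc m" using DIM_positive[where 'a='a] by (simp add: m_def)
  define \<omega> where "\<omega> = unit_ball_vol (real DIM('a))"
  have \<omega>: "0 < \<omega>" by (simp add: \<omega>_def)
  define w R where "w = y - x" and "R = dist x y"
  have R: "0 < R" "norm w = R" using xy by (auto simp: R_def w_def dist_norm norm_minus_commute)
  define q where "q = 2 * \<rho> / R"
  have q: "0 < q" using \<rho> R by (simp add: q_def)
  \<comment> \<open>The factor \<open>2 ^ n\<close> of \<open>cone_const\<close> consists of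
    \<open>2 ^ m\<close>, due to the 2 in \<open>q\<close>, and one spare factor 2.\<close>
  have const: "cone_const DIM('a) * (\<rho> / R) ^ m = 3 ^ (DIM('a) + 1) * 2 * \<omega> * q ^ m"
    by (simp add: cone_const_def \<omega>_def q_def n power_mult_distrib power_divide)
  show ?thesis
  proof (cases "q < 1")
    case False
    have "emeasure lborel (ball 0 1 :: 'a set) = ennreal \<omega>"
      by (simp add: emeasure_ball \<omega>_def)
    also have "\<dots> \<le> ennreal (cone_const DIM('a) * (\<rho> / R) ^ m)"
    proof (rule ennreal_leI)
      have "1 * \<omega> \<le> (3 ^ (DIM('a) + 1) * 2 * q ^ m) * \<omega>"
      proof (intro mult_right_mono)
        have "1 * 1 * 1 \<le> 3 ^ (DIM('a) + 1) * 2 * q ^ m"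
          using False by (intro mult_mono one_le_power) auto
        then show "1 \<le> 3 ^ (DIM('a) + 1) * 2 * q ^ m" by simp
      qed (use \<omega> in simp)
      then show "\<omega> \<le> cone_const DIM('a) * (\<rho> / R) ^ m"
        unfolding const by (simp add: mult_ac)
    qed
    finally show ?thesis
      by (intro bexI[of _ "ball 0 1"]) (auto simp: m_def R_def)
  next
    case True
    \<comment> \<open>Centres at distance \<open>q\<close> from each other on the segment in the
      direction of \<open>w\<close>; \<open>J\<close> reaches to its length 2.\<close>
    define p where "p i = (real i * q / R) *\<^sub>R w" for i :: nat
    define J where "J = nat \<lfloor>2 / q\<rfloor>"
    define N where "N = (\<Union>i\<le>J. ball (p i) (3 * q))"
    have \<rho>R: "2 * \<rho> < R" using True R by (simp add: q_def field_simps)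
    have cover: "v \<in> N" if v: "norm v < 1" and s: "0 < s" and d: "dist (x + s *\<^sub>R v) y \<le> \<rho>" for v s
    proof -
      define t where "t = 1 / s"
      have t: "0 < t" using s by (simp add: t_def)
      have "norm (v - t *\<^sub>R w) = t * norm (s *\<^sub>R v - w)"
      proof -
        have "v - t *\<^sub>R w = t *\<^sub>R (s *\<^sub>R v - w)" using s by (simp add: t_def algebra_simps)
        then show ?thesis using t by simp
      qed
      also have "s *\<^sub>R v - w = x + s *\<^sub>R v - y" by (simp add: w_def)
      finally have e1: "norm (v - t *\<^sub>R w) \<le> t * \<rho>"
        using d t by (simp add: dist_norm)
      have "t * R = norm (t *\<^sub>R w)" using t R by simp
      also have "\<dots> \<le> norm v + norm (v - t *\<^sub>R w)"
        using norm_triangle_sub[of "t *\<^sub>R w" v] by (simp only: norm_minus_commute)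
      finally have "t * R \<le> 1 + t * \<rho>" using v e1 by linarith
      moreover have "t * (2 * \<rho>) \<le> t * R" using \<rho>R t by (intro mult_left_mono) auto
      ultimately have tR: "t * R \<le> 2" by linarith
      then have "t \<le> 2 / R" using R by (simp add: field_simps)
      then have "t * \<rho> \<le> q" using \<rho> mult_right_mono[of t "2 / R" \<rho>] by (simp add: q_def)
      with e1 have e2: "norm (v - t *\<^sub>R w) \<le> q" by linarith
      define i where "i = nat \<lfloor>t * R / q\<rfloor>"
      have tq: "0 \<le> t * R / q" using t R q by simp
      then have i: "real i \<le> t * R / q" "t * R / q < real i + 1"
        by (auto simp: i_def)
      have "t *\<^sub>R w - p i = (t - real i * q / R) *\<^sub>R w" by (simp add: p_def algebra_simps)
      then have "norm (t *\<^sub>R w - p i) = \<bar>t - real i * q / R\<bar> * R" using R by simp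
      also have "\<dots> = \<bar>(t - real i * q / R) * R\<bar>" using R(1) by (simp add: abs_mult)
      also have "(t - real i * q / R) * R = t * R - real i * q" using R(1) by (simp add: field_simps)
      also have "\<bar>t * R - real i * q\<bar> \<le> q" using i q by (auto simp: field_simps abs_le_iff)
      finally have "norm (t *\<^sub>R w - p i) \<le> q" .
      with e2 have "norm (p i - v) < 3 * q"
        using q norm_triangle_ineq[of "t *\<^sub>R w - p i" "v - t *\<^sub>R w"] norm_minus_commute[of v "p i"] by simp
      moreover have "i \<le> J"
        unfolding i_def J_def using tR q by (intro nat_mono floor_mono divide_right_mono) auto
      ultimately show ?thesis by (auto simp: N_def dist_norm)
    qed
    have "emeasure lborel N \<le> (\<Sum>i\<le>J. emeasure lborel (ball (p i) (3 * q)))"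
      unfolding N_def by (intro emeasure_subadditive_finite) auto
    also have "\<dots> = ennreal (real (Suc J) * (\<omega> * (3 * q) ^ DIM('a)))"
    proof -
      have "emeasure lborel (ball (p i) (3 * q)) = ennreal (\<omega> * (3 * q) ^ DIM('a))" for i
        using q by (simp add: emeasure_ball \<omega>_def)
      then have "(\<Sum>i\<le>J. emeasure lborel (ball (p i) (3 * q))) = (\<Sum>i\<le>J. ennreal (\<omega> * (3 * q) ^ DIM('a)))"
        by simp
      also have "\<dots> = ennreal (\<Sum>i\<le>J. \<omega> * (3 * q) ^ DIM('a))"
        using q \<omega> by (intro sum_ennreal) auto
      finally show ?thesis by simp
    qed
    also have "\<dots> \<le> ennreal (cone_const DIM('a) * (\<rho> / R) ^ m)"
    proof (rule ennreal_leI)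
      \<comment> \<open>At most \<open>3 / q\<close> balls of volume
        \<open>\<omega> * (3 * q) ^ n\<close> each: this is the origin of \<open>3 ^ Suc n\<close>
        in \<open>cone_const\<close>.\<close>
      have "real J \<le> 2 / q" using q by (simp add: J_def)
      then have "real (Suc J) \<le> 3 / q" using True q by (simp add: field_simps)
      then have "real (Suc J) * (\<omega> * (3 * q) ^ DIM('a)) \<le> 3 / q * (\<omega> * (3 * q) ^ DIM('a))"
        using \<omega> q by (intro mult_right_mono) auto
      also have "\<dots> = 3 ^ (DIM('a) + 1) * \<omega> * q ^ m"
        using q unfolding n power_mult_distrib power_add power_Suc by simp
      also have "\<dots> \<le> cone_const DIM('a) * (\<rho> / R) ^ m"
        unfolding const using q \<omega> by simp
      finally show "real (Suc J) * (\<omega> * (3 * q) ^ DIM('a)) \<le> cone_const DIM('a) * (\<rho> / R) ^ m" .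
    qed
    finally have "emeasure lborel N \<le> ennreal (cone_const DIM('a) * (\<rho> / R) ^ m)" .
    moreover have "N \<in> sets borel" by (auto simp: N_def)
    ultimately show ?thesis
    proof (intro bexI[of _ N] conjI subsetI)
      fix v assume "v \<in> {v \<in> ball 0 1. \<exists>s>0. dist (x + s *\<^sub>R v) y \<le> \<rho>}"
      then show "v \<in> N" using cover by auto
    qed (simp_all add: R_def m_def)
  qed
qed

text \<open>A set of a covering may be a single point, so radius 0 has to be allowed. The sets for
  the radii \<open>\<rho> + 1 / Suc k\<close> are intersected.\<close>

lemma cone_cover:
  fixes x y :: "'a::euclidean_space"
  assumes xy: "x \<noteq> y" and \<rho>: "0 \<le> \<rho>"
  shows "\<exists>N\<in>sets borel. {v \<in> ball 0 1. \<exists>s>0. dist (x + s *\<^sub>R v) y \<le> \<rho>} \<subseteq> N \<and>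
    emeasure lborel N \<le> ennreal (cone_const DIM('a) * (\<rho> / dist x y) ^ (DIM('a) - 1))"
proof -
  let ?f = "\<lambda>\<rho>. cone_const DIM('a) * (\<rho> / dist x y) ^ (DIM('a) - 1)"
  have "\<forall>k. \<exists>N\<in>sets borel. {v \<in> ball 0 1. \<exists>s>0. dist (x + s *\<^sub>R v) y \<le> \<rho> + 1 / real (Suc k)} \<subseteq> N \<and>
    emeasure lborel N \<le> ennreal (?f (\<rho> + 1 / real (Suc k)))"
    using \<rho> by (intro allI cone_cover_pos[OF xy]) (simp add: add_nonneg_pos)
  from this[unfolded Bex_def choice_iff] obtain N where N: "\<And>k. N k \<in> sets borel"
    "\<And>k. {v \<in> ball 0 1. \<exists>s>0. dist (x + s *\<^sub>R v) y \<le> \<rho> + 1 / real (Suc k)} \<subseteq> N k"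
    "\<And>k. emeasure lborel (N k) \<le> ennreal (?f (\<rho> + 1 / real (Suc k)))" by blast
  have "(\<lambda>k. 1 / real (Suc k)) \<longlonglongrightarrow> 0"
    using LIMSEQ_Suc[OF lim_1_over_n[where 'a=real]] by simp
  then have "(\<lambda>k. ?f (\<rho> + 1 / real (Suc k))) \<longlonglongrightarrow> ?f (\<rho> + 0)"
    using xy by (intro tendsto_intros) auto
  from tendsto_ennrealI[OF this] have lim: "(\<lambda>k. ennreal (?f (\<rho> + 1 / real (Suc k)))) \<longlonglongrightarrow> ennreal (?f \<rho>)"
    by simp
  have "emeasure lborel (\<Inter>k. N k) \<le> ennreal (?f (\<rho> + 1 / real (Suc k)))" for k
    using N(1) by (intro order_trans[OF emeasure_mono N(3)[of k]]) auto
  then have "emeasure lborel (\<Inter>k. N k) \<le> ennreal (?f \<rho>)"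
    by (intro LIMSEQ_le_const[OF lim]) auto
  moreover have "{v \<in> ball 0 1. \<exists>s>0. dist (x + s *\<^sub>R v) y \<le> \<rho>} \<subseteq> (\<Inter>k. N k)"
  proof (intro INT_greatest subsetI)
    fix k v assume "v \<in> {v \<in> ball 0 1. \<exists>s>0. dist (x + s *\<^sub>R v) y \<le> \<rho>}"
    then obtain s where "v \<in> ball 0 1" "0 < s" "dist (x + s *\<^sub>R v) y \<le> \<rho>" by blast
    moreover have "\<rho> \<le> \<rho> + 1 / real (Suc k)" by simp
    ultimately have "v \<in> {v \<in> ball 0 1. \<exists>s>0. dist (x + s *\<^sub>R v) y \<le> \<rho> + 1 / real (Suc k)}"
      using order_trans by blast
    then show "v \<in> N k" using N(2) by blast
  qed
  moreover have "(\<Inter>k. N k) \<in> sets borel" using N(1) by auto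
  ultimately show ?thesis by (intro bexI[of _ "\<Inter>k. N k"] conjI)
qed

text \<open>One function \<open>M\<close> bounds, for all \<open>x\<close> off \<open>Z\<close> at
  once, the measure of the directions whose ray meets \<open>Z\<close>. Each set of an efficient
  cover contributes its cone bound, a power of diameter over distance. Integrating in
  \<open>x\<close> replaces the power of the distance by \<open>\<kappa>\<close> and leaves
  \<open>diameter ^ m\<close>, a multiple of the Hausdorff weight; the factor
  \<open>2 ^ m / unit_ball_vol m\<close> undoes the normalisation of that weight.\<close>

lemma hausdorff_cone_majorant:
  fixes Z :: "'a::euclidean_space set" and \<nu> :: "'a measure"
  defines "m \<equiv> DIM('a) - 1"
  assumes sets[measurable_cong]: "sets \<nu> = sets borel" and \<Omega>[measurable]: "\<Omega> \<in> sets borel"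
    and kern: "\<And>y. y \<in> Z \<Longrightarrow> (\<integral>\<^sup>+x\<in>\<Omega>. ennreal (1 / dist x y ^ m) \<partial>\<nu>) \<le> ennreal \<kappa>"
    and \<kappa>: "0 \<le> \<kappa>"
    and b: "hausdorff_outer m Z < b"
  obtains M where "M \<in> borel_measurable borel"
    "\<And>x. x \<notin> Z \<Longrightarrow> \<exists>N\<in>sets borel. {v \<in> ball 0 1. \<exists>s>0. x + s *\<^sub>R v \<in> Z} \<subseteq> N \<and> emeasure lborel N \<le> M x"
    "(\<integral>\<^sup>+x\<in>\<Omega>. M x \<partial>\<nu>) \<le> ennreal (cone_const DIM('a) * \<kappa> * 2 ^ m / unit_ball_vol (real m)) * b"
proof -
  let ?c = "cone_const DIM('a)" and ?\<omega> = "unit_ball_vol (real m)"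
  \<comment> \<open>The mesh size 1 is an arbitrary choice: what is used of the cover is the sum of
    its weights.\<close>
  have "hausdorff_pre m 1 Z \<le> hausdorff_outer m Z"
    unfolding hausdorff_outer_def by (intro SUP_upper) auto
  then have "hausdorff_pre m 1 Z < b" using b by (rule le_less_trans)
  then obtain S :: "nat \<Rightarrow> 'a set" where S: "Z \<subseteq> (\<Union>i. S i)" "\<And>i. bounded (S i)"
      "(\<Sum>i. hausdorff_weight m (S i)) < b"
    unfolding hausdorff_pre_def Inf_less_iff by blast
  \<comment> \<open>The centres are taken in \<open>Z\<close>, where \<open>kern\<close> is
    available; they then differ from every \<open>x\<close> off \<open>Z\<close>.\<close>
  define y where "y i = (SOME z. z \<in> S i \<inter> Z)" for i
  have y: "y i \<in> S i" "y i \<in> Z" if "S i \<inter> Z \<noteq> {}" for i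
    using someI_ex[of "\<lambda>z. z \<in> S i \<inter> Z"] that by (auto simp: y_def)
  define t where "t i x = (if S i \<inter> Z = {} then 0 else ennreal (?c * (diameter (S i) / dist x (y i)) ^ m))" for i x
  define M where "M x = (\<Sum>i. t i x)" for x
  have t_meas[measurable]: "t i \<in> borel_measurable borel" for i
    unfolding t_def[abs_def] by measurable
  have d0: "0 \<le> diameter (S i)" for i using S(2) by (rule diameter_ge_0)
  have "M \<in> borel_measurable borel" unfolding M_def[abs_def] by measurable
  moreover have "\<exists>N\<in>sets borel. {v \<in> ball 0 1. \<exists>s>0. x + s *\<^sub>R v \<in> Z} \<subseteq> N \<and> emeasure lborel N \<le> M x"
    if x: "x \<notin> Z" for x
  proof -
    have "\<exists>N. N \<in> sets borel \<and> {v \<in> ball 0 1. \<exists>s>0. x + s *\<^sub>R v \<in> S i \<inter> Z} \<subseteq> N \<and> emeasure lborel N \<le> t i x" for i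
    proof (cases "S i \<inter> Z = {}")
      case True
      then show ?thesis by (intro exI[of _ "{}"]) auto
    next
      case False
      have "x \<noteq> y i" using x y[OF False] by auto
      from cone_cover[OF this d0[of i]] obtain N where N: "N \<in> sets borel"
        "{v \<in> ball 0 1. \<exists>s>0. dist (x + s *\<^sub>R v) (y i) \<le> diameter (S i)} \<subseteq> N"
        "emeasure lborel N \<le> ennreal (?c * (diameter (S i) / dist x (y i)) ^ m)"
        unfolding m_def by blast
      have "{v \<in> ball 0 1. \<exists>s>0. x + s *\<^sub>R v \<in> S i \<inter> Z}
          \<subseteq> {v \<in> ball 0 1. \<exists>s>0. dist (x + s *\<^sub>R v) (y i) \<le> diameter (S i)}"
        using diameter_bounded_bound[OF S(2)] y(1)[OF False] by blast
      with N False show ?thesis by (intro exI[of _ N]) (auto simp: t_def)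
    qed
    then have "\<forall>i. \<exists>N. N \<in> sets borel \<and> {v \<in> ball 0 1. \<exists>s>0. x + s *\<^sub>R v \<in> S i \<inter> Z} \<subseteq> N \<and> emeasure lborel N \<le> t i x"
      by blast
    from choice[OF this] obtain N where N: "\<And>i. N i \<in> sets borel"
      "\<And>i. {v \<in> ball 0 1. \<exists>s>0. x + s *\<^sub>R v \<in> S i \<inter> Z} \<subseteq> N i"
      "\<And>i. emeasure lborel (N i) \<le> t i x"
      by blast
    have "emeasure lborel (\<Union>i. N i) \<le> (\<Sum>i. emeasure lborel (N i))"
      using N(1) by (intro emeasure_subadditive_countably) auto
    also have "\<dots> \<le> M x"
      unfolding M_def by (intro suminf_le N) auto
    finally have "emeasure lborel (\<Union>i. N i) \<le> M x" .
    moreover have "{v \<in> ball 0 1. \<exists>s>0. x + s *\<^sub>R v \<in> Z} \<subseteq> (\<Union>i. N i)"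
    proof
      fix v assume "v \<in> {v \<in> ball 0 1. \<exists>s>0. x + s *\<^sub>R v \<in> Z}"
      then obtain s where s: "v \<in> ball 0 1" "0 < s" "x + s *\<^sub>R v \<in> Z" by blast
      then obtain i where "x + s *\<^sub>R v \<in> S i" using S(1) by blast
      with s have "v \<in> {v \<in> ball 0 1. \<exists>s>0. x + s *\<^sub>R v \<in> S i \<inter> Z}" by blast
      with N(2)[of i] show "v \<in> (\<Union>i. N i)" by blast
    qed
    moreover have "(\<Union>i. N i) \<in> sets borel" using N(1) by auto
    ultimately show ?thesis by (intro bexI[of _ "\<Union>i. N i"] conjI)
  qed
  moreover have "(\<integral>\<^sup>+x\<in>\<Omega>. M x \<partial>\<nu>) \<le> ennreal (?c * \<kappa> * 2 ^ m / ?\<omega>) * b"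
  proof -
    have c: "0 < ?c" by (rule cone_const_pos)
    have \<omega>: "?\<omega> \<noteq> 0" using unit_ball_vol_pos[of "real m"] by linarith
    have "(\<integral>\<^sup>+x\<in>\<Omega>. M x \<partial>\<nu>) = (\<integral>\<^sup>+x. (\<Sum>i. t i x * indicator \<Omega> x) \<partial>\<nu>)"
      unfolding M_def by simp
    also have "\<dots> = (\<Sum>i. \<integral>\<^sup>+x\<in>\<Omega>. t i x \<partial>\<nu>)"
      by (rule nn_integral_suminf) measurable
    also have "\<dots> \<le> (\<Sum>i. ennreal (?c * \<kappa> * 2 ^ m / ?\<omega>) * hausdorff_weight m (S i))"
    proof (rule suminf_le)
      fix i
      show "(\<integral>\<^sup>+x\<in>\<Omega>. t i x \<partial>\<nu>) \<le> ennreal (?c * \<kappa> * 2 ^ m / ?\<omega>) * hausdorff_weight m (S i)"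
      proof (cases "S i \<inter> Z = {}")
        case False
        let ?d = "diameter (S i)"
        have "t i x * indicator \<Omega> x = ennreal (?c * ?d ^ m) * (ennreal (1 / dist x (y i) ^ m) * indicator \<Omega> x)" for x
          using False c d0[of i]
          by (simp add: t_def power_divide ennreal_mult[symmetric] mult.assoc[symmetric])
        then have "(\<integral>\<^sup>+x\<in>\<Omega>. t i x \<partial>\<nu>) = ennreal (?c * ?d ^ m) * (\<integral>\<^sup>+x\<in>\<Omega>. ennreal (1 / dist x (y i) ^ m) \<partial>\<nu>)"
          by (simp add: nn_integral_cmult)
        also have "\<dots> \<le> ennreal (?c * ?d ^ m) * ennreal \<kappa>"
          by (intro mult_left_mono kern y False) auto
        also have "\<dots> = ennreal (?c * ?d ^ m * \<kappa>)"
          using c d0[of i] \<kappa> by (simp add: ennreal_mult)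
        also have "?c * ?d ^ m * \<kappa> = (?c * \<kappa> * 2 ^ m / ?\<omega>) * (?\<omega> * (?d / 2) ^ m)"
          using \<omega> by (simp add: power_divide)
        also have "ennreal \<dots> = ennreal (?c * \<kappa> * 2 ^ m / ?\<omega>) * hausdorff_weight m (S i)"
          using False c \<kappa> by (subst ennreal_mult') (auto simp: hausdorff_weight_def)
        finally show ?thesis .
      qed (simp add: t_def)
    qed auto
    also have "\<dots> = ennreal (?c * \<kappa> * 2 ^ m / ?\<omega>) * (\<Sum>i. hausdorff_weight m (S i))"
      by simp
    also have "\<dots> \<le> ennreal (?c * \<kappa> * 2 ^ m / ?\<omega>) * b"
      by (intro mult_left_mono less_imp_le[OF S(3)]) auto
    finally show ?thesis .
  qed
  ultimately show thesis by (rule that)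
qed

section \<open>Dyadic levels of the density and its Riesz potential\<close>

text \<open>The \<open>n\<close>-th powers of these numbers are, up to a factor \<open>2\<^sup>n\<close>, the integrals of \<open>F\<^sup>n\<close> over dyadic levels.\<close>

definition level_norm :: "('a::euclidean_space \<Rightarrow> real) \<Rightarrow> nat \<Rightarrow> real" where
  "level_norm F j = 2 ^ j * root DIM('a) (measure lborel {y. 2 ^ j < F y \<and> F y \<le> 2 ^ Suc j})"

abbreviation half_tail :: "(nat \<Rightarrow> real) \<Rightarrow> nat \<Rightarrow> ennreal" where
  "half_tail c k \<equiv> \<Sum>i. ennreal ((1/2) ^ i * c (k + i))"

text \<open>The summand 1 stands for the part of the density that is at most 1 and belongs to no
  level. The weights in \<open>half_tail\<close> are the gain of level \<open>k + i\<close> over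
  level \<open>k\<close>.\<close>

abbreviation level_bound :: "real \<Rightarrow> (nat \<Rightarrow> real) \<Rightarrow> (nat \<Rightarrow> real) \<Rightarrow> nat \<Rightarrow> ennreal" where
  "level_bound \<Lambda> c a k \<equiv> ennreal \<Lambda> * (1 + (\<Sum>j<k. ennreal (c j)) + half_tail c k) + half_tail a k"

lemma level_norm_nonneg: "0 \<le> level_norm F j"
  by (simp add: level_norm_def)

text \<open>On level \<open>j\<close> the density exceeds \<open>2 ^ j\<close>, so
  \<open>(2 ^ j) ^ n\<close> times the volume of the level is at most its share of the integral, and
  the levels are disjoint.\<close>

lemma sum_level_norm_le:
  fixes F :: "'a::euclidean_space \<Rightarrow> real"
  assumes F[measurable]: "F \<in> borel_measurable borel"
    and int: "(\<integral>\<^sup>+y. ennreal (F y ^ DIM('a)) \<partial>lborel) \<le> 1"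
  shows "(\<Sum>j. ennreal (level_norm F j ^ DIM('a))) \<le> 1"
proof -
  let ?n = "DIM('a)"
  define D where "D j = {y. 2 ^ j < F y \<and> F y \<le> 2 ^ Suc j}" for j :: nat
  have D[measurable]: "D j \<in> sets borel" for j unfolding D_def by measurable
  have disj: "disjoint_family D"
    unfolding disjoint_family_on_def
  proof (intro ballI impI)
    fix i j :: nat assume "i \<noteq> j"
    then have "Suc i \<le> j \<or> Suc j \<le> i" by auto
    then have "(2::real) ^ Suc i \<le> 2 ^ j \<or> (2::real) ^ Suc j \<le> 2 ^ i"
      using power_increasing[of _ _ "2::real"] by (meson one_le_numeral)
    then show "D i \<inter> D j = {}"
      unfolding D_def by force
  qed
  have "ennreal (level_norm F j ^ ?n) \<le> (\<integral>\<^sup>+y\<in>D j. ennreal (F y ^ ?n) \<partial>lborel)" for j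
  proof -
    have "level_norm F j ^ ?n = (2 ^ j) ^ ?n * measure lborel (D j)"
      by (simp add: level_norm_def power_mult_distrib D_def)
    then have "ennreal (level_norm F j ^ ?n) = ennreal ((2 ^ j) ^ ?n) * ennreal (measure lborel (D j))"
      by (simp add: ennreal_mult')
    \<comment> \<open>True also for a level of infinite volume, where \<open>measure\<close> is
      0.\<close>
    also have "\<dots> \<le> ennreal ((2 ^ j) ^ ?n) * emeasure lborel (D j)"
      by (intro mult_left_mono) (auto simp: measure_def ennreal_enn2real_if)
    also have "\<dots> = (\<integral>\<^sup>+y\<in>D j. ennreal ((2 ^ j) ^ ?n) \<partial>lborel)"
      by (intro nn_integral_cmult_indicator[symmetric]) simp
    also have "\<dots> \<le> (\<integral>\<^sup>+y\<in>D j. ennreal (F y ^ ?n) \<partial>lborel)"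
      by (intro nn_integral_mono) (auto simp: indicator_def D_def intro!: ennreal_leI power_mono)
    finally show ?thesis .
  qed
  then have "(\<Sum>j. ennreal (level_norm F j ^ ?n)) \<le> (\<Sum>j. \<integral>\<^sup>+y\<in>D j. ennreal (F y ^ ?n) \<partial>lborel)"
    by (intro suminf_le) auto
  also have "\<dots> = (\<integral>\<^sup>+y. (\<Sum>j. ennreal (F y ^ ?n) * indicator (D j) y) \<partial>lborel)"
    by (intro nn_integral_suminf[symmetric]) measurable
  also have "\<dots> \<le> (\<integral>\<^sup>+y. ennreal (F y ^ ?n) \<partial>lborel)"
  proof (rule nn_integral_mono)
    fix y
    have "(\<Sum>j. indicator (D j) y :: ennreal) = indicator (\<Union>j. D j) y"
      by (rule suminf_indicator[OF disj])
    also have "\<dots> \<le> 1" by (simp add: indicator_def)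
    finally have "ennreal (F y ^ ?n) * (\<Sum>j. indicator (D j) y) \<le> ennreal (F y ^ ?n) * 1"
      by (intro mult_left_mono) auto
    then show "(\<Sum>j. ennreal (F y ^ ?n) * indicator (D j) y) \<le> ennreal (F y ^ ?n)" by simp
  qed
  finally show ?thesis using int by (rule order_trans)
qed

text \<open>Each level is estimated in both orders of integration. Integrating in \<open>y\<close>
  first gives \<open>L * root n (d j)\<close>, which after multiplication by \<open>2 ^ j\<close> is
  a multiple of \<open>c j\<close>; this serves for \<open>j < k\<close>. Integrating in
  \<open>x\<close> over \<open>G\<close> first gives a multiple of \<open>d j / r ^ m\<close>, hence
  of \<open>2 ^ k * d j\<close>; for \<open>j = k + i\<close> this is better by
  \<open>(1/2) ^ i\<close>. Both bounds carry the factor \<open>emeasure \<nu> G\<close>, so a later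
  division by it yields mean values.\<close>

lemma riesz_level_bound:
  fixes \<nu> :: "'a::euclidean_space measure" and F :: "'a \<Rightarrow> real" and K b :: real
  defines "m \<equiv> DIM('a) - 1"
  defines "L \<equiv> 2 ^ DIM('a) * unit_ball_vol (real DIM('a)) + 1"
  defines "L' \<equiv> 2 ^ m * K / (1 - 2 powr (real m - b)) + 1"
  assumes dim: "2 \<le> DIM('a)"
    and sets[measurable_cong]: "sets \<nu> = sets borel" and fin: "finite_measure \<nu>"
    and growth: "\<And>y r. 0 < r \<Longrightarrow> emeasure \<nu> (ball y r) \<le> ennreal (K * r powr b)"
    and K: "0 \<le> K" and b: "real m < b"
    and F[measurable]: "F \<in> borel_measurable borel"
    and \<Omega>[measurable]: "\<Omega> \<in> sets borel" and vol: "emeasure lborel \<Omega> \<le> ennreal V" "0 \<le> V"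
    and supp: "\<And>y. y \<notin> \<Omega> \<Longrightarrow> F y = 0"
    and int: "(\<integral>\<^sup>+y. ennreal (F y ^ DIM('a)) \<partial>lborel) \<le> 1"
    and G[measurable]: "G \<in> sets borel"
    and r: "0 < r" "ennreal (r powr b) \<le> emeasure \<nu> G" "1 / r ^ m \<le> P * 2 ^ k" and P: "0 \<le> P"
  shows "(\<integral>\<^sup>+x\<in>G. (\<integral>\<^sup>+y. ennreal (F y) * ennreal (1 / dist y x ^ m) \<partial>lborel) \<partial>\<nu>)
    \<le> emeasure \<nu> G * ennreal (L * root DIM('a) V + 2 * L + 2 * L' * P)
       * (1 + (\<Sum>j<k. ennreal (level_norm F j)) + (half_tail (level_norm F) k))"
proof -
  interpret finite_measure \<nu> by (rule fin)
  interpret pair_sigma_finite lborel \<nu> ..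
  let ?n = "DIM('a)"
  let ?k = "\<lambda>y x. ennreal (1 / dist y x ^ m)"
  let ?N = "emeasure \<nu> G"
  have n: "?n = Suc m" "1 \<le> m" using dim by (auto simp: m_def)
  have L: "0 \<le> L" "1 \<le> L" by (auto simp: L_def)
  have "2 powr (real m - b) < 1" using b by (auto simp: powr_less_one)
  then have L': "0 \<le> L'" using K by (simp add: L'_def)
  define D where "D j = {y. 2 ^ j < F y \<and> F y \<le> 2 ^ Suc j}" for j :: nat
  have D[measurable]: "D j \<in> sets borel" for j unfolding D_def by measurable
  have D\<Omega>: "D j \<subseteq> \<Omega>" for j
    using supp by (force simp: D_def)
  define d where "d j = measure lborel (D j)" for j
  have emD: "emeasure lborel (D j) = ennreal (d j)" for j
  proof -
    have "emeasure lborel (D j) \<le> emeasure lborel \<Omega>" by (intro emeasure_mono D\<Omega>) simp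
    also note vol(1)
    also have "ennreal V < top" by simp
    finally have "emeasure lborel (D j) < top" .
    then show ?thesis by (simp add: d_def emeasure_eq_ennreal_measure)
  qed
  have d0: "0 \<le> d j" for j by (simp add: d_def)
  let ?c = "level_norm F"
  have c_def: "?c j = 2 ^ j * root ?n (d j)" for j by (simp add: level_norm_def d_def D_def)
  have c1: "?c j \<le> 1" for j
  proof -
    have "ennreal (?c j ^ ?n) \<le> (\<Sum>j. ennreal (?c j ^ ?n))"
      using sum_le_suminf[OF summableI, of "{j}" "\<lambda>j. ennreal (?c j ^ ?n)"] by simp
    also have "\<dots> \<le> 1" by (rule sum_level_norm_le[OF F int])
    finally have "?c j ^ ?n \<le> 1" by (simp add: ennreal_le_1)
    then show ?thesis using power_le_one_iff[OF level_norm_nonneg, of F j ?n] n by auto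
  qed
  have inner: "(\<integral>\<^sup>+y\<in>D j. ?k y x \<partial>lborel) \<le> ennreal (L * root ?n (d j))" for j x
    unfolding m_def L_def by (intro nn_integral_kernel_lborel emD d0) simp
  have inner\<Omega>: "(\<integral>\<^sup>+y\<in>\<Omega>. ?k y x \<partial>lborel) \<le> ennreal (L * root ?n V)" for x
  proof -
    have fin\<Omega>: "emeasure lborel \<Omega> = ennreal (measure lborel \<Omega>)"
      using vol by (intro emeasure_eq_ennreal_measure) (auto simp: top_unique)
    have "(\<integral>\<^sup>+y\<in>\<Omega>. ?k y x \<partial>lborel) \<le> ennreal (L * root ?n (measure lborel \<Omega>))"
      unfolding m_def L_def by (intro nn_integral_kernel_lborel fin\<Omega>) simp_all
    also have "\<dots> \<le> ennreal (L * root ?n V)"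
      using vol L n unfolding fin\<Omega> by (intro ennreal_leI mult_left_mono) auto
    finally show ?thesis .
  qed
  have outer: "(\<integral>\<^sup>+x\<in>G. ?k y x \<partial>\<nu>) \<le> ennreal L' * ennreal (1 / r ^ m) * ?N" for y
    unfolding L'_def dist_commute[of y]
    by (intro nn_integral_kernel_le_emeasure sets growth K b r) simp_all
  have lev: "(\<integral>\<^sup>+x\<in>G. (\<integral>\<^sup>+y\<in>D j. ?k y x \<partial>lborel) \<partial>\<nu>) \<le> ?N * ennreal (L * root ?n (d j))"
    (is "?I j \<le> _") for j
  proof -
    have "?I j \<le> (\<integral>\<^sup>+x. ennreal (L * root ?n (d j)) * indicator G x \<partial>\<nu>)"
      by (intro nn_integral_mono mult_right_mono inner) auto
    also have "\<dots> = ennreal (L * root ?n (d j)) * ?N"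
      by (rule nn_integral_cmult_indicator) (simp add: sets)
    finally show ?thesis by (simp only: mult.commute)
  qed
  have lev': "(\<integral>\<^sup>+x\<in>G. (\<integral>\<^sup>+y\<in>D j. ?k y x \<partial>lborel) \<partial>\<nu>) \<le> ?N * ennreal (L' * P * 2 ^ k * d j)" for j
  proof -
    have "?I j = (\<integral>\<^sup>+x. (\<integral>\<^sup>+y. ?k y x * indicator (D j) y * indicator G x \<partial>lborel) \<partial>\<nu>)"
      by (intro nn_integral_cong nn_integral_multc[symmetric]) measurable
    also have "\<dots> = (\<integral>\<^sup>+y. (\<integral>\<^sup>+x. ?k y x * indicator (D j) y * indicator G x \<partial>\<nu>) \<partial>lborel)"
      by (rule Fubini') measurable
    also have "\<dots> = (\<integral>\<^sup>+y. (\<integral>\<^sup>+x\<in>G. ?k y x \<partial>\<nu>) * indicator (D j) y \<partial>lborel)"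
      by (subst nn_integral_multc[symmetric]) (auto intro!: nn_integral_cong simp: mult_ac)
    also have "\<dots> \<le> (\<integral>\<^sup>+y. ennreal L' * ennreal (1 / r ^ m) * ?N * indicator (D j) y \<partial>lborel)"
      by (intro nn_integral_mono mult_right_mono outer) auto
    also have "\<dots> = ennreal L' * ennreal (1 / r ^ m) * ?N * ennreal (d j)"
      unfolding emD[symmetric] by (rule nn_integral_cmult_indicator) simp
    also have "\<dots> \<le> ennreal L' * ennreal (P * 2 ^ k) * ?N * ennreal (d j)"
      by (intro mult_right_mono mult_left_mono ennreal_leI r) auto
    also have "\<dots> = ?N * (ennreal L' * ennreal (P * 2 ^ k) * ennreal (d j))"
      by (simp only: mult_ac)
    also have "ennreal L' * ennreal (P * 2 ^ k) * ennreal (d j) = ennreal (L' * P * 2 ^ k * d j)"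
      using L' P d0[of j] by (simp add: ennreal_mult[symmetric] mult_ac)
    finally show ?thesis .
  qed
  define B where "B = 2 * L + 2 * L' * P"
  have B: "0 \<le> B" using L L' P by (simp add: B_def)
  have lev1: "ennreal (2 ^ Suc j) * ?I j \<le> ?N * (ennreal B * ennreal (?c j))" for j
  proof -
    have "ennreal (2 ^ Suc j) * ?I j \<le> ennreal (2 ^ Suc j) * (?N * ennreal (L * root ?n (d j)))"
      by (intro mult_left_mono lev) auto
    also have "\<dots> = ?N * (ennreal (2 ^ Suc j) * ennreal (L * root ?n (d j)))" by (simp only: mult_ac)
    also have "ennreal (2 ^ Suc j) * ennreal (L * root ?n (d j)) = ennreal (2 * L * ?c j)"
      by (subst ennreal_mult'[symmetric]) (auto simp: c_def mult_ac)
    also have "\<dots> \<le> ennreal (B * ?c j)"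
      using L L' P level_norm_nonneg[of F j] by (intro ennreal_leI mult_right_mono) (auto simp: B_def)
    also have "\<dots> = ennreal B * ennreal (?c j)" by (simp add: ennreal_mult B level_norm_nonneg)
    finally show ?thesis by (simp add: mult_left_mono)
  qed
  have lev2: "ennreal (2 ^ Suc (k + i)) * ?I (k + i) \<le> ?N * (ennreal B * ennreal ((1/2) ^ i * ?c (k + i)))" for i
  proof -
    let ?j = "k + i"
    have "ennreal (2 ^ Suc ?j) * ?I ?j \<le> ennreal (2 ^ Suc ?j) * (?N * ennreal (L' * P * 2 ^ k * d ?j))"
      by (intro mult_left_mono lev') auto
    also have "\<dots> = ?N * (ennreal (2 ^ Suc ?j) * ennreal (L' * P * 2 ^ k * d ?j))" by (simp only: mult_ac)
    also have "ennreal (2 ^ Suc ?j) * ennreal (L' * P * 2 ^ k * d ?j) = ennreal (2 ^ Suc ?j * (L' * P * 2 ^ k * d ?j))"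
      by (subst ennreal_mult'[symmetric]) auto
    also have "\<dots> \<le> ennreal (B * ((1/2) ^ i * ?c ?j))"
    proof (rule ennreal_leI)
      \<comment> \<open>From \<open>c j ^ n = 2 ^ (j * n) * d j\<close>, \<open>n \<ge> 2\<close>
        and \<open>c j \<le> 1\<close> follows \<open>2 ^ (2 * j) * d j \<le> c j\<close>; writing
        \<open>2 * j\<close> as \<open>j + k + i\<close> leaves the factor
        \<open>(1/2) ^ i\<close>.\<close>
      have "?c ?j ^ ?n = 2 ^ (?j * ?n) * d ?j"
        unfolding c_def power_mult_distrib power_mult
        using real_root_pow_pos2[OF DIM_positive[where 'a='a] d0] by simp
      moreover have "?c ?j ^ ?n \<le> ?c ?j ^ 1"
        using n by (intro power_decreasing level_norm_nonneg c1) auto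
      ultimately have "2 ^ (?j * ?n) * d ?j \<le> ?c ?j" by simp
      moreover have "2 * ?j \<le> ?j * ?n"
        using mult_left_mono[OF dim, of ?j] by (simp only: mult.commute)
      then have "(2::real) ^ (2 * ?j) * d ?j \<le> 2 ^ (?j * ?n) * d ?j"
        by (intro mult_right_mono d0 power_increasing) simp_all
      ultimately have "(2::real) ^ (2 * ?j) * d ?j \<le> ?c ?j" by linarith
      moreover have "(2::real) ^ (2 * ?j) = 2 ^ ?j * 2 ^ k * 2 ^ i"
        by (simp add: power_add mult_2)
      ultimately have "2 ^ ?j * 2 ^ k * d ?j \<le> (1/2) ^ i * ?c ?j"
        by (simp add: power_divide field_simps)
      then have "(2 * L' * P) * (2 ^ ?j * 2 ^ k * d ?j) \<le> (2 * L' * P) * ((1/2) ^ i * ?c ?j)"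
        using L' P by (intro mult_left_mono) auto
      also have "\<dots> \<le> B * ((1/2) ^ i * ?c ?j)"
        using L by (intro mult_right_mono mult_nonneg_nonneg level_norm_nonneg) (auto simp: B_def)
      finally show "2 ^ Suc ?j * (L' * P * 2 ^ k * d ?j) \<le> B * ((1/2) ^ i * ?c ?j)"
        by (simp add: mult_ac)
    qed
    also have "\<dots> = ennreal B * ennreal ((1/2) ^ i * ?c ?j)" by (simp add: ennreal_mult B level_norm_nonneg)
    finally show ?thesis by (simp add: mult_left_mono)
  qed
  \<comment> \<open>Values up to 1 are covered by the indicator of \<open>\<Omega>\<close>, outside
    which \<open>F\<close> vanishes.\<close>
  have Fle: "ennreal (F y) \<le> indicator \<Omega> y + (\<Sum>j. ennreal (2 ^ Suc j) * indicator (D j) y)" for y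
  proof (cases "F y \<le> 1 \<or> y \<notin> \<Omega>")
    case True
    then have "ennreal (F y) \<le> indicator \<Omega> y"
      using supp[of y] by (auto simp: indicator_def)
    then show ?thesis by (rule add_increasing2[OF zero_le])
  next
    case False
    define P where "P j \<longleftrightarrow> F y \<le> 2 ^ j" for j
    have "\<exists>j. P j" using real_arch_pow[of 2 "F y"] by (auto simp: P_def intro: less_imp_le)
    then have ex: "P (LEAST j. P j)" and least: "\<And>j. j < (LEAST j. P j) \<Longrightarrow> \<not> P j"
      using LeastI_ex[of P] not_less_Least[of _ P] by blast+
    have "\<not> P 0" using False by (simp add: P_def)
    then have "(LEAST j. P j) \<noteq> 0" using ex by metis
    then obtain j where j: "(LEAST j. P j) = Suc j" by (meson not0_implies_Suc)
    have "P (Suc j)" "\<not> P j" using ex least[of j] by (simp_all add: j)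
    then have "ennreal (F y) \<le> ennreal (2 ^ Suc j) * indicator (D j) y"
      by (auto simp: D_def P_def indicator_def intro: ennreal_leI)
    also have "\<dots> \<le> (\<Sum>j. ennreal (2 ^ Suc j) * indicator (D j) y)"
      using sum_le_suminf[OF summableI, of "{j}" "\<lambda>j. ennreal (2 ^ Suc j) * indicator (D j) y"]
      by (simp del: sum_mult_indicator)
    finally show ?thesis by (rule add_increasing[OF zero_le])
  qed
  have pot: "(\<integral>\<^sup>+y. ennreal (F y) * ?k y x \<partial>lborel)
     \<le> ennreal (L * root ?n V) + (\<Sum>j. ennreal (2 ^ Suc j) * (\<integral>\<^sup>+y\<in>D j. ?k y x \<partial>lborel))" for x
  proof -
    have "(\<integral>\<^sup>+y. ennreal (F y) * ?k y x \<partial>lborel)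
      \<le> (\<integral>\<^sup>+y. ?k y x * indicator \<Omega> y + (\<Sum>j. ennreal (2 ^ Suc j) * (?k y x * indicator (D j) y)) \<partial>lborel)"
    proof (rule nn_integral_mono)
      fix y
      have "ennreal (F y) * ?k y x \<le> (indicator \<Omega> y + (\<Sum>j. ennreal (2 ^ Suc j) * indicator (D j) y)) * ?k y x"
        by (intro mult_right_mono Fle) auto
      also have "\<dots> = ?k y x * indicator \<Omega> y + (\<Sum>j. (ennreal (2 ^ Suc j) * indicator (D j) y) * ?k y x)"
        by (simp only: distrib_right ennreal_suminf_multc mult.commute[of "indicator \<Omega> y"])
      also have "\<dots> = ?k y x * indicator \<Omega> y + (\<Sum>j. ennreal (2 ^ Suc j) * (?k y x * indicator (D j) y))"
        by (simp only: mult_ac)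
      finally show "ennreal (F y) * ?k y x \<le> \<dots>" .
    qed
    also have "\<dots> = (\<integral>\<^sup>+y\<in>\<Omega>. ?k y x \<partial>lborel) + (\<Sum>j. \<integral>\<^sup>+y. ennreal (2 ^ Suc j) * (?k y x * indicator (D j) y) \<partial>lborel)"
      by (subst nn_integral_add) (auto simp: nn_integral_suminf)
    also have "\<dots> = (\<integral>\<^sup>+y\<in>\<Omega>. ?k y x \<partial>lborel) + (\<Sum>j. ennreal (2 ^ Suc j) * (\<integral>\<^sup>+y\<in>D j. ?k y x \<partial>lborel))"
      by (subst nn_integral_cmult) auto
    finally show ?thesis using inner\<Omega>[of x] by (meson add_right_mono order_trans)
  qed
  have "(\<integral>\<^sup>+x\<in>G. (\<integral>\<^sup>+y. ennreal (F y) * ?k y x \<partial>lborel) \<partial>\<nu>)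
    \<le> (\<integral>\<^sup>+x. ennreal (L * root ?n V) * indicator G x
          + (\<Sum>j. ennreal (2 ^ Suc j) * ((\<integral>\<^sup>+y\<in>D j. ?k y x \<partial>lborel) * indicator G x)) \<partial>\<nu>)"
  proof (rule nn_integral_mono)
    fix x
    have "(\<integral>\<^sup>+y. ennreal (F y) * ?k y x \<partial>lborel) * indicator G x
      \<le> (ennreal (L * root ?n V) + (\<Sum>j. ennreal (2 ^ Suc j) * (\<integral>\<^sup>+y\<in>D j. ?k y x \<partial>lborel))) * indicator G x"
      by (intro mult_right_mono pot) auto
    then show "(\<integral>\<^sup>+y. ennreal (F y) * ?k y x \<partial>lborel) * indicator G x
      \<le> ennreal (L * root ?n V) * indicator G x
          + (\<Sum>j. ennreal (2 ^ Suc j) * ((\<integral>\<^sup>+y\<in>D j. ?k y x \<partial>lborel) * indicator G x))"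
      by (simp only: distrib_right ennreal_suminf_multc[symmetric] mult.assoc)
  qed
  also have "\<dots> = ennreal (L * root ?n V) * ?N + (\<Sum>j. ennreal (2 ^ Suc j) * ?I j)"
  proof -
    have "(\<integral>\<^sup>+x. ennreal (L * root ?n V) * indicator G x
          + (\<Sum>j. ennreal (2 ^ Suc j) * ((\<integral>\<^sup>+y\<in>D j. ?k y x \<partial>lborel) * indicator G x)) \<partial>\<nu>)
      = (\<integral>\<^sup>+x. ennreal (L * root ?n V) * indicator G x \<partial>\<nu>)
          + (\<integral>\<^sup>+x. (\<Sum>j. ennreal (2 ^ Suc j) * ((\<integral>\<^sup>+y\<in>D j. ?k y x \<partial>lborel) * indicator G x)) \<partial>\<nu>)"
      by (rule nn_integral_add) measurable
    also have "(\<integral>\<^sup>+x. ennreal (L * root ?n V) * indicator G x \<partial>\<nu>) = ennreal (L * root ?n V) * ?N"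
      by (rule nn_integral_cmult_indicator) (simp add: sets)
    also have "(\<integral>\<^sup>+x. (\<Sum>j. ennreal (2 ^ Suc j) * ((\<integral>\<^sup>+y\<in>D j. ?k y x \<partial>lborel) * indicator G x)) \<partial>\<nu>)
      = (\<Sum>j. \<integral>\<^sup>+x. ennreal (2 ^ Suc j) * ((\<integral>\<^sup>+y\<in>D j. ?k y x \<partial>lborel) * indicator G x) \<partial>\<nu>)"
      by (rule nn_integral_suminf) measurable
    also have "\<dots> = (\<Sum>j. ennreal (2 ^ Suc j) * ?I j)"
      by (intro suminf_cong nn_integral_cmult) measurable
    finally show ?thesis .
  qed
  also have "(\<Sum>j. ennreal (2 ^ Suc j) * ?I j)
      = (\<Sum>j<k. ennreal (2 ^ Suc j) * ?I j) + (\<Sum>i. ennreal (2 ^ Suc (k + i)) * ?I (k + i))"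
    by (subst suminf_offset[OF summableI, of _ k]) (simp add: add.commute)
  also have "\<dots> \<le> (\<Sum>j<k. ?N * (ennreal B * ennreal (?c j))) + (\<Sum>i. ?N * (ennreal B * ennreal ((1/2) ^ i * ?c (k + i))))"
    by (intro add_mono sum_mono suminf_le lev1 lev2) auto
  also have "\<dots> = ?N * (ennreal B * ((\<Sum>j<k. ennreal (?c j)) + (half_tail ?c k)))"
    by (simp only: sum_distrib_left[symmetric] ennreal_suminf_cmult distrib_left)
  finally have *: "(\<integral>\<^sup>+x\<in>G. (\<integral>\<^sup>+y. ennreal (F y) * ?k y x \<partial>lborel) \<partial>\<nu>)
    \<le> ennreal (L * root ?n V) * ?N + ?N * (ennreal B * ((\<Sum>j<k. ennreal (?c j)) + (half_tail ?c k)))"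
    (is "_ \<le> _ + ?N * (_ * ?S)")
    by (simp add: add_left_mono)
  have V0: "0 \<le> L * root ?n V" using L vol n by simp
  have "ennreal (L * root ?n V) * ?N + ?N * (ennreal B * ?S)
      \<le> ?N * (ennreal (L * root ?n V + B) * (1 + ?S))"
  proof -
    have "ennreal (L * root ?n V) * ?N + ?N * (ennreal B * ?S)
        = ?N * (ennreal (L * root ?n V) * 1 + ennreal B * ?S)"
      by (simp only: distrib_left mult_1_right mult_1_left mult.commute)
    also have "\<dots> \<le> ?N * (ennreal (L * root ?n V + B) * 1 + ennreal (L * root ?n V + B) * ?S)"
      using V0 B by (intro mult_left_mono add_mono mult_right_mono ennreal_leI) auto
    finally show ?thesis by (simp only: distrib_left)
  qed
  from order_trans[OF * this] show ?thesis
    by (simp only: B_def mult.assoc add.assoc)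
qed

section \<open>Mollification and integration along rays\<close>

lemma continuous_on_bump:
  assumes "continuous_on S f" "continuous_on S g"
  shows "continuous_on S (\<lambda>s. bump r (f s) (g s :: real^'n))"
  unfolding bump_def
  by (intro continuous_on_compose2[OF continuous_on_flat[of UNIV 0]] continuous_intros assms) auto

lemma borel_measurable_bump [measurable]:
  fixes f g :: "'a \<Rightarrow> real^'n"
  assumes [measurable]: "f \<in> borel_measurable M" "g \<in> borel_measurable M"
  shows "(\<lambda>s. bump r (f s) (g s)) \<in> borel_measurable M"
proof -
  have "(\<lambda>(p::(real^'n) \<times> (real^'n)). bump r (fst p) (snd p)) \<in> borel_measurable borel"
    by (intro borel_measurable_continuous_onI continuous_on_bump continuous_intros)
  then have "(\<lambda>(p::(real^'n) \<times> (real^'n)). bump r (fst p) (snd p)) \<in> borel_measurable (borel \<Otimes>\<^sub>M borel)"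
    by (simp add: borel_prod)
  from measurable_compose[OF measurable_Pair[OF assms] this] show ?thesis by simp
qed

text \<open>Total mass, for normalising \<open>bump\<close> independently of the centre. The
  dimension is carried by the type alone, hence the \<open>itself\<close> argument.\<close>

definition bump_mass :: "real \<Rightarrow> 'n::finite itself \<Rightarrow> real" where
  "bump_mass r _ = (\<integral>z. bump r (0::real^'n) z \<partial>lborel)"

lemma bump_outside: "0 < r \<Longrightarrow> x \<notin> ball c r \<Longrightarrow> bump r c x = 0"
  using bump_nonzero_iff by blast

lemma integrable_bump: "0 < r \<Longrightarrow> integrable lborel (bump r (c::real^'n))"
proof -
  assume r: "0 < r"
  have "integrable lborel (\<lambda>x. indicator (cball c r) x *\<^sub>R bump r c x)"
    by (rule borel_integrable_compact) (auto intro!: continuous_on_bump continuous_intros)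
  also have "(\<lambda>x. indicator (cball c r) x *\<^sub>R bump r c x) = bump r c"
  proof
    fix x show "indicator (cball c r) x *\<^sub>R bump r c x = bump r c x"
      using bump_outside[OF r, of x c] by (cases "x \<in> cball c r") auto
  qed
  finally show ?thesis .
qed

lemma integral_bump: "(\<integral>z. bump r (c::real^'n) z \<partial>lborel) = bump_mass r TYPE('n)"
proof -
  have "(\<integral>z. bump r c z \<partial>lborel) = (\<integral>z. bump r c (c + z) \<partial>lborel)"
    by (subst (1) lborel_distr_plus[symmetric, of c]) (subst integral_distr; simp)
  then show ?thesis by (simp add: bump_mass_def bump_def)
qed

lemma bump_mass_pos: "0 < r \<Longrightarrow> 0 < bump_mass r TYPE('n::finite)"
proof (rule ccontr)
  assume r: "0 < r" and "\<not> 0 < bump_mass r TYPE('n)"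
  moreover have "0 \<le> bump_mass r TYPE('n)"
    unfolding bump_mass_def by (intro integral_nonneg_AE) (simp add: bump_nonneg)
  ultimately have "(\<integral>z. bump r (0::real^'n) z \<partial>lborel) = 0" by (simp add: bump_mass_def)
  then have "AE z in lborel. bump r (0::real^'n) z = 0"
    using integral_nonneg_eq_0_iff_AE[OF integrable_bump[OF r, of "0::real^'n"]] by (simp add: bump_nonneg)
  then have "AE z in lborel. z \<notin> ball (0::real^'n) r"
    using bump_nonzero_iff[OF r, of "0::real^'n"] by (elim eventually_mono) metis
  then have "emeasure lborel (ball (0::real^'n) r) = 0"
    by (subst (asm) AE_iff_measurable[where N="ball 0 r"]) auto
  then show False
    using r unit_ball_vol_pos[of "real CARD('n)"] by (simp add: emeasure_ball less_le)
qed

lemma nn_integral_bump: "0 < r \<Longrightarrow> (\<integral>\<^sup>+z. ennreal (bump r (c::real^'n) z) \<partial>lborel) = ennreal (bump_mass r TYPE('n))"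
  by (simp add: nn_integral_eq_integral integrable_bump bump_nonneg integral_bump)

section \<open>The symmetric gradient tested with a bump\<close>

lemma norm_outer_product: "norm (\<chi> i. v $ i *\<^sub>R v :: real^'n^'n) = (norm v)\<^sup>2"
proof -
  have "norm (\<chi> i. v $ i *\<^sub>R v :: real^'n^'n) = L2_set (\<lambda>i. norm ((\<chi> i. v $ i *\<^sub>R v :: real^'n^'n) $ i)) UNIV"
    by (rule norm_vec_def)
  also have "\<dots> = L2_set (\<lambda>i. norm (v $ i) * norm v) UNIV"
    by (simp only: vec_lambda_beta norm_scaleR real_norm_def)
  also have "\<dots> = L2_set (\<lambda>i. norm (v $ i)) UNIV * norm v"
    by (rule L2_set_left_distrib[symmetric]) simp
  finally show ?thesis by (simp add: norm_vec_def power2_eq_square)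
qed

text \<open>The distributions are defined by integrals over \<open>\<Omega>\<close> with respect to
  \<open>lebesgue\<close>, whereas Fubini's theorem is applied to \<open>lborel\<close>; for a
  continuous integrand living on a compact set the two agree.\<close>

lemma lebesgue_integral_support:
  fixes f :: "real^'n \<Rightarrow> real"
  assumes K: "compact K" "K \<subseteq> \<Omega>" and f: "continuous_on K f" and supp: "\<And>z. z \<in> \<Omega> \<Longrightarrow> z \<notin> K \<Longrightarrow> f z = 0"
  shows "set_integrable lebesgue \<Omega> f"
    "(LINT z:\<Omega>|lebesgue. f z) = (\<integral>z. indicator K z * f z \<partial>lborel)"
proof -
  have eq: "indicator \<Omega> z *\<^sub>R f z = indicator K z *\<^sub>R f z" for z
    using K(2) supp[of z] by (auto simp: indicator_def)
  have i: "integrable lborel (\<lambda>z. indicator K z *\<^sub>R f z)"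
    by (rule borel_integrable_compact[OF K(1) f])
  then show "set_integrable lebesgue \<Omega> f"
    unfolding set_integrable_def eq by (subst integrable_completion) (auto dest: borel_measurable_integrable)
  show "(LINT z:\<Omega>|lebesgue. f z) = (\<integral>z. indicator K z * f z \<partial>lborel)"
    unfolding set_lebesgue_integral_def eq using i
    by (subst integral_completion) (auto dest: borel_measurable_integrable)
qed

lemma continuous_on_partial_bump: "continuous_on S (partial j (bump r (c::real^'n)))"
  unfolding partial_bump[abs_def]
  by (intro continuous_on_compose2[OF continuous_on_flat[of UNIV 2]] continuous_intros) auto

lemma partial_bump_outside: "0 < r \<Longrightarrow> z \<notin> cball c r \<Longrightarrow> partial j (bump r c) z = 0"
proof -
  assume "0 < r" "z \<notin> cball c r"
  then have "r\<^sup>2 \<le> (norm (z - c))\<^sup>2"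
    by (intro power_mono) (auto simp: dist_norm norm_minus_commute)
  then show ?thesis by (simp add: partial_bump flat_def)
qed

lemma set_integral_double_sum:
  fixes f :: "'i \<Rightarrow> 'j \<Rightarrow> 'a \<Rightarrow> real"
  assumes f: "\<And>i j. set_integrable M A (f i j)"
  shows "set_integrable M A (\<lambda>x. \<Sum>i\<in>I. \<Sum>j\<in>J. c i j * f i j x)"
    "(LINT x:A|M. (\<Sum>i\<in>I. \<Sum>j\<in>J. c i j * f i j x)) = (\<Sum>i\<in>I. \<Sum>j\<in>J. c i j * (LINT x:A|M. f i j x))"
proof -
  have *: "integrable M (\<lambda>x. indicator A x *\<^sub>R (c i j * f i j x))" for i j
    using set_integrable_mult_right[OF f] unfolding set_integrable_def .
  show "set_integrable M A (\<lambda>x. \<Sum>i\<in>I. \<Sum>j\<in>J. c i j * f i j x)"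
    unfolding set_integrable_def scaleR_sum_right by (intro Bochner_Integration.integrable_sum *)
  have "(LINT x:A|M. (\<Sum>i\<in>I. \<Sum>j\<in>J. c i j * f i j x)) = (\<Sum>i\<in>I. \<Sum>j\<in>J. (LINT x:A|M. c i j * f i j x))"
    unfolding set_lebesgue_integral_def scaleR_sum_right
    by (subst Bochner_Integration.integral_sum; (intro Bochner_Integration.integrable_sum *)?)
       (intro sum.cong refl Bochner_Integration.integral_sum *)
  then show "(LINT x:A|M. (\<Sum>i\<in>I. \<Sum>j\<in>J. c i j * f i j x)) = (\<Sum>i\<in>I. \<Sum>j\<in>J. c i j * (LINT x:A|M. f i j x))"
    by simp
qed

text \<open>The coefficients \<open>v $ i * v $ j\<close> are symmetric in the indices, so
  \<open>distr_grad\<close> and \<open>distr_sym_grad\<close> have the same contraction. Up to sign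
  the left side is therefore the integral of the inner product of \<open>E\<close> with the rank one
  matrix \<open>?V\<close> against the bump, and Cauchy-Schwarz in the Frobenius norm gives the
  factor \<open>(norm v)\<^sup>2\<close>.\<close>

lemma sym_grad_bump_bound:
  fixes u :: "real^'n \<Rightarrow> real^'n" and v :: "real^'n"
  assumes u: "continuous_on \<Omega> u" and E: "has_sym_grad \<Omega> u E"
    and F[measurable]: "F \<in> borel_measurable borel"
    and EF: "AE z in lebesgue. z \<in> \<Omega> \<longrightarrow> norm (E z) \<le> F z"
    and r: "0 < r" "cball y r \<subseteq> \<Omega>"
  shows "ennreal \<bar>LINT z:\<Omega>|lebesgue. (u z \<bullet> v) * (\<Sum>j\<in>UNIV. v $ j * partial j (bump r y) z)\<bar>
     \<le> ennreal ((norm v)\<^sup>2) * (\<integral>\<^sup>+z. ennreal (F z) * ennreal (bump r y z) \<partial>lborel)"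
proof -
  let ?\<phi> = "bump r y"
  let ?V = "\<chi> i. v $ i *\<^sub>R v :: real^'n^'n"
  have \<phi>: "?\<phi> \<in> test_functions \<Omega>" by (rule bump_test_function[OF r])
  have ucont: "continuous_on (cball y r) (\<lambda>z. u z $ i)" for i
    by (intro continuous_intros continuous_on_subset[OF u r(2)])
  have int1: "set_integrable lebesgue \<Omega> (\<lambda>z. u z $ i * partial j ?\<phi> z)" for i j
    by (rule lebesgue_integral_support[of "cball y r"])
       (use r partial_bump_outside[OF r(1)] in \<open>auto intro!: continuous_intros ucont continuous_on_partial_bump\<close>)
  have EK: "set_integrable lebesgue (cball y r) E"
    using E r(2) by (auto simp: has_sym_grad_def L1_loc_def)
  have \<phi>0: "?\<phi> z = 0" if "z \<notin> cball y r" for z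
    using bump_nonzero_iff[OF r(1), of y z] that by auto
  have \<phi>b: "\<bar>?\<phi> z\<bar> \<le> 1" for z
    by (auto simp: bump_def flat_def)
  have int2: "set_integrable lebesgue \<Omega> (\<lambda>z. E z $ i $ j * ?\<phi> z)" for i j
  proof -
    have "integrable lebesgue (\<lambda>z. (indicator (cball y r) z *\<^sub>R E z) $ i $ j)"
      using EK unfolding set_integrable_def
      by (intro integrable_bounded_linear[OF bounded_linear_vec_nth])
    then have "integrable lebesgue (\<lambda>z. (indicator (cball y r) z *\<^sub>R E z) $ i $ j * ?\<phi> z)"
    proof (rule Bochner_Integration.integrable_bound)
      show "(\<lambda>z. (indicator (cball y r) z *\<^sub>R E z) $ i $ j * ?\<phi> z) \<in> borel_measurable lebesgue"
        using \<open>integrable lebesgue (\<lambda>z. (indicator (cball y r) z *\<^sub>R E z) $ i $ j)\<close>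
        by (intro borel_measurable_times) (auto intro!: measurable_completion dest: borel_measurable_integrable)
      show "AE z in lebesgue. norm ((indicator (cball y r) z *\<^sub>R E z) $ i $ j * ?\<phi> z)
          \<le> norm ((indicator (cball y r) z *\<^sub>R E z) $ i $ j)"
        using \<phi>b by (intro always_eventually) (auto simp: abs_mult intro: mult_left_le)
    qed
    moreover have "(indicator (cball y r) z *\<^sub>R E z) $ i $ j * ?\<phi> z = indicator \<Omega> z *\<^sub>R (E z $ i $ j * ?\<phi> z)" for z
      using r(2) \<phi>0[of z] by (auto simp: indicator_def)
    ultimately show ?thesis by (simp only: set_integrable_def)
  qed
  have EV: "(E z \<bullet> ?V) * ?\<phi> z = (\<Sum>i\<in>UNIV. \<Sum>j\<in>UNIV. v $ i * v $ j * (E z $ i $ j * ?\<phi> z))" for z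
    by (simp add: inner_vec_def sum_distrib_left sum_distrib_right mult_ac)
  have int3: "set_integrable lebesgue \<Omega> (\<lambda>z. (E z \<bullet> ?V) * ?\<phi> z)"
    unfolding EV by (intro set_integral_double_sum int2)
  have "(u z \<bullet> v) * (\<Sum>j\<in>UNIV. v $ j * partial j ?\<phi> z)
      = (\<Sum>i\<in>UNIV. \<Sum>j\<in>UNIV. v $ i * v $ j * (u z $ i * partial j ?\<phi> z))" for z
    unfolding inner_vec_def sum_product by (intro sum.cong refl) (simp add: mult_ac)
  then have "(LINT z:\<Omega>|lebesgue. (u z \<bullet> v) * (\<Sum>j\<in>UNIV. v $ j * partial j ?\<phi> z))
      = (LINT z:\<Omega>|lebesgue. (\<Sum>i\<in>UNIV. \<Sum>j\<in>UNIV. v $ i * v $ j * (u z $ i * partial j ?\<phi> z)))"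
    by simp
  also have "\<dots> = (\<Sum>i\<in>UNIV. \<Sum>j\<in>UNIV. v $ i * v $ j * (LINT z:\<Omega>|lebesgue. u z $ i * partial j ?\<phi> z))"
    by (intro set_integral_double_sum int1)
  also have "\<dots> = - (\<Sum>i\<in>UNIV. \<Sum>j\<in>UNIV. v $ i * v $ j * distr_grad \<Omega> u i j ?\<phi>)"
    by (simp add: distr_grad_def sum_negf)
  \<comment> \<open>Exchanging the summation indices identifies the two halves of the
    symmetrisation.\<close>
  also have "(\<Sum>i\<in>UNIV. \<Sum>j\<in>UNIV. v $ i * v $ j * distr_grad \<Omega> u i j ?\<phi>)
      = (\<Sum>i\<in>UNIV. \<Sum>j\<in>UNIV. v $ i * v $ j * distr_sym_grad \<Omega> u i j ?\<phi>)"
  proof -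
    have "(\<Sum>i\<in>UNIV. \<Sum>j\<in>UNIV. v $ i * v $ j * distr_grad \<Omega> u j i ?\<phi>)
        = (\<Sum>i\<in>UNIV. \<Sum>j\<in>UNIV. v $ i * v $ j * distr_grad \<Omega> u i j ?\<phi>)"
      by (subst sum.swap) (simp add: mult_ac)
    then show ?thesis
      by (simp add: distr_sym_grad_def add_divide_distrib distrib_left sum.distrib sum_divide_distrib[symmetric])
  qed
  also have "\<dots> = (\<Sum>i\<in>UNIV. \<Sum>j\<in>UNIV. v $ i * v $ j * (LINT z:\<Omega>|lebesgue. E z $ i $ j * ?\<phi> z))"
    using E \<phi> by (simp add: has_sym_grad_def)
  also have "\<dots> = (LINT z:\<Omega>|lebesgue. (\<Sum>i\<in>UNIV. \<Sum>j\<in>UNIV. v $ i * v $ j * (E z $ i $ j * ?\<phi> z)))"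
    by (intro set_integral_double_sum(2)[symmetric] int2)
  also have "\<dots> = (LINT z:\<Omega>|lebesgue. (E z \<bullet> ?V) * ?\<phi> z)"
    by (simp only: EV)
  finally have "\<bar>LINT z:\<Omega>|lebesgue. (u z \<bullet> v) * (\<Sum>j\<in>UNIV. v $ j * partial j ?\<phi> z)\<bar>
     = norm (LINT z:\<Omega>|lebesgue. (E z \<bullet> ?V) * ?\<phi> z)" by simp
  also have "ennreal \<dots> \<le> (\<integral>\<^sup>+z. ennreal (norm (indicator \<Omega> z *\<^sub>R ((E z \<bullet> ?V) * ?\<phi> z))) \<partial>lebesgue)"
    unfolding set_lebesgue_integral_def by (rule integral_norm_bound_ennreal[OF int3[unfolded set_integrable_def]])
  also have "\<dots> \<le> (\<integral>\<^sup>+z. ennreal ((norm v)\<^sup>2) * (ennreal (F z) * ennreal (?\<phi> z)) \<partial>lebesgue)"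
  proof (rule nn_integral_mono_AE)
    show "AE z in lebesgue. ennreal (norm (indicator \<Omega> z *\<^sub>R ((E z \<bullet> ?V) * ?\<phi> z)))
        \<le> ennreal ((norm v)\<^sup>2) * (ennreal (F z) * ennreal (?\<phi> z))"
      using EF
    proof eventually_elim
      case (elim z)
      show ?case
      proof (cases "z \<in> \<Omega>")
        case True
        have "\<bar>E z \<bullet> ?V\<bar> \<le> norm (E z) * norm ?V" by (rule Cauchy_Schwarz_ineq2)
        also have "\<dots> \<le> F z * (norm v)\<^sup>2"
          unfolding norm_outer_product using elim True by (intro mult_right_mono) auto
        finally have "\<bar>E z \<bullet> ?V\<bar> * ?\<phi> z \<le> F z * (norm v)\<^sup>2 * ?\<phi> z"
          by (intro mult_right_mono bump_nonneg)
        moreover have "0 \<le> F z" using elim True norm_ge_zero order_trans by blast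
        ultimately show ?thesis
          using True by (simp add: ennreal_mult[symmetric] bump_nonneg abs_mult mult_ac ennreal_leI)
      qed simp
    qed
  qed
  also have "\<dots> = (\<integral>\<^sup>+z. ennreal ((norm v)\<^sup>2) * (ennreal (F z) * ennreal (?\<phi> z)) \<partial>lborel)"
    by (rule nn_integral_completion)
  also have "\<dots> = ennreal ((norm v)\<^sup>2) * (\<integral>\<^sup>+z. ennreal (F z) * ennreal (?\<phi> z) \<partial>lborel)"
    by (rule nn_integral_cmult) measurable
  finally show ?thesis by (simp add: ennreal_leI)
qed

section \<open>Mollification and its increments along a line\<close>

definition mollified :: "(real^'n) set \<Rightarrow> (real^'n \<Rightarrow> real) \<Rightarrow> real \<Rightarrow> real^'n \<Rightarrow> real" where
  "mollified \<Omega> g r y = (LINT z:\<Omega>|lebesgue. g z * bump r y z) / bump_mass r TYPE('n)"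

lemma mollified_close:
  fixes g :: "real^'n \<Rightarrow> real"
  assumes r: "0 < r" "cball y r \<subseteq> \<Omega>" and g: "continuous_on \<Omega> g"
    and close: "\<And>z. z \<in> cball y r \<Longrightarrow> \<bar>g z - a\<bar> \<le> e"
  shows "\<bar>mollified \<Omega> g r y - a\<bar> \<le> e"
proof -
  let ?K = "cball y r" and ?B = "bump_mass r TYPE('n)"
  have B: "0 < ?B" by (rule bump_mass_pos[OF r(1)])
  have \<phi>0: "bump r y z = 0" if "z \<notin> ?K" for z
    using bump_nonzero_iff[OF r(1), of y z] that by auto
  have gc: "continuous_on ?K g" using g r(2) by (rule continuous_on_subset)
  have bc: "continuous_on ?K (bump r y)" by (intro continuous_on_bump continuous_intros)
  have int: "integrable lborel (\<lambda>z. indicator ?K z *\<^sub>R (g z * bump r y z))"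
    by (rule borel_integrable_compact) (auto intro!: continuous_on_mult gc bc)
  have "(LINT z:\<Omega>|lebesgue. g z * bump r y z) = (\<integral>z. indicator ?K z * (g z * bump r y z) \<partial>lborel)"
    by (rule lebesgue_integral_support) (use r \<phi>0 in \<open>auto intro!: continuous_on_mult gc bc\<close>)
  then have "(LINT z:\<Omega>|lebesgue. g z * bump r y z) - a * ?B
     = (\<integral>z. indicator ?K z * (g z * bump r y z) \<partial>lborel) - (\<integral>z. a * bump r y z \<partial>lborel)"
    by (simp add: integral_bump)
  also have "\<dots> = (\<integral>z. indicator ?K z * (g z * bump r y z) - a * bump r y z \<partial>lborel)"
    using int integrable_bump[OF r(1), of y] by (intro Bochner_Integration.integral_diff[symmetric]) auto
  also have "\<bar>\<dots>\<bar> \<le> (\<integral>z. e * bump r y z \<partial>lborel)"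
  proof (rule integral_abs_bound_integral)
    show "integrable lborel (\<lambda>z. indicator ?K z * (g z * bump r y z) - a * bump r y z)"
      using int integrable_bump[OF r(1), of y] by auto
    show "integrable lborel (\<lambda>z. e * bump r y z)"
      using integrable_bump[OF r(1), of y] by auto
    fix z
    show "\<bar>indicator ?K z * (g z * bump r y z) - a * bump r y z\<bar> \<le> e * bump r y z"
    proof (cases "z \<in> ?K")
      case True
      then have "indicator ?K z * (g z * bump r y z) - a * bump r y z = (g z - a) * bump r y z"
        by (simp add: algebra_simps)
      then show ?thesis
        using mult_right_mono[OF close[OF True] bump_nonneg[of r y z]] by (simp add: abs_mult bump_nonneg)
    qed (simp add: \<phi>0)
  qed
  also have "\<dots> = e * ?B" by (simp add: integral_bump)
  finally have "\<bar>(mollified \<Omega> g r y - a) * ?B\<bar> \<le> e * ?B"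
    using B by (simp add: mollified_def left_diff_distrib)
  then show ?thesis using B by (simp add: abs_mult)
qed

text \<open>Centre and radius vary together because the rays below start at a point that depends on
  the radius.\<close>

lemma mollified_tendsto:
  fixes g :: "real^'n \<Rightarrow> real"
  assumes \<Omega>: "open \<Omega>" "a \<in> \<Omega>" and g: "continuous_on \<Omega> g"
    and r: "r \<longlonglongrightarrow> 0" "\<And>k. 0 < r k" and y: "y \<longlonglongrightarrow> a"
  shows "(\<lambda>k. mollified \<Omega> g (r k) (y k)) \<longlonglongrightarrow> g a"
proof (rule LIMSEQ_I)
  fix e :: real assume e: "0 < e"
  have "isCont g a" using g \<Omega> by (simp add: continuous_on_eq_continuous_at)
  then obtain d where d: "0 < d" "\<And>z. dist z a < d \<Longrightarrow> dist (g z) (g a) < e / 2"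
    using e unfolding continuous_at_eps_delta by (metis half_gt_zero)
  obtain d' where d': "0 < d'" "ball a d' \<subseteq> \<Omega>"
    using \<Omega> open_contains_ball by blast
  define D where "D = min d d'"
  have D: "0 < D / 2" using d d' by (simp add: D_def)
  have "eventually (\<lambda>k. dist (y k) a < D / 2) sequentially"
    using y D by (rule tendstoD)
  moreover have "eventually (\<lambda>k. r k < D / 2) sequentially"
    using r(1) D by (rule order_tendstoD(2))
  ultimately have "eventually (\<lambda>k. norm (mollified \<Omega> g (r k) (y k) - g a) < e) sequentially"
  proof eventually_elim
    case (elim k)
    have sub: "dist z a < D" if "z \<in> cball (y k) (r k)" for z
      using that elim dist_triangle[of z a "y k"] by (simp add: dist_commute)
    have "\<bar>mollified \<Omega> g (r k) (y k) - g a\<bar> \<le> e / 2"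
    proof (rule mollified_close[OF r(2) _ g])
      show "cball (y k) (r k) \<subseteq> \<Omega>"
        using sub d'(2) by (force simp: D_def dist_commute)
      show "\<bar>g z - g a\<bar> \<le> e / 2" if "z \<in> cball (y k) (r k)" for z
        using d(2)[of z] sub[OF that] by (simp add: D_def dist_real_def)
    qed
    then show ?case using e by simp
  qed
  then show "\<exists>N. \<forall>k\<ge>N. norm (mollified \<Omega> g (r k) (y k) - g a) < e"
    by (simp add: eventually_sequentially)
qed

text \<open>Moving the centre along \<open>v\<close> amounts to moving the argument along
  \<open>- v\<close>. This converts a derivative of the mollification into a distributional
  derivative of \<open>u\<close>.\<close>

lemma bump_line_derivative:
  "((\<lambda>s. bump r (x + s *\<^sub>R v) z) has_real_derivative
     - (\<Sum>j\<in>UNIV. v $ j * partial j (bump r (x + s *\<^sub>R v)) z)) (at s)"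
proof -
  have eq: "bump r (x + s *\<^sub>R v) z = bump r x (z - s *\<^sub>R v)" for s by (rule bump_translate)
  have p: "partial j (bump r (x + s *\<^sub>R v)) z = partial j (bump r x) (z - s *\<^sub>R v)" for j
    by (simp add: partial_bump algebra_simps)
  have "((\<lambda>s. z - s *\<^sub>R v) has_derivative (\<lambda>h. - (h *\<^sub>R v))) (at s)"
    by (auto intro!: derivative_eq_intros)
  from has_derivative_compose[OF this bump_has_derivative]
  have "((\<lambda>s. bump r x (z - s *\<^sub>R v)) has_derivative
     (\<lambda>h. \<Sum>j\<in>UNIV. (- (h *\<^sub>R v)) $ j * partial j (bump r x) (z - s *\<^sub>R v))) (at s)" .
  then show ?thesis
    unfolding eq p has_field_derivative_def
    by (rule has_derivative_eq_rhs) (auto simp: sum_negf sum_distrib_left mult_ac)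
qed

lemma continuous_on_partial_bump_line:
  "continuous_on S (\<lambda>p. partial j (bump r (x + fst p *\<^sub>R v)) (snd p))"
  unfolding partial_bump
  by (intro continuous_on_compose2[OF continuous_on_flat[of UNIV 2]] continuous_intros) auto

text \<open>The increment is expressed by the fundamental theorem of calculus for each fixed
  \<open>z\<close> together with Fubini's theorem in \<open>(s, z)\<close>, so nothing is
  differentiated under an integral. For each fixed \<open>s\<close>,
  \<open>sym_grad_bump_bound\<close> then applies to the integral in \<open>z\<close>.\<close>

lemma mollified_line_bound:
  fixes u :: "real^'n \<Rightarrow> real^'n" and v :: "real^'n"
  assumes u: "continuous_on \<Omega> u" and E: "has_sym_grad \<Omega> u E"
    and F[measurable]: "F \<in> borel_measurable borel"
    and EF: "AE z in lebesgue. z \<in> \<Omega> \<longrightarrow> norm (E z) \<le> F z"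
    and r: "0 < r" and ab: "a \<le> b" and seg: "\<And>s. s \<in> {a..b} \<Longrightarrow> cball (x + s *\<^sub>R v) r \<subseteq> \<Omega>"
  shows "ennreal \<bar>mollified \<Omega> (\<lambda>z. u z \<bullet> v) r (x + b *\<^sub>R v) - mollified \<Omega> (\<lambda>z. u z \<bullet> v) r (x + a *\<^sub>R v)\<bar>
     \<le> ennreal ((norm v)\<^sup>2) * (\<integral>\<^sup>+s\<in>{a..b}. (\<integral>\<^sup>+z. ennreal (F z) *
          ennreal (bump r (x + s *\<^sub>R v) z / bump_mass r TYPE('n)) \<partial>lborel) \<partial>lborel)"
proof -
  let ?p = "\<lambda>s. bump r (x + s *\<^sub>R v)" and ?g = "\<lambda>z. u z \<bullet> v" and ?B = "bump_mass r TYPE('n)"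
  let ?D = "\<lambda>s z. \<Sum>j\<in>UNIV. v $ j * partial j (?p s) z"
  have B: "0 < ?B" by (rule bump_mass_pos[OF r])
  \<comment> \<open>One compact set that carries all bumps centred on the segment; continuity on
    \<open>{a..b} \<times> K\<close> then gives integrability of the product integrand.\<close>
  define K where "K = (\<lambda>(s, w). x + s *\<^sub>R v + w) ` ({a..b} \<times> cball 0 r)"
  have K: "compact K"
    unfolding K_def by (intro compact_continuous_image compact_Times)
      (auto intro!: continuous_intros simp: case_prod_unfold)
  have K_cball: "cball (x + s *\<^sub>R v) r \<subseteq> K" if "s \<in> {a..b}" for s
  proof
    fix z assume z: "z \<in> cball (x + s *\<^sub>R v) r"
    have "z = (\<lambda>(s, w). x + s *\<^sub>R v + w) (s, z - (x + s *\<^sub>R v))" by simp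
    moreover have "(s, z - (x + s *\<^sub>R v)) \<in> {a..b} \<times> cball 0 r"
      using z that by (simp add: dist_norm norm_minus_commute)
    ultimately show "z \<in> K" unfolding K_def by (rule image_eqI)
  qed
  have K\<Omega>: "K \<subseteq> \<Omega>"
  proof
    fix z assume "z \<in> K"
    then obtain s w where s: "s \<in> {a..b}" "norm w \<le> r" "z = x + s *\<^sub>R v + w" by (auto simp: K_def)
    then have "z \<in> cball (x + s *\<^sub>R v) r" by (simp add: dist_norm)
    then show "z \<in> \<Omega>" using seg[OF s(1)] by blast
  qed
  have gc: "continuous_on K ?g" by (intro continuous_intros continuous_on_subset[OF u K\<Omega>])
  have pc: "continuous_on K (?p s)" for s by (intro continuous_on_bump continuous_intros)
  have Dc: "continuous_on K (?D s)" for s by (intro continuous_intros continuous_on_partial_bump)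
  have p0: "?p s z = 0" if "s \<in> {a..b}" "z \<notin> K" for s z
    using K_cball[OF that(1)] that(2) ball_subset_cball by (intro bump_outside[OF r]) blast
  have D0: "?D s z = 0" if "s \<in> {a..b}" "z \<notin> K" for s z
  proof -
    have "z \<notin> cball (x + s *\<^sub>R v) r" using K_cball[OF that(1)] that(2) by blast
    from partial_bump_outside[OF r this] show ?thesis by simp
  qed
  define h where "h s = (\<integral>z. indicator K z * (?g z * ?p s z) \<partial>lborel)" for s
  define H where "H s = (\<integral>z. indicator K z * (?g z * ?D s z) \<partial>lborel)" for s
  have h: "(LINT z:\<Omega>|lebesgue. ?g z * ?p s z) = h s" if "s \<in> {a..b}" for s
    unfolding h_def by (rule lebesgue_integral_support)
      (use K K\<Omega> p0[OF that] in \<open>auto intro!: continuous_on_mult gc pc\<close>)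
  have H: "(LINT z:\<Omega>|lebesgue. ?g z * ?D s z) = H s" if "s \<in> {a..b}" for s
    unfolding H_def by (rule lebesgue_integral_support)
      (use K K\<Omega> D0[OF that] in \<open>auto intro!: continuous_on_mult gc Dc\<close>)
  have int_h: "integrable lborel (\<lambda>z. indicator K z * (?g z * ?p s z))" for s
    using borel_integrable_compact[OF K continuous_on_mult[OF gc pc]] by simp
  let ?f = "\<lambda>p. indicator ({a..b} \<times> K) p *\<^sub>R (?g (snd p) * ?D (fst p) (snd p))"
  have int_f: "integrable (lborel :: (real \<times> (real^'n)) measure) ?f"
  proof (rule borel_integrable_compact)
    show "compact ({a..b} \<times> K)" by (intro compact_Times K) simp
    show "continuous_on ({a..b} \<times> K) (\<lambda>p. ?g (snd p) * ?D (fst p) (snd p))"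
      by (intro continuous_on_mult continuous_on_sum continuous_on_partial_bump_line
          continuous_on_compose2[OF gc] continuous_intros) auto
  qed
  then have int_f: "integrable (lborel \<Otimes>\<^sub>M lborel) ?f" by (simp add: lborel_prod)
  have fubini: "(\<integral>s. (\<integral>z. ?f (s, z) \<partial>lborel) \<partial>lborel) = (\<integral>z. (\<integral>s. ?f (s, z) \<partial>lborel) \<partial>lborel)"
    using lborel_pair.Fubini_integral[of "\<lambda>s z. ?f (s, z)"] int_f by (simp add: case_prod_unfold)
  have in1: "(\<integral>z. ?f (s, z) \<partial>lborel) = indicator {a..b} s * H s" for s
    unfolding H_def
    by (subst integral_mult_right_zero[symmetric]) (auto simp: indicator_times mult_ac intro!: Bochner_Integration.integral_cong)
  \<comment> \<open>The minus sign of \<open>bump_line_derivative\<close> is responsible for the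
    order \<open>a\<close>, \<open>b\<close> of the end points.\<close>
  have in2: "(\<integral>s. ?f (s, z) \<partial>lborel) = indicator K z * (?g z * ?p a z) - indicator K z * (?g z * ?p b z)" for z
  proof -
    have cont: "continuous_on {a..b} (\<lambda>s. ?D s z)"
    proof (intro continuous_on_sum continuous_on_mult continuous_on_const)
      fix j
      have "continuous_on {a..b} (\<lambda>s. (s, z))" by (intro continuous_intros)
      from continuous_on_compose2[OF continuous_on_partial_bump_line[of UNIV j r x v] this]
      show "continuous_on {a..b} (\<lambda>s. partial j (?p s) z)" by simp
    qed
    have "(\<integral>s. indicator {a..b} s *\<^sub>R (- ?D s z) \<partial>lborel) = ?p b z - ?p a z"
    proof (rule integral_FTC_Icc[OF ab])
      show "((\<lambda>s. ?p s z) has_vector_derivative - ?D s z) (at s within {a..b})" for s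
        using bump_line_derivative[of r x v z s] has_field_derivative_at_within
          has_real_derivative_iff_has_vector_derivative by blast
      show "continuous_on {a..b} (\<lambda>s. - ?D s z)" using cont by (rule continuous_on_minus)
    qed
    then have "(\<integral>s. indicator {a..b} s * ?D s z \<partial>lborel) = ?p a z - ?p b z" by simp
    moreover have "?f (s, z) = (indicator K z * ?g z) * (indicator {a..b} s * ?D s z)" for s
      by (simp add: indicator_times mult_ac)
    ultimately show ?thesis
      by (simp only: integral_mult_right_zero) (simp add: algebra_simps)
  qed
  have "h a - h b = (\<integral>z. indicator K z * (?g z * ?p a z) - indicator K z * (?g z * ?p b z) \<partial>lborel)"
    unfolding h_def by (intro Bochner_Integration.integral_diff[symmetric] int_h)
  also have "\<dots> = (\<integral>s. indicator {a..b} s * H s \<partial>lborel)"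
    unfolding in2[symmetric] fubini[symmetric] in1 ..
  finally have diff: "h a - h b = (\<integral>s. indicator {a..b} s * H s \<partial>lborel)" .
  have int_H: "integrable lborel (\<lambda>s. indicator {a..b} s * H s)"
    using lborel_pair.integrable_fst'[of "\<lambda>p. ?f p"] int_f unfolding in1 by simp
  have "ennreal \<bar>h b - h a\<bar> = ennreal (norm (\<integral>s. indicator {a..b} s * H s \<partial>lborel))"
    by (simp add: diff[symmetric] abs_minus_commute)
  also have "\<dots> \<le> (\<integral>\<^sup>+s. ennreal (norm (indicator {a..b} s * H s)) \<partial>lborel)"
    by (rule integral_norm_bound_ennreal[OF int_H])
  also have "\<dots> \<le> (\<integral>\<^sup>+s. ennreal ((norm v)\<^sup>2) * ((\<integral>\<^sup>+z. ennreal (F z) * ennreal (?p s z) \<partial>lborel) * indicator {a..b} s) \<partial>lborel)"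
  proof (rule nn_integral_mono)
    fix s
    show "ennreal (norm (indicator {a..b} s * H s))
      \<le> ennreal ((norm v)\<^sup>2) * ((\<integral>\<^sup>+z. ennreal (F z) * ennreal (?p s z) \<partial>lborel) * indicator {a..b} s)"
    proof (cases "s \<in> {a..b}")
      case True
      then show ?thesis
        using sym_grad_bump_bound[OF u E F EF r seg[OF True], of v] H[OF True] by simp
    qed simp
  qed
  also have "\<dots> = ennreal ((norm v)\<^sup>2) * (\<integral>\<^sup>+s\<in>{a..b}. (\<integral>\<^sup>+z. ennreal (F z) * ennreal (?p s z) \<partial>lborel) \<partial>lborel)"
    by (rule nn_integral_cmult) measurable
  finally have main: "ennreal \<bar>h b - h a\<bar> \<le> ennreal ((norm v)\<^sup>2) * (\<integral>\<^sup>+s\<in>{a..b}. (\<integral>\<^sup>+z. ennreal (F z) * ennreal (?p s z) \<partial>lborel) \<partial>lborel)" .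
  have "ennreal \<bar>mollified \<Omega> ?g r (x + b *\<^sub>R v) - mollified \<Omega> ?g r (x + a *\<^sub>R v)\<bar> = ennreal (1 / ?B) * ennreal \<bar>h b - h a\<bar>"
    using h[of a] h[of b] ab B
    by (subst ennreal_mult[symmetric]) (auto simp: mollified_def diff_divide_distrib[symmetric] abs_divide)
  also have "\<dots> \<le> ennreal (1 / ?B) * (ennreal ((norm v)\<^sup>2) * (\<integral>\<^sup>+s\<in>{a..b}. (\<integral>\<^sup>+z. ennreal (F z) * ennreal (?p s z) \<partial>lborel) \<partial>lborel))"
    by (intro mult_left_mono main) simp
  also have "\<dots> = ennreal ((norm v)\<^sup>2) * (ennreal (1 / ?B) * (\<integral>\<^sup>+s\<in>{a..b}. (\<integral>\<^sup>+z. ennreal (F z) * ennreal (?p s z) \<partial>lborel) \<partial>lborel))"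
    by (simp only: mult_ac)
  also have "ennreal (1 / ?B) * (\<integral>\<^sup>+s\<in>{a..b}. (\<integral>\<^sup>+z. ennreal (F z) * ennreal (?p s z) \<partial>lborel) \<partial>lborel)
     = (\<integral>\<^sup>+s. ennreal (1 / ?B) * ((\<integral>\<^sup>+z. ennreal (F z) * ennreal (?p s z) \<partial>lborel) * indicator {a..b} s) \<partial>lborel)"
    by (rule nn_integral_cmult[symmetric]) measurable
  also have "\<dots> = (\<integral>\<^sup>+s\<in>{a..b}. (\<integral>\<^sup>+z. ennreal (F z) * ennreal (?p s z / ?B) \<partial>lborel) \<partial>lborel)"
  proof (rule nn_integral_cong)
    fix s
    have "ennreal (F z) * ennreal (?p s z / ?B) = ennreal (1 / ?B) * (ennreal (F z) * ennreal (?p s z))" for z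
      using B ennreal_mult[of "1 / ?B" "?p s z"] bump_nonneg[of r "x + s *\<^sub>R v" z] by (simp add: mult_ac)
    then have "(\<integral>\<^sup>+z. ennreal (F z) * ennreal (?p s z / ?B) \<partial>lborel)
       = ennreal (1 / ?B) * (\<integral>\<^sup>+z. ennreal (F z) * ennreal (?p s z) \<partial>lborel)"
      by (simp add: nn_integral_cmult)
    then show "ennreal (1 / ?B) * ((\<integral>\<^sup>+z. ennreal (F z) * ennreal (?p s z) \<partial>lborel) * indicator {a..b} s)
       = (\<integral>\<^sup>+z. ennreal (F z) * ennreal (?p s z / ?B) \<partial>lborel) * indicator {a..b} s"
      by (simp only: mult.assoc)
  qed
  finally show ?thesis .
qed

section \<open>Integrals along rays and their averages over directions\<close>

text \<open>
  The mollification radius is coupled to the starting point \<open>2 r\<close> of the ray: there the mollified Riesz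
  kernel is dominated by the Riesz kernel, so that Fatou's lemma applies as \<open>r\<close> tends to \<open>0\<close>.
\<close>

definition moll_ray :: "(real^'n \<Rightarrow> real) \<Rightarrow> real^'n \<Rightarrow> real \<Rightarrow> real^'n \<Rightarrow> ennreal" where
  "moll_ray F x r v = (\<integral>\<^sup>+s\<in>{2 * r..}. (\<integral>\<^sup>+z. ennreal (F z) *
     ennreal (bump r (x + s *\<^sub>R v) z / bump_mass r TYPE('n)) \<partial>lborel) \<partial>lborel)"

text \<open>Stands for the integral of the density over the ray. On a single ray a genuine line
  integral need not bound the increment of \<open>u\<close>, the density being given only almost
  everywhere. The lower limit of mollified integrals does bound it, and Fatou's lemma controls its
  average over \<open>v\<close>.\<close>

definition ray_integral :: "(real^'n \<Rightarrow> real) \<Rightarrow> real^'n \<Rightarrow> real^'n \<Rightarrow> ennreal" where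
  "ray_integral F x v = liminf (\<lambda>k. moll_ray F x (1 / real (Suc k)) v)"

lemma borel_measurable_moll_ray [measurable]:
  assumes [measurable]: "F \<in> borel_measurable borel"
  shows "moll_ray F x r \<in> borel_measurable borel"
  unfolding moll_ray_def[abs_def] by measurable

lemma borel_measurable_ray_integral [measurable]:
  assumes [measurable]: "F \<in> borel_measurable borel"
  shows "ray_integral F x \<in> borel_measurable borel"
  unfolding ray_integral_def[abs_def] by measurable

text \<open>The segment is a compact subset of an open set, so small balls along it stay inside and
  each mollified increment is at most \<open>moll_ray\<close>. The starting points tend to
  \<open>x\<close>, and continuity of \<open>u\<close> identifies the limit of the
  increments.\<close>

lemma ray_integral_bound:
  fixes u :: "real^'n \<Rightarrow> real^'n" and v :: "real^'n"
  assumes \<Omega>: "open \<Omega>" and u: "continuous_on \<Omega> u" and E: "has_sym_grad \<Omega> u E"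
    and F: "F \<in> borel_measurable borel"
    and EF: "AE z in lebesgue. z \<in> \<Omega> \<longrightarrow> norm (E z) \<le> F z"
    and v: "norm v \<le> 1" and \<tau>: "0 < \<tau>" and seg: "\<And>s. s \<in> {0..\<tau>} \<Longrightarrow> x + s *\<^sub>R v \<in> \<Omega>"
  shows "ennreal \<bar>u (x + \<tau> *\<^sub>R v) \<bullet> v - u x \<bullet> v\<bar> \<le> ray_integral F x v"
proof -
  let ?g = "\<lambda>z. u z \<bullet> v"
  let ?r = "\<lambda>k. 1 / real (Suc k)"
  let ?M = "\<lambda>k. mollified \<Omega> ?g (?r k) (x + \<tau> *\<^sub>R v) - mollified \<Omega> ?g (?r k) (x + (2 * ?r k) *\<^sub>R v)"
  have r: "?r \<longlonglongrightarrow> 0" using LIMSEQ_Suc[OF lim_1_over_n[where 'a=real]] by simp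
  have g: "continuous_on \<Omega> ?g" by (intro continuous_intros u)
  have x: "x \<in> \<Omega>" "x + \<tau> *\<^sub>R v \<in> \<Omega>" using seg[of 0] seg[of \<tau>] \<tau> by auto
  have "(\<lambda>k. x + (2 * ?r k) *\<^sub>R v) \<longlonglongrightarrow> x + (2 * 0) *\<^sub>R v"
    by (intro tendsto_intros r)
  then have "?M \<longlonglongrightarrow> ?g (x + \<tau> *\<^sub>R v) - ?g x"
    by (intro tendsto_diff mollified_tendsto[OF \<Omega> _ g r] x) auto
  then have lim: "(\<lambda>k. ennreal \<bar>?M k\<bar>) \<longlonglongrightarrow> ennreal \<bar>?g (x + \<tau> *\<^sub>R v) - ?g x\<bar>"
    by (intro tendsto_ennrealI tendsto_rabs)
  define S where "S = (\<lambda>s. x + s *\<^sub>R v) ` {0..\<tau>}"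
  have "compact S" unfolding S_def by (intro compact_continuous_image continuous_intros) simp
  moreover have "S \<subseteq> \<Omega>" using seg by (auto simp: S_def)
  ultimately obtain e where e: "0 < e" "(\<Union>y\<in>S. cball y e) \<subseteq> \<Omega>"
    using compact_subset_open_imp_cball_epsilon_subset \<Omega> by metis
  \<comment> \<open>The bound \<open>\<tau> / 2\<close> keeps the starting parameter, twice the
    radius, below \<open>\<tau>\<close>.\<close>
  have "eventually (\<lambda>k. ?r k < min e (\<tau> / 2)) sequentially"
    using r e(1) \<tau> by (intro order_tendstoD(2)) auto
  then have "eventually (\<lambda>k. ennreal \<bar>?M k\<bar> \<le> moll_ray F x (?r k) v) sequentially"
  proof eventually_elim
    case (elim k)
    have rk: "0 < ?r k" by simp
    have "cball (x + s *\<^sub>R v) (?r k) \<subseteq> \<Omega>" if s: "s \<in> {2 * ?r k..\<tau>}" for s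
    proof -
      have "0 \<le> s" using s rk by (meson atLeastAtMost_iff mult_nonneg_nonneg order_trans zero_le_numeral less_imp_le)
      then have "x + s *\<^sub>R v \<in> S" using s by (auto simp: S_def)
      then have "cball (x + s *\<^sub>R v) e \<subseteq> \<Omega>" using e(2) by blast
      moreover have "cball (x + s *\<^sub>R v) (?r k) \<subseteq> cball (x + s *\<^sub>R v) e"
        using elim by (intro subset_cball) simp
      ultimately show ?thesis by blast
    qed
    then have "ennreal \<bar>?M k\<bar> \<le> ennreal ((norm v)\<^sup>2) * (\<integral>\<^sup>+s\<in>{2 * ?r k..\<tau>}. (\<integral>\<^sup>+z. ennreal (F z) *
          ennreal (bump (?r k) (x + s *\<^sub>R v) z / bump_mass (?r k) TYPE('n)) \<partial>lborel) \<partial>lborel)"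
      using elim by (intro mollified_line_bound[OF u E F EF rk]) auto
    also have "\<dots> \<le> 1 * moll_ray F x (?r k) v"
      unfolding moll_ray_def using v
      by (intro mult_mono nn_integral_mono mult_left_mono) (auto simp: ennreal_le_1 abs_square_le_1 indicator_def)
    finally show ?case by simp
  qed
  then have "liminf (\<lambda>k. ennreal \<bar>?M k\<bar>) \<le> ray_integral F x v"
    unfolding ray_integral_def by (rule Liminf_mono)
  then show ?thesis using lim_imp_Liminf[OF _ lim] by simp
qed

lemma nn_integral_affine:
  fixes f :: "'a::euclidean_space \<Rightarrow> ennreal"
  assumes [measurable]: "f \<in> borel_measurable borel" and s: "0 < s"
  shows "(\<integral>\<^sup>+v. f (x + s *\<^sub>R v) \<partial>lborel) = ennreal (1 / s ^ DIM('a)) * (\<integral>\<^sup>+y. f y \<partial>lborel)"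
proof -
  have "(\<integral>\<^sup>+y. f y \<partial>lborel) = ennreal (s ^ DIM('a)) * (\<integral>\<^sup>+v. f (x + s *\<^sub>R v) \<partial>lborel)"
    using s by (subst lborel_affine[of s x]) (simp_all add: nn_integral_density nn_integral_distr nn_integral_cmult)
  then have "ennreal (1 / s ^ DIM('a)) * (\<integral>\<^sup>+y. f y \<partial>lborel)
     = ennreal (1 / s ^ DIM('a)) * ennreal (s ^ DIM('a)) * (\<integral>\<^sup>+v. f (x + s *\<^sub>R v) \<partial>lborel)"
    by (simp only: mult.assoc)
  also have "ennreal (1 / s ^ DIM('a)) * ennreal (s ^ DIM('a)) = 1"
    using s by (simp add: ennreal_mult[symmetric])
  finally show ?thesis by simp
qed

lemma nn_integral_inverse_power_atLeast:
  assumes R: "0 < R" and m: "1 \<le> m"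
  shows "(\<integral>\<^sup>+s. ennreal (1 / s ^ Suc m) * indicator {R..} s \<partial>lborel) \<le> ennreal (1 / R ^ m)"
proof -
  define f where "f s = (if R \<le> s then 1 / s ^ Suc m else 0)" for s :: real
  have "(\<integral>\<^sup>+s. ennreal (1 / s ^ Suc m) * indicator {R..} s \<partial>lborel)
      = (\<integral>\<^sup>+s. ennreal (f s) * indicator {R..} s \<partial>lborel)"
    by (intro nn_integral_cong) (auto simp: f_def indicator_def)
  also have "\<dots> = ennreal (0 - (- (1 / (real m * R ^ m))))"
  proof (rule nn_integral_FTC_atLeast)
    show "f \<in> borel_measurable borel" unfolding f_def by measurable
    show "((\<lambda>s. - (1 / (real m * s ^ m))) has_real_derivative f s) (at s)" if "R \<le> s" for s
    proof -
      have s: "s \<noteq> 0" using that R by simp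
      obtain k where k: "m = Suc k" using m by (cases m) auto
      define c where "c = real (Suc k)"
      have c: "c \<noteq> 0" by (simp add: c_def)
      have "((\<lambda>s. s ^ Suc k) has_real_derivative c * s ^ k) (at s)"
        using DERIV_pow[of "Suc k" s] by (simp add: c_def)
      from DERIV_cmult[OF DERIV_inverse'[OF this], of "- (1 / c)"] s
      have "((\<lambda>s. - (1 / c) * inverse (s ^ Suc k)) has_real_derivative
          - (1 / c) * - (inverse (s ^ Suc k) * (c * s ^ k) * inverse (s ^ Suc k))) (at s)"
        by simp
      moreover have "- (1 / c) * - (inverse (s ^ Suc k) * (c * s ^ k) * inverse (s ^ Suc k)) = f s"
        using c s that by (simp add: f_def k field_simps)
      moreover have "(\<lambda>s. - (1 / c) * inverse (s ^ Suc k)) = (\<lambda>s. - (1 / (real m * s ^ m)))"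
        by (simp add: k c_def field_simps)
      ultimately show ?thesis by simp
    qed
    show "0 \<le> f s" if "R \<le> s" for s using that R by (simp add: f_def)
    have "((\<lambda>s::real. inverse (s ^ m)) \<longlongrightarrow> 0) at_top"
      using m by (intro tendsto_inverse_0_at_top filterlim_pow_at_top filterlim_ident) auto
    from tendsto_mult[OF tendsto_const[of "- 1 / real m"] this]
    show "((\<lambda>s. - (1 / (real m * s ^ m))) \<longlongrightarrow> 0) at_top"
      by (simp add: field_simps)
  qed
  also have "\<dots> \<le> ennreal (1 / R ^ m)"
    using R m by (intro ennreal_leI) (simp add: field_simps)
  finally show ?thesis .
qed

text \<open>The direction is integrated first: for fixed \<open>s\<close> the substitution
  \<open>y = x + s *\<^sub>R v\<close> turns the normalised bump into at most
  \<open>1 / s ^ n\<close>. The bump about \<open>x + s *\<^sub>R v\<close> reaches \<open>z\<close>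
  only if \<open>dist z x < s + r\<close>, which is at most \<open>3 / 2 * s\<close> because
  \<open>s \<ge> 2 * r\<close>. Integrating \<open>1 / s ^ n\<close> over
  \<open>s \<ge> 2 / 3 * dist z x\<close> produces the Riesz kernel and the constant.\<close>

lemma nn_integral_moll_ray_le:
  fixes x :: "real^'n"
  assumes dim: "2 \<le> CARD('n)" and F[measurable]: "F \<in> borel_measurable borel" and r: "0 < r"
  shows "(\<integral>\<^sup>+v\<in>ball 0 1. moll_ray F x r v \<partial>lborel)
    \<le> ennreal ((3 / 2) ^ (CARD('n) - 1)) * (\<integral>\<^sup>+z. ennreal (F z) * ennreal (1 / dist z x ^ (CARD('n) - 1)) \<partial>lborel)"
proof -
  define m where "m = CARD('n) - 1"
  have n: "CARD('n) = Suc m" "1 \<le> m" using dim by (auto simp: m_def)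
  let ?B = "bump_mass r TYPE('n)"
  have B: "0 < ?B" by (rule bump_mass_pos[OF r])
  define b where "b s v z = ennreal (bump r (x + s *\<^sub>R v) z / ?B)" for s v and z :: "real^'n"
  have b_meas[measurable (raw)]: "(\<lambda>w. b (f w) (g w) (h w)) \<in> borel_measurable M"
    if [measurable]: "f \<in> borel_measurable M" "g \<in> borel_measurable M" "h \<in> borel_measurable M"
    for f g h and M :: "'w measure"
    unfolding b_def by measurable
  have [measurable]: "ball (0::real^'n) 1 \<in> sets borel" by simp
  have inner: "(\<integral>\<^sup>+v\<in>ball 0 1. b s v z \<partial>lborel) \<le> ennreal (1 / s ^ Suc m) * indicator {2 / 3 * dist z x..} s"
    if s: "2 * r \<le> s" for s z
  proof (cases "2 / 3 * dist z x \<le> s")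
    case True
    have "(\<integral>\<^sup>+v\<in>ball 0 1. b s v z \<partial>lborel) \<le> (\<integral>\<^sup>+v. ennreal (bump r z (x + s *\<^sub>R v) / ?B) \<partial>lborel)"
      by (intro nn_integral_mono) (auto simp: b_def bump_def norm_minus_commute indicator_def)
    also have "\<dots> = ennreal (1 / s ^ CARD('n)) * (\<integral>\<^sup>+y. ennreal (bump r z y / ?B) \<partial>lborel)"
      using s r nn_integral_affine[of "\<lambda>y. ennreal (bump r z y / ?B)" s x] by simp
    also have "(\<integral>\<^sup>+y. ennreal (bump r z y / ?B) \<partial>lborel) = (\<integral>\<^sup>+y. ennreal (1 / ?B) * ennreal (bump r z y) \<partial>lborel)"
      using B by (intro nn_integral_cong) (simp add: ennreal_mult[symmetric] bump_nonneg)
    also have "\<dots> = ennreal (1 / ?B) * ennreal ?B"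
      by (subst nn_integral_cmult) (simp_all add: nn_integral_bump[OF r])
    also have "\<dots> = 1" using B by (simp add: ennreal_mult[symmetric])
    finally show ?thesis using True n by simp
  next
    case False
    have "bump r (x + s *\<^sub>R v) z = 0" if "v \<in> ball 0 1" for v
    proof (rule bump_outside[OF r])
      have "norm (s *\<^sub>R v) \<le> s * 1"
        using that s r by (simp del: mult_1_right add: mult_left_mono)
      then have "dist z x \<le> dist (x + s *\<^sub>R v) z + s"
        using norm_triangle_ineq4[of "s *\<^sub>R v" "x + s *\<^sub>R v - z"] by (simp add: dist_norm algebra_simps)
      then show "z \<notin> ball (x + s *\<^sub>R v) r" using False s by simp
    qed
    then have "(\<integral>\<^sup>+v\<in>ball 0 1. b s v z \<partial>lborel) = (\<integral>\<^sup>+v. 0 \<partial>(lborel :: (real^'n) measure))"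
      by (intro nn_integral_cong) (auto simp: b_def indicator_def)
    then show ?thesis by simp
  qed
  have "(\<integral>\<^sup>+v\<in>ball 0 1. moll_ray F x r v \<partial>lborel)
      = (\<integral>\<^sup>+v. (\<integral>\<^sup>+s. (\<integral>\<^sup>+z. ennreal (F z) * b s v z * indicator {2 * r..} s * indicator (ball 0 1) v \<partial>lborel) \<partial>lborel) \<partial>lborel)"
    unfolding moll_ray_def b_def[symmetric]
    by (intro nn_integral_cong) (simp add: nn_integral_multc)
  also have "\<dots> = (\<integral>\<^sup>+v. (\<integral>\<^sup>+z. (\<integral>\<^sup>+s. ennreal (F z) * b s v z * indicator {2 * r..} s * indicator (ball 0 1) v \<partial>lborel) \<partial>lborel) \<partial>lborel)"
    by (intro nn_integral_cong lborel_pair.Fubini') measurable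
  also have "\<dots> = (\<integral>\<^sup>+z. (\<integral>\<^sup>+v. (\<integral>\<^sup>+s. ennreal (F z) * b s v z * indicator {2 * r..} s * indicator (ball 0 1) v \<partial>lborel) \<partial>lborel) \<partial>lborel)"
    by (intro lborel_pair.Fubini') measurable
  also have "\<dots> = (\<integral>\<^sup>+z. (\<integral>\<^sup>+s. (\<integral>\<^sup>+v. ennreal (F z) * b s v z * indicator {2 * r..} s * indicator (ball 0 1) v \<partial>lborel) \<partial>lborel) \<partial>lborel)"
    by (intro nn_integral_cong lborel_pair.Fubini') measurable
  also have "\<dots> = (\<integral>\<^sup>+z. (\<integral>\<^sup>+s. ennreal (F z) * indicator {2 * r..} s * (\<integral>\<^sup>+v\<in>ball 0 1. b s v z \<partial>lborel) \<partial>lborel) \<partial>lborel)"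
    by (intro nn_integral_cong) (simp add: nn_integral_cmult[symmetric] mult_ac)
  also have "\<dots> \<le> (\<integral>\<^sup>+z. ennreal ((3 / 2) ^ m) * (ennreal (F z) * ennreal (1 / dist z x ^ m)) \<partial>lborel)"
  proof (rule nn_integral_mono_AE)
    \<comment> \<open>Off this null set the lower end of the integral in \<open>s\<close> is
      positive.\<close>
    have "AE z in lborel. z \<noteq> x"
      by (rule AE_lborel_singleton)
    then show "AE z in lborel. (\<integral>\<^sup>+s. ennreal (F z) * indicator {2 * r..} s * (\<integral>\<^sup>+v\<in>ball 0 1. b s v z \<partial>lborel) \<partial>lborel)
        \<le> ennreal ((3 / 2) ^ m) * (ennreal (F z) * ennreal (1 / dist z x ^ m))"
    proof eventually_elim
      case (elim z)
      have R: "0 < 2 / 3 * dist z x" using elim by simp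
      have "(\<integral>\<^sup>+s. ennreal (F z) * indicator {2 * r..} s * (\<integral>\<^sup>+v\<in>ball 0 1. b s v z \<partial>lborel) \<partial>lborel)
         \<le> (\<integral>\<^sup>+s. ennreal (F z) * (ennreal (1 / s ^ Suc m) * indicator {2 / 3 * dist z x..} s) \<partial>lborel)"
      proof (rule nn_integral_mono)
        fix s
        show "ennreal (F z) * indicator {2 * r..} s * (\<integral>\<^sup>+v\<in>ball 0 1. b s v z \<partial>lborel)
          \<le> ennreal (F z) * (ennreal (1 / s ^ Suc m) * indicator {2 / 3 * dist z x..} s)"
        proof (cases "2 * r \<le> s")
          case True
          then show ?thesis using mult_left_mono[OF inner[OF True, of z], of "ennreal (F z)"] by simp
        qed simp
      qed
      also have "\<dots> = ennreal (F z) * (\<integral>\<^sup>+s. ennreal (1 / s ^ Suc m) * indicator {2 / 3 * dist z x..} s \<partial>lborel)"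
        by (rule nn_integral_cmult) measurable
      also have "\<dots> \<le> ennreal (F z) * ennreal (1 / (2 / 3 * dist z x) ^ m)"
        by (intro mult_left_mono nn_integral_inverse_power_atLeast R n) simp
      also have "1 / (2 / 3 * dist z x) ^ m = (3 / 2) ^ m * (1 / dist z x ^ m)"
        by (simp add: power_mult_distrib power_divide)
      also have "ennreal ((3 / 2) ^ m * (1 / dist z x ^ m)) = ennreal ((3 / 2) ^ m) * ennreal (1 / dist z x ^ m)"
        by (rule ennreal_mult) auto
      finally show ?case by (simp only: mult.left_commute)
    qed
  qed
  also have "\<dots> = ennreal ((3 / 2) ^ m) * (\<integral>\<^sup>+z. ennreal (F z) * ennreal (1 / dist z x ^ m) \<partial>lborel)"
    by (rule nn_integral_cmult) measurable
  finally show ?thesis by (simp add: m_def)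
qed

text \<open>Fatou's lemma, applicable since the bound on \<open>moll_ray\<close> does not depend on
  the radius.\<close>

lemma nn_integral_ray_integral_le:
  fixes x :: "real^'n"
  assumes dim: "2 \<le> CARD('n)" and F[measurable]: "F \<in> borel_measurable borel"
  shows "(\<integral>\<^sup>+v\<in>ball 0 1. ray_integral F x v \<partial>lborel)
    \<le> ennreal ((3 / 2) ^ (CARD('n) - 1)) * (\<integral>\<^sup>+z. ennreal (F z) * ennreal (1 / dist z x ^ (CARD('n) - 1)) \<partial>lborel)"
    (is "_ \<le> ?R")
proof -
  have [measurable]: "ball (0::real^'n) 1 \<in> sets borel" by simp
  have "(\<integral>\<^sup>+v\<in>ball 0 1. ray_integral F x v \<partial>lborel)
      = (\<integral>\<^sup>+v. liminf (\<lambda>k. moll_ray F x (1 / real (Suc k)) v * indicator (ball 0 1) v) \<partial>lborel)"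
    by (intro nn_integral_cong) (auto simp: ray_integral_def indicator_def Liminf_const)
  also have "\<dots> \<le> liminf (\<lambda>k. \<integral>\<^sup>+v\<in>ball 0 1. moll_ray F x (1 / real (Suc k)) v \<partial>lborel)"
    by (rule nn_integral_liminf) measurable
  also have "\<dots> \<le> liminf (\<lambda>k. ?R)"
    by (intro Liminf_mono always_eventually allI nn_integral_moll_ray_le dim F) simp
  also have "\<dots> = ?R" by (rule Liminf_const) simp
  finally show ?thesis .
qed

text \<open>Either the ray stays in \<open>\<Omega>\<close>, and \<open>u\<close> vanishes far out
  because its support is bounded, or it leaves, and the estimate is carried to the first exit point
  by continuity of \<open>u\<close> on the closure. The conclusion asserts only that some boundary
  point of the ray works, so no hitting map has to be defined.\<close>

lemma ray_estimate:
  fixes u :: "real^'n \<Rightarrow> real^'n" and v :: "real^'n"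
  assumes \<Omega>: "open \<Omega>" and u: "u \<in> C_b (closure \<Omega>)" and E: "has_sym_grad \<Omega> u E"
    and F: "F \<in> borel_measurable borel"
    and EF: "AE z in lebesgue. z \<in> \<Omega> \<longrightarrow> norm (E z) \<le> F z"
    and x: "x \<in> \<Omega>" and v: "v \<in> ball 0 1"
  shows "ennreal \<bar>v \<bullet> u x\<bar> \<le> ray_integral F x v \<or>
    (\<exists>s>0. x + s *\<^sub>R v \<in> frontier \<Omega> \<and> ennreal \<bar>v \<bullet> u x\<bar> \<le> ray_integral F x v + ennreal (norm (u (x + s *\<^sub>R v))))"
proof -
  have uc: "continuous_on (closure \<Omega>) u" and ub: "bounded {z \<in> closure \<Omega>. u z \<noteq> 0}"
    using u by (auto simp: C_b_def)
  have uo: "continuous_on \<Omega> u" using uc closure_subset by (rule continuous_on_subset)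
  have v1: "norm v \<le> 1" using v by simp
  note ray = ray_integral_bound[OF \<Omega> uo E F EF v1]
  consider "v = 0" | "v \<noteq> 0" "\<And>s. 0 \<le> s \<Longrightarrow> x + s *\<^sub>R v \<in> \<Omega>"
    | s where "v \<noteq> 0" "0 \<le> s" "x + s *\<^sub>R v \<notin> \<Omega>" by blast
  then show ?thesis
  proof cases
    case 1
    then show ?thesis by simp
  next
    case 2
    obtain b where b: "\<And>z. z \<in> closure \<Omega> \<Longrightarrow> u z \<noteq> 0 \<Longrightarrow> norm z \<le> b"
      using ub unfolding bounded_iff by blast
    \<comment> \<open>Chosen so that \<open>x + \<tau> *\<^sub>R v\<close> has norm greater than
      \<open>b\<close> and lies outside the support.\<close>
    define \<tau> where "\<tau> = (\<bar>b\<bar> + norm x + 1) / norm v"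
    have \<tau>: "0 < \<tau>" using 2(1) by (simp add: \<tau>_def divide_pos_pos add_nonneg_pos)
    have "\<bar>b\<bar> + norm x + 1 = norm (\<tau> *\<^sub>R v)"
      using 2(1) \<tau> by (simp add: \<tau>_def add_nonneg_nonneg)
    also have "\<dots> \<le> norm (x + \<tau> *\<^sub>R v) + norm x"
      using norm_triangle_ineq4[of "x + \<tau> *\<^sub>R v" x] by simp
    finally have "b < norm (x + \<tau> *\<^sub>R v)" by linarith
    moreover have "x + \<tau> *\<^sub>R v \<in> closure \<Omega>"
      using 2(2)[of \<tau>] \<tau> closure_subset[of \<Omega>] by auto
    ultimately have "u (x + \<tau> *\<^sub>R v) = 0" using b by fastforce
    then have "ennreal \<bar>v \<bullet> u x\<bar> \<le> ray_integral F x v"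
      using ray[OF \<tau>, of x] 2(2) by (simp add: inner_commute)
    then show ?thesis ..
  next
    case (3 s0)
    define T where "T = {0..} \<inter> (\<lambda>s. x + s *\<^sub>R v) -` (- \<Omega>)"
    have "closed T"
      unfolding T_def using \<Omega> by (intro closed_Int closed_vimage continuous_intros) auto
    moreover have T: "T \<noteq> {}" "bdd_below T" using 3 by (auto simp: T_def intro: bdd_belowI)
    ultimately have tT: "Inf T \<in> T" by (intro closed_contains_Inf)
    define t where "t = Inf T"
    have t: "0 \<le> t" "x + t *\<^sub>R v \<notin> \<Omega>" using tT by (auto simp: T_def t_def)
    then have t0: "0 < t" using x by (cases "t = 0") auto
    have seg: "x + s *\<^sub>R v \<in> \<Omega>" if "0 \<le> s" "s < t" for s
    proof (rule ccontr)
      assume "x + s *\<^sub>R v \<notin> \<Omega>"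
      then have "s \<in> T" using that by (simp add: T_def)
      then have "t \<le> s" unfolding t_def using T(2) by (rule cInf_lower)
      then show False using that by simp
    qed
    \<comment> \<open>Parameters tending to the exit parameter from below; the double
      \<open>Suc\<close> keeps \<open>\<sigma> 0\<close> positive.\<close>
    define \<sigma> where "\<sigma> k = t * (1 - 1 / real (Suc (Suc k)))" for k
    have \<sigma>: "0 < \<sigma> k" "\<sigma> k < t" for k using t0 by (auto simp: \<sigma>_def field_simps add_pos_nonneg)
    have "(\<lambda>k. 1 / real (Suc (Suc k))) \<longlonglongrightarrow> 0"
      using LIMSEQ_Suc[OF LIMSEQ_Suc[OF lim_1_over_n[where 'a=real]]] by simp
    then have "\<sigma> \<longlonglongrightarrow> t * (1 - 0)" unfolding \<sigma>_def by (intro tendsto_intros)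
    then have \<sigma>t: "(\<lambda>k. x + \<sigma> k *\<^sub>R v) \<longlonglongrightarrow> x + t *\<^sub>R v" by (intro tendsto_intros) simp
    have cl: "x + t *\<^sub>R v \<in> closure \<Omega>"
      unfolding closure_sequential using seg \<sigma> \<sigma>t by (meson less_imp_le)
    then have fr: "x + t *\<^sub>R v \<in> frontier \<Omega>"
      using t(2) \<Omega> by (simp add: frontier_def interior_open)
    have in_cl: "x + \<sigma> k *\<^sub>R v \<in> closure \<Omega>" for k
      using seg[of "\<sigma> k"] \<sigma>[of k] closure_subset by (meson less_imp_le subsetD)
    have "(\<lambda>k. u (x + \<sigma> k *\<^sub>R v)) \<longlonglongrightarrow> u (x + t *\<^sub>R v)"
      by (rule continuous_on_tendsto_compose[OF uc \<sigma>t cl]) (simp add: in_cl)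
    then have "(\<lambda>k. \<bar>u (x + \<sigma> k *\<^sub>R v) \<bullet> v - u x \<bullet> v\<bar>) \<longlonglongrightarrow> \<bar>u (x + t *\<^sub>R v) \<bullet> v - u x \<bullet> v\<bar>"
      by (intro tendsto_intros)
    from tendsto_ennrealI[OF this]
    have "ennreal \<bar>u (x + t *\<^sub>R v) \<bullet> v - u x \<bullet> v\<bar> \<le> ray_integral F x v"
    proof (rule LIMSEQ_le_const2)
      have "ennreal \<bar>u (x + \<sigma> k *\<^sub>R v) \<bullet> v - u x \<bullet> v\<bar> \<le> ray_integral F x v" for k
        using \<sigma>[of k] seg by (intro ray) auto
      then show "\<exists>N. \<forall>k\<ge>N. ennreal \<bar>u (x + \<sigma> k *\<^sub>R v) \<bullet> v - u x \<bullet> v\<bar> \<le> ray_integral F x v" by blast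
    qed
    moreover have "\<bar>v \<bullet> u x\<bar> \<le> \<bar>u (x + t *\<^sub>R v) \<bullet> v - u x \<bullet> v\<bar> + norm (u (x + t *\<^sub>R v))"
    proof -
      have "\<bar>u (x + t *\<^sub>R v) \<bullet> v\<bar> \<le> norm (u (x + t *\<^sub>R v)) * norm v" by (rule Cauchy_Schwarz_ineq2)
      also have "\<dots> \<le> norm (u (x + t *\<^sub>R v))" using v1 by (simp add: mult_left_le)
      finally show ?thesis by (simp add: inner_commute)
    qed
    then have "ennreal \<bar>v \<bullet> u x\<bar> \<le> ennreal \<bar>u (x + t *\<^sub>R v) \<bullet> v - u x \<bullet> v\<bar> + ennreal (norm (u (x + t *\<^sub>R v)))"
      by (metis abs_ge_zero ennreal_leI ennreal_plus norm_ge_zero)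
    ultimately have "ennreal \<bar>v \<bullet> u x\<bar> \<le> ray_integral F x v + ennreal (norm (u (x + t *\<^sub>R v)))"
      by (meson add_right_mono order_trans)
    then show ?thesis using t0 fr by blast
  qed
qed

section \<open>Weighted sequences and Lorentz--Zygmund norms\<close>

text \<open>The weighted inequality between arithmetic and geometric mean, proved by induction so
  that no real exponents occur. It drives Hardy's inequality and later takes the place of
  Hoelder's.\<close>

lemma weighted_mean_le:
  fixes x y :: real
  assumes x: "0 \<le> x" and y: "0 \<le> y"
  shows "real (Suc m) * (x * y ^ m) \<le> x ^ Suc m + real m * y ^ Suc m"
proof (induction m)
  case (Suc m)
  have "0 \<le> (x - y) * (x ^ Suc m - y ^ Suc m)"
  proof (cases "x \<le> y")
    case True
    then have "x ^ Suc m \<le> y ^ Suc m" using x by (intro power_mono)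
    with True show ?thesis by (intro mult_nonpos_nonpos) auto
  next
    case False
    then have "y ^ Suc m \<le> x ^ Suc m" using y by (intro power_mono) auto
    with False show ?thesis by (intro mult_nonneg_nonneg) auto
  qed
  then have "x * y ^ Suc m + y * x ^ Suc m \<le> x ^ Suc (Suc m) + y ^ Suc (Suc m)"
    by (simp add: algebra_simps)
  moreover have "y * (real (Suc m) * (x * y ^ m)) \<le> y * (x ^ Suc m + real m * y ^ Suc m)"
    using Suc y by (rule mult_left_mono)
  ultimately show ?case by (simp add: algebra_simps)
qed simp

text \<open>Elliott's telescoping proof of Hardy's inequality.\<close>

lemma hardy_telescope:
  fixes c :: "nat \<Rightarrow> real" and m :: nat
  defines "A N \<equiv> (\<Sum>j<N. c j) / real N"
  assumes c: "\<And>j. 0 \<le> c j" and m: "1 \<le> m"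
  shows "(\<Sum>k<N. real m * A (Suc k) ^ Suc m) + real N * A N ^ Suc m
     \<le> (\<Sum>k<N. real (Suc m) * (A (Suc k) ^ m * c k))"
proof (induction N)
  case (Suc N)
  have A0: "0 \<le> A k" for k unfolding A_def using c by (intro divide_nonneg_nonneg sum_nonneg) auto
  have cN: "c N = real (Suc N) * A (Suc N) - real N * A N"
    by (cases "N = 0") (simp_all add: A_def)
  have "real (Suc m) * (A (Suc N) ^ m * c N) = real (Suc m) * real (Suc N) * A (Suc N) ^ Suc m
      - real N * (real (Suc m) * (A N * A (Suc N) ^ m))"
    unfolding cN by (simp add: algebra_simps)
  moreover have "real N * (real (Suc m) * (A N * A (Suc N) ^ m)) \<le> real N * (A N ^ Suc m + real m * A (Suc N) ^ Suc m)"
    by (intro mult_left_mono weighted_mean_le A0) simp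
  ultimately have "real m * A (Suc N) ^ Suc m + real (Suc N) * A (Suc N) ^ Suc m - real N * A N ^ Suc m
     \<le> real (Suc m) * (A (Suc N) ^ m * c N)"
    by (simp add: algebra_simps)
  with Suc show ?case by simp
qed (simp add: A_def)

text \<open>Telescoping bounds \<open>m\<close> times the sum of \<open>A k ^ Suc m\<close> by
  \<open>Suc m\<close> times the sum of \<open>A k ^ m * c k\<close>. Comparing \<open>c k\<close>
  with \<open>A k / 4\<close> splits each product into a quarter of \<open>A k ^ Suc m\<close> and a
  multiple of \<open>c k ^ Suc m\<close>; since \<open>Suc m \<le> 2 * m\<close>, half of the sum on
  the left can be absorbed. The constant is not sharp.\<close>

lemma hardy_finite:
  fixes c :: "nat \<Rightarrow> real"
  assumes c: "\<And>j. 0 \<le> c j" and m: "1 \<le> m"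
  shows "(\<Sum>k<N. ((\<Sum>j<Suc k. c j) / real (Suc k)) ^ Suc m) \<le> 4 ^ Suc m * (\<Sum>k<N. c k ^ Suc m)"
proof -
  define A where "A k = (\<Sum>j<Suc k. c j) / real (Suc k)" for k
  have A0: "0 \<le> A k" for k unfolding A_def using c by (intro divide_nonneg_nonneg sum_nonneg) auto
  have young: "A k ^ m * c k \<le> A k ^ Suc m / 4 + 4 ^ m * c k ^ Suc m" for k
  proof (cases "c k \<le> A k / 4")
    case True
    then have "A k ^ m * c k \<le> A k ^ m * (A k / 4)" using A0 by (intro mult_left_mono) auto
    also have "\<dots> \<le> A k ^ Suc m / 4 + 4 ^ m * c k ^ Suc m" using c by (simp add: mult.commute)
    finally show ?thesis .
  next
    case False
    then have "A k ^ m * c k \<le> (4 * c k) ^ m * c k"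
      using A0 c by (intro mult_right_mono power_mono) auto
    also have "\<dots> = 4 ^ m * c k ^ Suc m" by (simp add: power_mult_distrib)
    also have "\<dots> \<le> A k ^ Suc m / 4 + 4 ^ m * c k ^ Suc m" using A0 by simp
    finally show ?thesis .
  qed
  have "real m * (\<Sum>k<N. A k ^ Suc m) \<le> (\<Sum>k<N. real (Suc m) * (A k ^ m * c k))"
  proof -
    have "0 \<le> real N * ((\<Sum>j<N. c j) / real N) ^ Suc m"
      using c by (intro mult_nonneg_nonneg zero_le_power divide_nonneg_nonneg sum_nonneg) auto
    then show ?thesis
      using hardy_telescope[of c m N, OF c m] unfolding A_def sum_distrib_left by linarith
  qed
  also have "\<dots> \<le> (\<Sum>k<N. real (Suc m) * (A k ^ Suc m / 4 + 4 ^ m * c k ^ Suc m))"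
    by (intro sum_mono mult_left_mono young) simp
  also have "\<dots> = real (Suc m) * ((\<Sum>k<N. A k ^ Suc m) / 4 + 4 ^ m * (\<Sum>k<N. c k ^ Suc m))"
    by (simp only: sum_distrib_left[symmetric] sum.distrib sum_divide_distrib)
  also have "\<dots> \<le> (2 * real m) * ((\<Sum>k<N. A k ^ Suc m) / 4 + 4 ^ m * (\<Sum>k<N. c k ^ Suc m))"
    using m A0 c by (intro mult_right_mono add_nonneg_nonneg mult_nonneg_nonneg divide_nonneg_nonneg sum_nonneg) auto
  finally have "real m * (\<Sum>k<N. A k ^ Suc m)
     \<le> real m * ((\<Sum>k<N. A k ^ Suc m) / 2 + 2 * 4 ^ m * (\<Sum>k<N. c k ^ Suc m))"
    by (simp add: algebra_simps)
  then have "(\<Sum>k<N. A k ^ Suc m) \<le> (\<Sum>k<N. A k ^ Suc m) / 2 + 2 * 4 ^ m * (\<Sum>k<N. c k ^ Suc m)"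
    using m by (subst (asm) mult_le_cancel_left_pos) auto
  then show ?thesis by (simp add: A_def)
qed

lemma hardy_inequality:
  fixes c :: "nat \<Rightarrow> real"
  assumes c: "\<And>j. 0 \<le> c j" and n: "2 \<le> n"
  shows "(\<Sum>k. ennreal (((\<Sum>j<Suc k. c j) / real (Suc k)) ^ n)) \<le> ennreal (4 ^ n) * (\<Sum>k. ennreal (c k ^ n))"
proof (rule suminf_le_const)
  fix N
  obtain m where m: "n = Suc m" "1 \<le> m" using n by (cases n) auto
  have "(\<Sum>k<N. ennreal (((\<Sum>j<Suc k. c j) / real (Suc k)) ^ n))
     = ennreal (\<Sum>k<N. ((\<Sum>j<Suc k. c j) / real (Suc k)) ^ n)"
    using c by (intro sum_ennreal zero_le_power divide_nonneg_nonneg sum_nonneg) auto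
  also have "\<dots> \<le> ennreal (4 ^ n * (\<Sum>k<N. c k ^ n))"
    unfolding m(1) by (intro ennreal_leI hardy_finite c m)
  also have "\<dots> = ennreal (4 ^ n) * (\<Sum>k<N. ennreal (c k ^ n))"
    using c by (subst sum_ennreal) (auto simp: ennreal_mult' )
  also have "\<dots> \<le> ennreal (4 ^ n) * (\<Sum>k. ennreal (c k ^ n))"
    by (intro mult_left_mono sum_le_suminf) auto
  finally show "(\<Sum>k<N. ennreal (((\<Sum>j<Suc k. c j) / real (Suc k)) ^ n)) \<le> ennreal (4 ^ n) * (\<Sum>k. ennreal (c k ^ n))" .
qed auto

section \<open>Powers of extended reals and weighted sums of sequences\<close>

lemma epowr_of_nat: "0 < n \<Longrightarrow> epowr x (real n) = x ^ n"
  by (cases x) (auto simp: epowr_def ennreal_power powr_realpow' top_power_ennreal)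

lemma epowr_inverse_le:
  assumes n: "0 < n" and le: "I \<le> y ^ n"
  shows "epowr I (1 / real n) \<le> y"
proof (cases y)
  case (real t)
  then have "I \<le> ennreal (t ^ n)" using le by (simp add: ennreal_power)
  then obtain i where i: "I = ennreal i" "0 \<le> i" "i \<le> t ^ n"
    using real by (cases I) (auto simp: top_unique)
  have "i powr (1 / real n) \<le> (t ^ n) powr (1 / real n)"
    using i by (intro powr_mono2) auto
  also have "(t ^ n) powr (1 / real n) = t"
    using n real by (cases "t = 0") (simp_all add: powr_realpow[symmetric] powr_powr)
  finally show ?thesis using i real by (simp add: epowr_def ennreal_leI)
qed simp

text \<open>Norms are compared through their \<open>n\<close>-th powers, where only integer
  exponents occur; this lemma leads there and \<open>power_le_imp_le_ennreal\<close> leads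
  back.\<close>

lemma epowr_inverse_power:
  assumes n: "0 < n"
  shows "epowr I (1 / real n) ^ n = I"
proof (cases I)
  case (real i)
  have "(i powr (1 / real n)) ^ n = i"
    using n real by (cases "i = 0") (simp_all add: powr_realpow[symmetric] powr_powr)
  then show ?thesis using real by (simp add: epowr_def ennreal_power)
qed (use n in \<open>simp add: epowr_def top_power_ennreal\<close>)

lemma epowr_power_inverse:
  assumes n: "0 < n"
  shows "epowr (x ^ n) (1 / real n) = x"
proof (cases x)
  case (real r)
  have "(r ^ n) powr (1 / real n) = r"
    using n real by (cases "r = 0") (simp_all add: powr_realpow[symmetric] powr_powr)
  then show ?thesis using real by (simp add: epowr_def ennreal_power)
qed (use n in \<open>simp add: epowr_def top_power_ennreal\<close>)

lemma power_le_imp_le_ennreal: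
  fixes x y :: ennreal
  assumes "0 < n" "x ^ n \<le> y ^ n"
  shows "x \<le> y"
  using epowr_inverse_le[OF assms] by (simp add: epowr_power_inverse assms(1))

lemma add_power_le_ennreal:
  fixes x y :: ennreal
  shows "(x + y) ^ n \<le> 2 ^ n * (x ^ n + y ^ n)"
proof -
  have "x + y \<le> 2 * max x y"
    by (metis add_mono max.cobounded1 max.cobounded2 mult_2)
  then have "(x + y) ^ n \<le> (2 * max x y) ^ n" by (rule power_mono) simp
  also have "\<dots> = 2 ^ n * max x y ^ n" by (rule power_mult_distrib)
  also have "\<dots> \<le> 2 ^ n * (x ^ n + y ^ n)"
    by (intro mult_left_mono) (auto simp: max_def add_increasing add_increasing2)
  finally show ?thesis .
qed

text \<open>Bernoulli's inequality. The ratio \<open>5 / 4\<close> is chosen so that its products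
  with \<open>1 / 2\<close> and \<open>2 / 3\<close> remain below 1.\<close>

lemma Suc_le_geometric: "real (Suc i) \<le> 4 * (5 / 4) ^ i"
proof -
  have "1 + real i * (1 / 4) \<le> (1 + 1 / 4) ^ i" by (rule Bernoulli_inequality) simp
  then show ?thesis by simp
qed

text \<open>If \<open>\<rho> ^ n\<close> is the series on the right without its factor, then every
  term \<open>(2/3) ^ i * x i\<close> is at most \<open>\<rho>\<close>, and the remaining ratio
  \<open>3 / 4\<close> sums to 4.\<close>

lemma tail_power_le:
  fixes x :: "nat \<Rightarrow> ennreal"
  assumes n: "0 < n"
  shows "(\<Sum>i. ennreal ((1/2) ^ i) * x i) ^ n \<le> ennreal (4 ^ n) * (\<Sum>i. (ennreal ((2/3) ^ i) * x i) ^ n)"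
proof (cases "(\<Sum>i. (ennreal ((2/3) ^ i) * x i) ^ n)")
  case (real S)
  define \<rho> where "\<rho> = root n S"
  have \<rho>: "0 \<le> \<rho>" "\<rho> ^ n = S" using n real by (auto simp: \<rho>_def)
  have y: "ennreal ((2/3) ^ i) * x i \<le> ennreal \<rho>" for i
  proof -
    have "(ennreal ((2/3) ^ i) * x i) ^ n \<le> ennreal S"
      unfolding real(2)[symmetric] using sum_le_suminf[OF summableI, of "{i}"] by simp
    also have "\<dots> = ennreal \<rho> ^ n" using \<rho> by (simp add: ennreal_power)
    finally show ?thesis by (rule power_le_imp_le_ennreal[OF n])
  qed
  have *: "ennreal ((1/2) ^ i) * x i \<le> ennreal (\<rho> * (3/4) ^ i)" for i
  proof -
    have "ennreal ((1/2) ^ i) * x i = ennreal ((3/4) ^ i) * (ennreal ((2/3) ^ i) * x i)"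
      by (simp add: mult.assoc[symmetric] ennreal_mult[symmetric] power_mult_distrib[symmetric])
    also have "\<dots> \<le> ennreal ((3/4) ^ i) * ennreal \<rho>" by (intro mult_left_mono y) simp
    finally show ?thesis using \<rho> by (simp add: ennreal_mult[symmetric] mult.commute)
  qed
  have "(\<Sum>i. ennreal ((1/2) ^ i) * x i) \<le> (\<Sum>i. ennreal (\<rho> * (3/4) ^ i))"
    by (intro suminf_le *) auto
  also have "\<dots> = ennreal (4 * \<rho>)"
    using geometric_sums[of "3/4::real"] sums_mult[of _ 4 \<rho>] \<rho>
    by (intro suminf_ennreal_eq) (auto simp: mult.commute)
  finally have "(\<Sum>i. ennreal ((1/2) ^ i) * x i) ^ n \<le> ennreal (4 * \<rho>) ^ n" by (rule power_mono) simp
  also have "\<dots> = ennreal (4 ^ n) * ennreal S"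
    using \<rho> real by (simp add: ennreal_power ennreal_mult[symmetric] power_mult_distrib)
  finally show ?thesis using real by simp
qed (simp add: ennreal_mult_top)

text \<open>For \<open>x k\<close> the rearrangement at \<open>M * (1/2) ^ k\<close>, essentially
  the \<open>n\<close>-th power of the Lorentz-Zygmund norm: on a dyadic interval the logarithm is
  comparable to \<open>Suc k\<close>, and the weight \<open>1 / s\<close> gives all these intervals
  the same mass.\<close>

definition weighted_sum :: "nat \<Rightarrow> (nat \<Rightarrow> ennreal) \<Rightarrow> ennreal" where
  "weighted_sum n x = (\<Sum>k. (ennreal (1 / real (Suc k)) * x k) ^ n)"

lemma weighted_sum_mono: "(\<And>k. x k \<le> y k) \<Longrightarrow> weighted_sum n x \<le> weighted_sum n y"
  unfolding weighted_sum_def by (intro suminf_le power_mono mult_left_mono) auto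

lemma weighted_sum_cmult: "weighted_sum n (\<lambda>k. c * x k) = c ^ n * weighted_sum n x"
proof -
  have "(ennreal (1 / real (Suc k)) * (c * x k)) ^ n = c ^ n * (ennreal (1 / real (Suc k)) * x k) ^ n" for k
    by (simp only: power_mult_distrib mult_ac)
  then show ?thesis unfolding weighted_sum_def by (simp only: ennreal_suminf_cmult)
qed

lemma weighted_sum_add: "weighted_sum n (\<lambda>k. x k + y k) \<le> 2 ^ n * (weighted_sum n x + weighted_sum n y)"
proof -
  have "weighted_sum n (\<lambda>k. x k + y k)
    \<le> (\<Sum>k. 2 ^ n * ((ennreal (1 / real (Suc k)) * x k) ^ n + (ennreal (1 / real (Suc k)) * y k) ^ n))"
    unfolding weighted_sum_def
  proof (intro suminf_le summableI)
    fix k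
    show "(ennreal (1 / real (Suc k)) * (x k + y k)) ^ n
      \<le> 2 ^ n * ((ennreal (1 / real (Suc k)) * x k) ^ n + (ennreal (1 / real (Suc k)) * y k) ^ n)"
      unfolding distrib_left[of "ennreal (1 / real (Suc k))"] by (rule add_power_le_ennreal)
  qed
  also have "\<dots> = 2 ^ n * (weighted_sum n x + weighted_sum n y)"
    unfolding weighted_sum_def by (simp only: ennreal_suminf_cmult suminf_add[OF summableI summableI])
  finally show ?thesis .
qed

text \<open>Since \<open>n \<ge> 2\<close>, the terms are dominated by the telescoping differences
  \<open>2 / Suc k - 2 / Suc (Suc k)\<close>.\<close>

lemma weighted_sum_one:
  assumes n: "2 \<le> n"
  shows "weighted_sum n (\<lambda>_. 1) \<le> 2"
proof -
  have "weighted_sum n (\<lambda>_. 1) \<le> (\<Sum>k. ennreal (1 / real (Suc k) ^ 2))"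
    unfolding weighted_sum_def
  proof (intro suminf_le summableI)
    fix k
    have "(1 / real (Suc k)) ^ n \<le> (1 / real (Suc k)) ^ 2"
      using n by (intro power_decreasing) auto
    then show "(ennreal (1 / real (Suc k)) * 1) ^ n \<le> ennreal (1 / real (Suc k) ^ 2)"
      by (simp add: ennreal_power power_divide ennreal_leI del: of_nat_Suc)
  qed
  also have "\<dots> \<le> 2"
  proof (rule suminf_le_const)
    fix N
    have "(\<Sum>k<N. 1 / real (Suc k) ^ 2) \<le> 2 - 2 / real (Suc N)"
    proof (induction N)
      case (Suc N)
      have "real (Suc N) * real (Suc (Suc N)) \<le> 2 * real (Suc N) ^ 2"
        by (simp add: power2_eq_square algebra_simps)
      then have "1 / real (Suc N) ^ 2 \<le> 2 / (real (Suc N) * real (Suc (Suc N)))"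
        by (simp add: divide_simps del: of_nat_Suc)
      also have "\<dots> = 2 / real (Suc N) - 2 / real (Suc (Suc N))"
        by (simp add: field_simps)
      finally show ?case using Suc by (simp del: of_nat_Suc)
    qed simp
    also have "\<dots> \<le> 2" by simp
    finally show "(\<Sum>k<N. ennreal (1 / real (Suc k) ^ 2)) \<le> 2"
      by (subst sum_ennreal) (auto intro: ennreal_leI[of _ 2, simplified])
  qed auto
  finally show ?thesis .
qed

text \<open>Moving the weight from \<open>k\<close> to \<open>k + i\<close> costs a factor
  \<open>Suc i\<close>, absorbed by the geometric factor: \<open>(5/4) * (2/3) = 5/6\<close>. After
  exchanging the sums each shifted sum is at most the whole one, and the powers of
  \<open>5/6\<close> sum to 6. One \<open>4 ^ n\<close> comes from \<open>tail_power_le\<close>, the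
  other from \<open>Suc_le_geometric\<close>.\<close>

lemma weighted_sum_tail:
  assumes n: "0 < n"
  shows "weighted_sum n (\<lambda>k. \<Sum>i. ennreal ((1/2) ^ i) * x (k + i)) \<le> ennreal (6 * 16 ^ n) * weighted_sum n x"
proof -
  let ?w = "\<lambda>k. ennreal (1 / real (Suc k))"
  have termwise: "(?w k * (ennreal ((2/3) ^ i) * x (k + i))) ^ n
      \<le> ennreal (4 ^ n * (5/6) ^ i) * (?w (k + i) * x (k + i)) ^ n" for k i
  proof -
    have "?w k * ennreal ((2/3) ^ i) \<le> ennreal (4 * (5/6) ^ i) * ?w (k + i)"
    proof -
      have "1 / real (Suc k) \<le> real (Suc i) * (1 / real (Suc (k + i)))"
        by (simp add: field_simps)
      then have "1 / real (Suc k) * (2/3) ^ i \<le> (real (Suc i) * (1 / real (Suc (k + i)))) * (2/3) ^ i"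
        by (rule mult_right_mono) simp
      also have "\<dots> \<le> ((4 * (5/4) ^ i) * (1 / real (Suc (k + i)))) * (2/3) ^ i"
        by (intro mult_right_mono Suc_le_geometric) auto
      also have "\<dots> = 4 * (5/6) ^ i * (1 / real (Suc (k + i)))"
        by (simp add: power_mult_distrib[symmetric] mult_ac power_divide[symmetric] del: of_nat_Suc)
      finally show ?thesis
        by (subst (1 2) ennreal_mult'[symmetric]) (auto intro: ennreal_leI)
    qed
    then have "?w k * ennreal ((2/3) ^ i) * x (k + i) \<le> ennreal (4 * (5/6) ^ i) * ?w (k + i) * x (k + i)"
      by (rule mult_right_mono) simp
    then have "(?w k * (ennreal ((2/3) ^ i) * x (k + i))) ^ n \<le> (ennreal (4 * (5/6) ^ i) * (?w (k + i) * x (k + i))) ^ n"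
      by (intro power_mono) (simp_all only: mult.assoc zero_le)
    also have "\<dots> = ennreal ((4 * (5/6) ^ i) ^ n) * (?w (k + i) * x (k + i)) ^ n"
      by (simp add: power_mult_distrib ennreal_power)
    also have "\<dots> \<le> ennreal (4 ^ n * (5/6) ^ i) * (?w (k + i) * x (k + i)) ^ n"
    proof (intro mult_right_mono ennreal_leI)
      have "((5/6::real) ^ i) ^ n \<le> ((5/6) ^ i) ^ 1"
        using n by (intro power_decreasing) (auto simp: power_le_one)
      then show "(4 * (5/6::real) ^ i) ^ n \<le> 4 ^ n * (5/6) ^ i" by (simp add: power_mult_distrib)
    qed simp
    finally show ?thesis .
  qed
  have "weighted_sum n (\<lambda>k. \<Sum>i. ennreal ((1/2) ^ i) * x (k + i))
     \<le> (\<Sum>k. ennreal (4 ^ n) * (\<Sum>i. (?w k * (ennreal ((2/3) ^ i) * x (k + i))) ^ n))"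
    unfolding weighted_sum_def
  proof (intro suminf_le summableI)
    fix k
    have "?w k * (\<Sum>i. ennreal ((1/2) ^ i) * x (k + i)) = (\<Sum>i. ennreal ((1/2) ^ i) * (?w k * x (k + i)))"
      unfolding ennreal_suminf_cmult[symmetric] by (simp only: mult_ac)
    then have "(?w k * (\<Sum>i. ennreal ((1/2) ^ i) * x (k + i))) ^ n
       \<le> ennreal (4 ^ n) * (\<Sum>i. (ennreal ((2/3) ^ i) * (?w k * x (k + i))) ^ n)"
      using tail_power_le[OF n, of "\<lambda>i. ?w k * x (k + i)"] by simp
    then show "(?w k * (\<Sum>i. ennreal ((1/2) ^ i) * x (k + i))) ^ n
       \<le> ennreal (4 ^ n) * (\<Sum>i. (?w k * (ennreal ((2/3) ^ i) * x (k + i))) ^ n)"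
      by (simp only: mult.left_commute)
  qed
  also have "\<dots> = ennreal (4 ^ n) * (\<Sum>k. \<Sum>i. (?w k * (ennreal ((2/3) ^ i) * x (k + i))) ^ n)"
    by (rule ennreal_suminf_cmult)
  also have "\<dots> \<le> ennreal (4 ^ n) * (\<Sum>k. \<Sum>i. ennreal (4 ^ n * (5/6) ^ i) * (?w (k + i) * x (k + i)) ^ n)"
    by (intro mult_left_mono suminf_le termwise) auto
  also have "(\<Sum>k. \<Sum>i. ennreal (4 ^ n * (5/6) ^ i) * (?w (k + i) * x (k + i)) ^ n)
     = (\<Sum>i. \<Sum>k. ennreal (4 ^ n * (5/6) ^ i) * (?w (k + i) * x (k + i)) ^ n)"
    unfolding nn_integral_count_space_nat[symmetric]
    by (rule pair_sigma_finite.Fubini') (auto intro!: pair_sigma_finite.intro sigma_finite_measure_count_space)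
  also have "\<dots> \<le> (\<Sum>i. ennreal (4 ^ n * (5/6) ^ i) * weighted_sum n x)"
  proof (intro suminf_le summableI)
    fix i
    have "(\<Sum>k. (?w (k + i) * x (k + i)) ^ n) \<le> weighted_sum n x"
      unfolding weighted_sum_def
      by (subst (2) suminf_offset[OF summableI, of _ i]) (rule add_increasing2, simp_all)
    then show "(\<Sum>k. ennreal (4 ^ n * (5/6) ^ i) * (?w (k + i) * x (k + i)) ^ n) \<le> ennreal (4 ^ n * (5/6) ^ i) * weighted_sum n x"
      unfolding ennreal_suminf_cmult by (rule mult_left_mono) simp
  qed
  also have "\<dots> = (\<Sum>i. ennreal (4 ^ n * (5/6) ^ i)) * weighted_sum n x"
    by (rule ennreal_suminf_multc)
  also have "(\<Sum>i. ennreal (4 ^ n * (5/6) ^ i)) = ennreal (4 ^ n * 6)"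
    using geometric_sums[of "5/6::real"] sums_mult[of _ 6 "4 ^ n"]
    by (intro suminf_ennreal_eq) auto
  also have "ennreal (4 ^ n) * (ennreal (4 ^ n * 6) * weighted_sum n x) = ennreal (6 * 16 ^ n) * weighted_sum n x"
  proof -
    have "(4::real) ^ n * (4 ^ n * 6) = 6 * 16 ^ n"
      using power_mult_distrib[of "4::real" 4 n] by simp
    then have "ennreal (4 ^ n) * ennreal (4 ^ n * 6) = ennreal (6 * 16 ^ n)"
      by (subst ennreal_mult[symmetric]) auto
    then show ?thesis by (simp only: mult.assoc[symmetric])
  qed
  finally show ?thesis by (simp add: mult_left_mono)
qed

lemma weighted_sum_partial_sums:
  assumes n: "2 \<le> n" and c: "\<And>j. 0 \<le> c j" and sum: "(\<Sum>j. ennreal (c j ^ n)) \<le> 1"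
  shows "weighted_sum n (\<lambda>k. \<Sum>j<Suc k. ennreal (c j)) \<le> ennreal (4 ^ n)"
proof -
  have "(ennreal (1 / real (Suc k)) * (\<Sum>j<Suc k. ennreal (c j))) ^ n = ennreal (((\<Sum>j<Suc k. c j) / real (Suc k)) ^ n)" for k
  proof -
    have "0 \<le> (\<Sum>j<Suc k. c j)" using c by (intro sum_nonneg) auto
    moreover have "(\<Sum>j<Suc k. ennreal (c j)) = ennreal (\<Sum>j<Suc k. c j)" using c by (intro sum_ennreal) auto
    ultimately show ?thesis
      by (simp add: ennreal_mult[symmetric] ennreal_power del: sum.lessThan_Suc of_nat_Suc)
  qed
  then have "weighted_sum n (\<lambda>k. \<Sum>j<Suc k. ennreal (c j)) \<le> ennreal (4 ^ n) * (\<Sum>k. ennreal (c k ^ n))"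
    unfolding weighted_sum_def using hardy_inequality[of c n, OF c n] by simp
  also have "\<dots> \<le> ennreal (4 ^ n) * 1" by (intro mult_left_mono sum) simp
  finally show ?thesis by simp
qed

lemma weighted_sum_le_sum:
  assumes c: "\<And>j. 0 \<le> c j" and sum: "(\<Sum>j. ennreal (c j ^ n)) \<le> 1"
  shows "weighted_sum n (\<lambda>k. ennreal (c k)) \<le> 1"
proof -
  have "weighted_sum n (\<lambda>k. ennreal (c k)) \<le> (\<Sum>j. ennreal (c j ^ n))"
    unfolding weighted_sum_def
  proof (intro suminf_le summableI)
    fix k
    have "1 / real (Suc k) * c k \<le> c k" using c[of k] by (intro mult_left_le_one_le) auto
    then have "(1 / real (Suc k) * c k) ^ n \<le> c k ^ n" using c[of k] by (intro power_mono) auto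
    then show "(ennreal (1 / real (Suc k)) * ennreal (c k)) ^ n \<le> ennreal (c k ^ n)"
      using c[of k] by (subst ennreal_mult[symmetric]) (auto simp: ennreal_power ennreal_leI simp del: of_nat_Suc)
  qed
  with sum show ?thesis by (rule order_trans[rotated])
qed

section \<open>Lorentz-Zygmund norms in dyadic form\<close>

lemma decreasing_rearrangement_antimono:
  "s \<le> s' \<Longrightarrow> decreasing_rearrangement M f s' \<le> decreasing_rearrangement M f s"
  unfolding decreasing_rearrangement_def
  by (rule Inf_superset_mono) (blast intro: order_trans ennreal_leI)

lemma lorentz_zygmund_norm_power:
  fixes f :: "'a \<Rightarrow> 'b::real_normed_vector" and \<mu> :: "'a measure"
  assumes n: "0 < n"
  defines "M \<equiv> measure \<mu> (space \<mu>)"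
  shows "lorentz_zygmund_norm (real n) \<mu> f ^ n
    = (\<integral>\<^sup>+s. ennreal (1 / (s * ln (1 + M / s) ^ n)) * decreasing_rearrangement \<mu> f s ^ n * indicator {0<..<M} s \<partial>lborel)"
proof -
  let ?D = "decreasing_rearrangement \<mu> f"
  have "lorentz_zygmund_norm (real n) \<mu> f ^ n
    = (\<integral>\<^sup>+s. (ennreal (s powr (- 1 / real n) / ln (1 + M / s)) * ?D s) ^ n \<partial>lebesgue_on {0<..<M})"
    unfolding lorentz_zygmund_norm_def Lp_enorm_def M_def[symmetric] epowr_inverse_power[OF n] epowr_of_nat[OF n] ..
  also have "\<dots> = (\<integral>\<^sup>+s. (ennreal (s powr (- 1 / real n) / ln (1 + M / s)) * ?D s) ^ n * indicator {0<..<M} s \<partial>lebesgue)"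
    by (rule nn_integral_restrict_space) simp
  also have "\<dots> = (\<integral>\<^sup>+s. ennreal (1 / (s * ln (1 + M / s) ^ n)) * ?D s ^ n * indicator {0<..<M} s \<partial>lebesgue)"
  proof (rule nn_integral_cong)
    fix s
    show "(ennreal (s powr (- 1 / real n) / ln (1 + M / s)) * ?D s) ^ n * indicator {0<..<M} s
       = ennreal (1 / (s * ln (1 + M / s) ^ n)) * ?D s ^ n * indicator {0<..<M} s"
    proof (cases "s \<in> {0<..<M}")
      case True
      then have "0 < s" "0 < M / s" by auto
      then have ln: "0 \<le> ln (1 + M / s)" by simp
      have "(s powr (- 1 / real n)) ^ n = s powr (- 1 / real n * real n)"
        using \<open>0 < s\<close> by (simp add: powr_realpow[symmetric] powr_powr)
      also have "\<dots> = 1 / s"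
        using n \<open>0 < s\<close> by (simp add: powr_minus_divide)
      finally have "(s powr (- 1 / real n) / ln (1 + M / s)) ^ n = 1 / (s * ln (1 + M / s) ^ n)"
        by (simp add: power_divide)
      then show ?thesis
        using ln by (simp add: power_mult_distrib ennreal_power)
    qed simp
  qed
  also have "\<dots> = (\<integral>\<^sup>+s. ennreal (1 / (s * ln (1 + M / s) ^ n)) * ?D s ^ n * indicator {0<..<M} s \<partial>lborel)"
    by (rule nn_integral_completion)
  finally show ?thesis .
qed

lemma exists_dyadic:
  fixes s M :: real
  assumes "0 < s" "s < M"
  obtains k where "M * (1/2) ^ Suc k < s" "s \<le> M * (1/2) ^ k"
proof -
  define P where "P k \<longleftrightarrow> M * (1/2) ^ k < s" for k
  have "\<exists>k. P k"
  proof -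
    obtain k where "(1/2::real) ^ k < s / M" using real_arch_pow_inv[of "s / M" "1/2"] assms by auto
    then show ?thesis using assms by (auto simp: P_def field_simps)
  qed
  then have ex: "P (LEAST k. P k)" and least: "\<And>j. j < (LEAST j. P j) \<Longrightarrow> \<not> P j"
    using LeastI_ex[of P] not_less_Least[of _ P] by blast+
  have "\<not> P 0" using assms by (simp add: P_def)
  then have "(LEAST j. P j) \<noteq> 0" using ex by metis
  then obtain k where k: "(LEAST j. P j) = Suc k" by (meson not0_implies_Suc)
  have "P (Suc k)" "\<not> P k" using ex least[of k] by (simp_all add: k)
  then show thesis by (intro that) (auto simp: P_def)
qed

lemma nn_integral_dyadic:
  fixes M :: real and c :: "nat \<Rightarrow> ennreal"
  assumes M: "0 < M"
  shows "(\<integral>\<^sup>+s. (\<Sum>k. c k * indicator {M * (1/2) ^ Suc k<..<M * (1/2) ^ k} s) \<partial>lborel)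
    = (\<Sum>k. c k * ennreal (M * (1/2) ^ Suc k))"
proof -
  have "(\<integral>\<^sup>+s. c k * indicator {M * (1/2) ^ Suc k<..<M * (1/2) ^ k} s \<partial>lborel) = c k * ennreal (M * (1/2) ^ Suc k)" for k
    using M by (subst nn_integral_cmult_indicator) simp_all
  then show ?thesis by (subst nn_integral_suminf) simp_all
qed

text \<open>Between \<open>M * (1/2) ^ Suc k\<close> and \<open>M * (1/2) ^ k\<close> the logarithm
  is at least \<open>Suc k / 4\<close>, and the rearrangement is at most its value at the left end;
  hence the index \<open>Suc k\<close>.\<close>

lemma lorentz_zygmund_norm_upper:
  fixes f :: "'a \<Rightarrow> 'b::real_normed_vector" and \<mu> :: "'a measure"
  assumes n: "0 < n"
  defines "M \<equiv> measure \<mu> (space \<mu>)"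
  assumes M: "0 < M"
  shows "lorentz_zygmund_norm (real n) \<mu> f ^ n
    \<le> ennreal (4 ^ n) * weighted_sum n (\<lambda>k. decreasing_rearrangement \<mu> f (M * (1/2) ^ Suc k))"
proof -
  let ?D = "decreasing_rearrangement \<mu> f"
  define c where "c k = ennreal ((4 / real (Suc k)) ^ n / (M * (1/2) ^ Suc k)) * ?D (M * (1/2) ^ Suc k) ^ n" for k
  have "lorentz_zygmund_norm (real n) \<mu> f ^ n
     = (\<integral>\<^sup>+s. ennreal (1 / (s * ln (1 + M / s) ^ n)) * ?D s ^ n * indicator {0<..<M} s \<partial>lborel)"
    unfolding M_def by (rule lorentz_zygmund_norm_power[OF n])
  also have "\<dots> \<le> (\<integral>\<^sup>+s. (\<Sum>k. c k * indicator {M * (1/2) ^ Suc k<..<M * (1/2) ^ k} s) \<partial>lborel)"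
  proof (rule nn_integral_mono_AE)
    \<comment> \<open>The dyadic intervals are open; their end points form a null set.\<close>
    have "AE s in lborel. \<forall>k. s \<noteq> M * (1/2) ^ k"
      unfolding AE_all_countable by (intro allI AE_lborel_singleton)
    then show "AE s in lborel. ennreal (1 / (s * ln (1 + M / s) ^ n)) * ?D s ^ n * indicator {0<..<M} s
        \<le> (\<Sum>k. c k * indicator {M * (1/2) ^ Suc k<..<M * (1/2) ^ k} s)"
    proof eventually_elim
      case (elim s)
      show ?case
      proof (cases "s \<in> {0<..<M}")
        case True
        then obtain k where k: "M * (1/2) ^ Suc k < s" "s \<le> M * (1/2) ^ k"
          using exists_dyadic[of s M] by auto
        then have k': "s < M * (1/2) ^ k" using elim by (simp add: less_le)
        have s: "0 < s" using True by simp
        have ln: "real (Suc k) / 4 \<le> ln (1 + M / s)"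
        proof -
          have "2 ^ k \<le> M / s" using k(2) s by (simp add: field_simps power_divide)
          \<comment> \<open>Squaring makes the estimate work down to \<open>k = 0\<close>: it yields
            \<open>Suc k * ln 2 \<le> 2 * ln (1 + 2 ^ k)\<close>.\<close>
          have "(2::real) ^ Suc k \<le> (1 + 2 ^ k) ^ 2"
            by (simp add: power2_eq_square algebra_simps add_increasing)
          then have "ln (2 ^ Suc k) \<le> ln ((1 + 2 ^ k) ^ 2 :: real)"
            by (rule ln_mono) simp
          moreover have "ln ((1 + 2 ^ k) ^ 2 :: real) = 2 * ln (1 + 2 ^ k)"
            using ln_realpow[of "1 + 2 ^ k" 2] by simp
          moreover have "ln ((2::real) ^ Suc k) = real (Suc k) * ln 2"
            by (rule ln_realpow)
          ultimately have "real (Suc k) * ln 2 \<le> 2 * ln (1 + 2 ^ k)" by linarith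
          moreover have "real (Suc k) * (1 / 2) \<le> real (Suc k) * ln 2"
            using ln2_ge_two_thirds by (intro mult_left_mono) auto
          moreover have "ln (1 + 2 ^ k) \<le> ln (1 + M / s)"
            using \<open>2 ^ k \<le> M / s\<close> by (intro ln_mono) (simp_all add: add_pos_pos)
          ultimately show ?thesis by linarith
        qed
        have "1 / (s * ln (1 + M / s) ^ n) \<le> (4 / real (Suc k)) ^ n / (M * (1/2) ^ Suc k)"
        proof -
          have "M * (1/2) ^ Suc k * (real (Suc k) / 4) ^ n \<le> s * ln (1 + M / s) ^ n"
            using k ln M s by (intro mult_mono power_mono) auto
          moreover have "0 < M * (1/2) ^ Suc k * (real (Suc k) / 4) ^ n" using M by simp
          ultimately have "1 / (s * ln (1 + M / s) ^ n) \<le> 1 / (M * (1/2) ^ Suc k * (real (Suc k) / 4) ^ n)"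
            by (intro divide_left_mono) (auto intro: mult_pos_pos less_le_trans simp del: power_Suc of_nat_Suc)
          also have "\<dots> = (4 / real (Suc k)) ^ n / (M * (1/2) ^ Suc k)"
            by (simp add: power_divide mult_ac del: of_nat_Suc)
          finally show ?thesis .
        qed
        then have "ennreal (1 / (s * ln (1 + M / s) ^ n)) * ?D s ^ n * indicator {0<..<M} s \<le> c k"
          unfolding c_def using True k(1)
          by (simp del: power_Suc of_nat_Suc) (intro mult_mono ennreal_leI power_mono decreasing_rearrangement_antimono; simp)
        also have "\<dots> = c k * indicator {M * (1/2) ^ Suc k<..<M * (1/2) ^ k} s"
          using k(1) k' by (simp del: power_Suc)
        also have "\<dots> \<le> (\<Sum>k. c k * indicator {M * (1/2) ^ Suc k<..<M * (1/2) ^ k} s)"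
          using sum_le_suminf[OF summableI, of "{k}" "\<lambda>k. c k * indicator {M * (1/2) ^ Suc k<..<M * (1/2) ^ k} s"]
          by (simp del: sum_mult_indicator power_Suc)
        finally show ?thesis .
      qed simp
    qed
  qed
  also have "\<dots> = (\<Sum>k. c k * ennreal (M * (1/2) ^ Suc k))"
    by (rule nn_integral_dyadic[OF M])
  also have "\<dots> = (\<Sum>k. ennreal (4 ^ n) * (ennreal (1 / real (Suc k)) * ?D (M * (1/2) ^ Suc k)) ^ n)"
  proof (rule suminf_cong)
    fix k
    have "c k * ennreal (M * (1/2) ^ Suc k) = ennreal ((4 / real (Suc k)) ^ n / (M * (1/2) ^ Suc k)) * ennreal (M * (1/2) ^ Suc k) * ?D (M * (1/2) ^ Suc k) ^ n"
      unfolding c_def by (simp only: mult_ac)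
    also have "ennreal ((4 / real (Suc k)) ^ n / (M * (1/2) ^ Suc k)) * ennreal (M * (1/2) ^ Suc k) = ennreal ((4 / real (Suc k)) ^ n)"
      using M by (subst ennreal_mult[symmetric]) auto
    also have "(4 / real (Suc k)) ^ n = 4 ^ n * (1 / real (Suc k)) ^ n"
      by (simp add: power_divide)
    also have "ennreal \<dots> = ennreal (4 ^ n) * ennreal (1 / real (Suc k)) ^ n"
      by (simp add: ennreal_mult' ennreal_power del: of_nat_Suc)
    finally show "c k * ennreal (M * (1/2) ^ Suc k) = ennreal (4 ^ n) * (ennreal (1 / real (Suc k)) * ?D (M * (1/2) ^ Suc k)) ^ n"
      by (simp only: power_mult_distrib mult.assoc)
  qed
  also have "\<dots> = ennreal (4 ^ n) * weighted_sum n (\<lambda>k. ?D (M * (1/2) ^ Suc k))"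
    unfolding weighted_sum_def by (rule ennreal_suminf_cmult)
  finally show ?thesis .
qed

text \<open>Here the value at the right end is a lower bound and the logarithm is at most
  \<open>2 * Suc k\<close>. The upper and the lower estimate thus differ by one index, for which
  \<open>tail_Suc_le\<close> compensates.\<close>

lemma lorentz_zygmund_norm_lower:
  fixes f :: "'a \<Rightarrow> 'b::real_normed_vector" and \<mu> :: "'a measure"
  assumes n: "0 < n"
  defines "M \<equiv> measure \<mu> (space \<mu>)"
  assumes M: "0 < M"
  shows "weighted_sum n (\<lambda>k. decreasing_rearrangement \<mu> f (M * (1/2) ^ k))
    \<le> ennreal (4 ^ n) * lorentz_zygmund_norm (real n) \<mu> f ^ n"
proof -
  let ?D = "decreasing_rearrangement \<mu> f"
  define c where "c k = ennreal ((1 / (4 * real (Suc k))) ^ n / (M * (1/2) ^ Suc k)) * ?D (M * (1/2) ^ k) ^ n" for k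
  have ck: "c k * ennreal (M * (1/2) ^ Suc k) = ennreal ((1/4) ^ n) * (ennreal (1 / real (Suc k)) * ?D (M * (1/2) ^ k)) ^ n" for k
  proof -
    have "c k * ennreal (M * (1/2) ^ Suc k) = ennreal ((1 / (4 * real (Suc k))) ^ n / (M * (1/2) ^ Suc k)) * ennreal (M * (1/2) ^ Suc k) * ?D (M * (1/2) ^ k) ^ n"
      unfolding c_def by (simp only: mult_ac)
    also have "ennreal ((1 / (4 * real (Suc k))) ^ n / (M * (1/2) ^ Suc k)) * ennreal (M * (1/2) ^ Suc k) = ennreal ((1 / (4 * real (Suc k))) ^ n)"
      using M by (subst ennreal_mult[symmetric]) auto
    also have "(1 / (4 * real (Suc k))) ^ n = (1/4) ^ n * (1 / real (Suc k)) ^ n"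
      by (simp add: power_mult_distrib[symmetric])
    also have "ennreal \<dots> = ennreal ((1/4) ^ n) * ennreal (1 / real (Suc k)) ^ n"
      by (simp add: ennreal_mult' ennreal_power del: of_nat_Suc)
    finally show ?thesis by (simp only: power_mult_distrib mult.assoc)
  qed
  have "ennreal ((1/4) ^ n) * weighted_sum n (\<lambda>k. ?D (M * (1/2) ^ k)) = (\<Sum>k. c k * ennreal (M * (1/2) ^ Suc k))"
    unfolding weighted_sum_def ck ennreal_suminf_cmult ..
  also have "\<dots> = (\<integral>\<^sup>+s. (\<Sum>k. c k * indicator {M * (1/2) ^ Suc k<..<M * (1/2) ^ k} s) \<partial>lborel)"
    by (rule nn_integral_dyadic[OF M, symmetric])
  also have "\<dots> \<le> (\<integral>\<^sup>+s. ennreal (1 / (s * ln (1 + M / s) ^ n)) * ?D s ^ n * indicator {0<..<M} s \<partial>lborel)"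
  proof (rule nn_integral_mono)
    fix s
    let ?I = "\<lambda>k. {M * (1/2) ^ Suc k<..<M * (1/2) ^ k}"
    show "(\<Sum>k. c k * indicator (?I k) s) \<le> ennreal (1 / (s * ln (1 + M / s) ^ n)) * ?D s ^ n * indicator {0<..<M} s"
    proof (cases "\<exists>k. s \<in> ?I k")
      case False
      then have "(\<lambda>k. c k * indicator (?I k) s) = (\<lambda>_. 0)" by (intro ext) simp
      then have "(\<Sum>k. c k * indicator (?I k) s) = 0" by (simp only: suminf_zero)
      then show ?thesis by (simp only: zero_le)
    next
      case True
      then obtain k where k: "M * (1/2) ^ Suc k < s" "s < M * (1/2) ^ k" by auto
      have other: "s \<notin> ?I j" if "j \<noteq> k" for j
      proof (cases "j < k")
        case True
        then have "M * (1/2) ^ k \<le> M * (1/2) ^ Suc j"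
          using M by (intro mult_left_mono power_decreasing) auto
        then show ?thesis using k by auto
      next
        case False
        then have "M * (1/2) ^ j \<le> M * (1/2) ^ Suc k"
          using M that by (intro mult_left_mono power_decreasing) auto
        then show ?thesis using k by auto
      qed
      have "(\<Sum>k. c k * indicator (?I k) s) = (\<Sum>j\<in>{k}. c j * indicator (?I j) s)"
        using other by (intro suminf_finite) auto
      also have "\<dots> = c k" using k by simp
      also have "\<dots> \<le> ennreal (1 / (s * ln (1 + M / s) ^ n)) * ?D s ^ n * indicator {0<..<M} s"
      proof -
        have s0: "0 < s" using k(1) M by (meson less_trans mult_pos_pos zero_less_power half_gt_zero_iff zero_less_one)
        have "M * (1/2) ^ k \<le> M * 1" using M by (intro mult_left_mono power_le_one) auto
        then have sM: "s < M" using k(2) by simp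
        have Ms: "1 \<le> M / s" using s0 sM by simp
        have ln0: "0 < ln (1 + M / s)" using Ms by (intro ln_gt_zero) auto
        have ln: "ln (1 + M / s) \<le> 2 * real (Suc k)"
        proof -
          have "M / s \<le> 2 ^ Suc k" using k(1) s0 by (simp add: field_simps power_divide)
          then have "1 + M / s \<le> 2 ^ Suc (Suc k)" using one_le_power[of "2::real" "Suc k"] by simp
          then have "ln (1 + M / s) \<le> ln (2 ^ Suc (Suc k))"
            using Ms by (subst ln_le_cancel_iff) auto
          also have "\<dots> = real (Suc (Suc k)) * ln 2" by (rule ln_realpow)
          also have "\<dots> \<le> real (Suc (Suc k)) * 1" using ln_2_less_1 by (intro mult_left_mono) auto
          finally show ?thesis by simp
        qed
        have "(1 / (4 * real (Suc k))) ^ n / (M * (1/2) ^ Suc k) \<le> 1 / (s * ln (1 + M / s) ^ n)"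
        proof -
          have "s * ln (1 + M / s) ^ n \<le> (2 * (M * (1/2) ^ Suc k)) * (2 * real (Suc k)) ^ n"
            using k(2) ln ln0 M s0 by (intro mult_mono power_mono) auto
          also have "\<dots> \<le> (2 ^ n * (M * (1/2) ^ Suc k)) * (2 * real (Suc k)) ^ n"
            using M n power_increasing[of 1 n "2::real"] by (intro mult_right_mono) auto
          also have "\<dots> = 4 ^ n * (M * (1/2) ^ Suc k * real (Suc k) ^ n)"
            using power_mult_distrib[of "2::real" 2 n]
            by (simp add: power_mult_distrib[of 2 "real (Suc k)"] del: of_nat_Suc)
          finally have le: "s * ln (1 + M / s) ^ n \<le> 4 ^ n * (M * (1/2) ^ Suc k * real (Suc k) ^ n)" .
          have pos: "0 < s * ln (1 + M / s) ^ n" "0 < M * (1/2) ^ Suc k * real (Suc k) ^ n"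
            using s0 ln0 M by simp_all
          have "1 / (4 ^ n * (M * (1/2) ^ Suc k * real (Suc k) ^ n)) \<le> 1 / (s * ln (1 + M / s) ^ n)"
            using le pos by (intro divide_left_mono) auto
          then show ?thesis by (simp add: power_divide power_mult_distrib mult_ac del: of_nat_Suc)
        qed
        then have "c k \<le> ennreal (1 / (s * ln (1 + M / s) ^ n)) * ?D s ^ n"
          unfolding c_def using k(2)
          by (intro mult_mono ennreal_leI power_mono decreasing_rearrangement_antimono) auto
        then show ?thesis using s0 sM by simp
      qed
      finally show ?thesis .
    qed
  qed
  also have "\<dots> = lorentz_zygmund_norm (real n) \<mu> f ^ n"
    unfolding M_def by (rule lorentz_zygmund_norm_power[OF n, symmetric])
  finally have "ennreal (4 ^ n) * (ennreal ((1/4) ^ n) * weighted_sum n (\<lambda>k. ?D (M * (1/2) ^ k)))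
      \<le> ennreal (4 ^ n) * lorentz_zygmund_norm (real n) \<mu> f ^ n"
    by (rule mult_left_mono) simp
  moreover have "ennreal (4 ^ n) * ennreal ((1/4) ^ n) = 1"
    by (simp add: ennreal_mult[symmetric] power_mult_distrib[symmetric])
  ultimately show ?thesis by (simp only: mult.assoc[symmetric] mult_1_left)
qed

section \<open>The rearrangement estimate\<close>

text \<open>The bound is used only qualitatively, for finiteness and for passing to a limit; it
  enters none of the constants.\<close>

lemma C_b_bounded:
  fixes u :: "real^'n \<Rightarrow> real^'n"
  assumes u: "u \<in> C_b (closure \<Omega>)"
  obtains U where "0 \<le> U" "\<And>y. y \<in> closure \<Omega> \<Longrightarrow> norm (u y) \<le> U"
proof -
  let ?S = "{y \<in> closure \<Omega>. u y \<noteq> 0}"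
  have "compact (closure ?S)" using u by (simp add: C_b_def compact_closure)
  moreover have "closure ?S \<subseteq> closure \<Omega>" by (intro closure_minimal) auto
  ultimately have "bounded (u ` closure ?S)"
    using u by (intro compact_imp_bounded compact_continuous_image) (auto simp: C_b_def intro: continuous_on_subset)
  then obtain U where U: "\<And>y. y \<in> closure ?S \<Longrightarrow> norm (u y) \<le> U"
    unfolding bounded_iff by blast
  show thesis
  proof (rule that[of "max U 0"])
    fix y assume y: "y \<in> closure \<Omega>"
    show "norm (u y) \<le> max U 0"
    proof (cases "u y = 0")
      case False
      with y have "y \<in> closure ?S" by (intro subsetD[OF closure_subset]) simp
      then have "norm (u y) \<le> U" by (rule U)
      then show ?thesis by simp
    qed simp
  qed simp
qed

text \<open>\<open>N j\<close> contains all directions in which a boundary point with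
  \<open>norm (u y) > a j\<close> is visible. The boundary value met in direction \<open>v\<close>
  is at most \<open>a k\<close>, or at most \<open>a (Suc j)\<close> with \<open>v\<close> in
  \<open>N j\<close> for some \<open>j\<close> between \<open>k\<close> and \<open>J - 1\<close>, or
  it is only known to be at most \<open>U\<close>, and then \<open>v\<close> lies in
  \<open>N J\<close>. Integrating in \<open>v\<close> gives the three boundary terms.\<close>

lemma pointwise_estimate:
  fixes u :: "real^'n \<Rightarrow> real^'n" and M :: "nat \<Rightarrow> real^'n \<Rightarrow> ennreal"
  defines "m \<equiv> CARD('n) - 1" and "\<omega> \<equiv> unit_ball_vol (real CARD('n))"
  assumes dim: "2 \<le> CARD('n)" and \<Omega>: "open \<Omega>" and u: "u \<in> C_b (closure \<Omega>)" and E: "has_sym_grad \<Omega> u E"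
    and F[measurable]: "F \<in> borel_measurable borel"
    and EF: "AE z in lebesgue. z \<in> \<Omega> \<longrightarrow> norm (E z) \<le> F z"
    and x: "x \<in> \<Omega>" and kJ: "k \<le> J" and a: "\<And>j. 0 \<le> a j"
    and U: "\<And>y. y \<in> frontier \<Omega> \<Longrightarrow> norm (u y) \<le> U"
    and M: "\<And>j. \<exists>N\<in>sets borel. {v \<in> ball 0 1. \<exists>s>0. x + s *\<^sub>R v \<in> {y \<in> frontier \<Omega>. a j < norm (u y)}} \<subseteq> N
       \<and> emeasure lborel N \<le> M j x"
  shows "ennreal (\<omega> / 4 ^ Suc CARD('n) * norm (u x))
    \<le> ennreal ((3 / 2) ^ m) * (\<integral>\<^sup>+z. ennreal (F z) * ennreal (1 / dist z x ^ m) \<partial>lborel)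
      + (ennreal (\<omega> * a k) + (\<Sum>j\<in>{k..<J}. ennreal (a (Suc j)) * M j x) + ennreal U * M J x)"
proof -
  have "\<forall>j. \<exists>N. N \<in> sets borel \<and> {v \<in> ball 0 1. \<exists>s>0. x + s *\<^sub>R v \<in> {y \<in> frontier \<Omega>. a j < norm (u y)}} \<subseteq> N
       \<and> emeasure lborel N \<le> M j x" using M by blast
  from choice[OF this] obtain N where N[measurable]: "\<And>j. N j \<in> sets borel"
    and Nsub: "\<And>j. {v \<in> ball 0 1. \<exists>s>0. x + s *\<^sub>R v \<in> {y \<in> frontier \<Omega>. a j < norm (u y)}} \<subseteq> N j"
    and Nle: "\<And>j. emeasure lborel (N j) \<le> M j x" by blast
  have [measurable]: "ball (0::real^'n) 1 \<in> sets borel" by simp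
  define I where "I = (\<lambda>j v. indicator (N j) v :: ennreal)"
  have [measurable]: "I j \<in> borel_measurable borel" for j unfolding I_def by measurable
  define R where "R v = ray_integral F x v * indicator (ball 0 1) v" for v
  have [measurable]: "R \<in> borel_measurable borel" unfolding R_def by measurable
  have lev: "ennreal (norm (u y)) \<le> ennreal (a k) + (\<Sum>j\<in>{k..<J}. ennreal (a (Suc j)) * I j v) + ennreal U * I J v"
    if v: "v \<in> ball 0 1" and s: "0 < s" and y: "y = x + s *\<^sub>R v" "y \<in> frontier \<Omega>" for y v s
  proof -
    have I1: "I j v = 1" if "a j < norm (u y)" for j
      using Nsub[of j] v s y that by (auto simp: I_def)
    \<comment> \<open>The first \<open>i\<close> from \<open>k\<close> on with
      \<open>norm (u y) \<le> a i\<close> satisfies \<open>i = k\<close> or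
      \<open>a (i - 1) < norm (u y)\<close>, in whatever order the numbers \<open>a j\<close>
      come.\<close>
    consider "norm (u y) \<le> a k" | "\<And>j. k \<le> j \<Longrightarrow> j \<le> J \<Longrightarrow> a j < norm (u y)"
      | i where "k < i" "i \<le> J" "norm (u y) \<le> a i" "\<And>j. k \<le> j \<Longrightarrow> j < i \<Longrightarrow> a j < norm (u y)"
    proof (cases "\<exists>i. k \<le> i \<and> i \<le> J \<and> norm (u y) \<le> a i")
      case True
      define i where "i = (LEAST i. k \<le> i \<and> i \<le> J \<and> norm (u y) \<le> a i)"
      have i: "k \<le> i" "i \<le> J" "norm (u y) \<le> a i"
        using LeastI_ex[OF True] by (auto simp: i_def)
      have "a j < norm (u y)" if "k \<le> j" "j < i" for j
        using not_less_Least[of j, OF that(2)[unfolded i_def]] that i(2) by auto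
      then show thesis using i that(1) that(3)[of i] by (cases "i = k") auto
    next
      case False
      then show thesis by (intro that(2)) (meson not_le)
    qed
    then show ?thesis
    proof cases
      case 1
      then show ?thesis by (simp add: add.assoc add_increasing2 ennreal_leI)
    next
      case 2
      then have "I J v = 1" using kJ by (intro I1) auto
      then have "ennreal (norm (u y)) \<le> ennreal U * I J v" using U[OF y(2)] by (simp add: ennreal_leI)
      then show ?thesis by (rule add_increasing[OF zero_le])
    next
      case (3 i)
      then obtain j where j: "i = Suc j" "k \<le> j" by (cases i) auto
      have "I j v = 1" using 3(4) j by (intro I1) auto
      then have "ennreal (norm (u y)) \<le> ennreal (a (Suc j)) * I j v" using 3(3) j by (simp add: ennreal_leI)
      also have "\<dots> \<le> (\<Sum>j\<in>{k..<J}. ennreal (a (Suc j)) * I j v)"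
        using j 3(2) by (intro member_le_sum) auto
      finally show ?thesis by (simp add: add_increasing add_increasing2)
    qed
  qed
  have "ennreal (\<omega> / 4 ^ Suc CARD('n) * norm (u x)) \<le> (\<integral>\<^sup>+v\<in>ball 0 1. ennreal \<bar>v \<bullet> u x\<bar> \<partial>lborel)"
    using norm_le_integral_inner[of "u x"] by (simp add: \<omega>_def)
  also have "\<dots> \<le> (\<integral>\<^sup>+v. R v + (ennreal (a k) * indicator (ball 0 1) v
       + (\<Sum>j\<in>{k..<J}. ennreal (a (Suc j)) * I j v) + ennreal U * I J v) \<partial>lborel)"
  proof (rule nn_integral_mono)
    fix v :: "real^'n"
    show "ennreal \<bar>v \<bullet> u x\<bar> * indicator (ball 0 1) v \<le> R v + (ennreal (a k) * indicator (ball 0 1) v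
       + (\<Sum>j\<in>{k..<J}. ennreal (a (Suc j)) * I j v) + ennreal U * I J v)"
    proof (cases "v \<in> ball 0 1")
      case True
      from ray_estimate[OF \<Omega> u E F EF x True] show ?thesis
      proof
        assume "ennreal \<bar>v \<bullet> u x\<bar> \<le> ray_integral F x v"
        then have "ennreal \<bar>v \<bullet> u x\<bar> * indicator (ball 0 1) v \<le> R v" using True by (simp add: R_def)
        then show ?thesis by (rule add_increasing2[OF zero_le])
      next
        assume "\<exists>s>0. x + s *\<^sub>R v \<in> frontier \<Omega> \<and> ennreal \<bar>v \<bullet> u x\<bar> \<le> ray_integral F x v + ennreal (norm (u (x + s *\<^sub>R v)))"
        then obtain s where s: "0 < s" "x + s *\<^sub>R v \<in> frontier \<Omega>"
          "ennreal \<bar>v \<bullet> u x\<bar> \<le> ray_integral F x v + ennreal (norm (u (x + s *\<^sub>R v)))" by blast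
        note s(3)
        also have "ray_integral F x v + ennreal (norm (u (x + s *\<^sub>R v))) \<le> R v + (ennreal (a k) * indicator (ball 0 1) v
            + (\<Sum>j\<in>{k..<J}. ennreal (a (Suc j)) * I j v) + ennreal U * I J v)"
          using lev[OF True s(1) refl s(2)] True by (intro add_mono) (simp_all add: R_def)
        finally show ?thesis using True by simp
      qed
    qed simp
  qed
  also have "\<dots> = (\<integral>\<^sup>+v. R v \<partial>lborel) + ((\<integral>\<^sup>+v. ennreal (a k) * indicator (ball 0 1) v \<partial>(lborel :: (real^'n) measure))
       + (\<integral>\<^sup>+v. (\<Sum>j\<in>{k..<J}. ennreal (a (Suc j)) * I j v) \<partial>lborel) + (\<integral>\<^sup>+v. ennreal U * I J v \<partial>lborel))"
    by (simp add: nn_integral_add)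
  also have "\<dots> = (\<integral>\<^sup>+v. R v \<partial>lborel) + (ennreal (\<omega> * a k)
       + (\<Sum>j\<in>{k..<J}. ennreal (a (Suc j)) * emeasure lborel (N j)) + ennreal U * emeasure lborel (N J))"
  proof -
    have "(\<integral>\<^sup>+v. ennreal (a k) * indicator (ball 0 1) v \<partial>(lborel :: (real^'n) measure)) = ennreal (a k) * emeasure lborel (ball (0::real^'n) 1)"
      by (rule nn_integral_cmult_indicator) simp
    also have "\<dots> = ennreal (\<omega> * a k)"
      using a by (simp add: emeasure_ball \<omega>_def ennreal_mult[symmetric] mult.commute)
    finally have 1: "(\<integral>\<^sup>+v. ennreal (a k) * indicator (ball 0 1) v \<partial>(lborel :: (real^'n) measure)) = ennreal (\<omega> * a k)" .
    have 2: "(\<integral>\<^sup>+v. c * I j v \<partial>lborel) = c * emeasure lborel (N j)" for c j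
      unfolding I_def by (rule nn_integral_cmult_indicator) simp
    have 3: "(\<integral>\<^sup>+v. (\<Sum>j\<in>{k..<J}. ennreal (a (Suc j)) * I j v) \<partial>lborel)
        = (\<Sum>j\<in>{k..<J}. ennreal (a (Suc j)) * emeasure lborel (N j))"
      by (subst nn_integral_sum) (simp_all add: 2)
    show ?thesis unfolding 1 2 3 ..
  qed
  also have "\<dots> \<le> ennreal ((3 / 2) ^ m) * (\<integral>\<^sup>+z. ennreal (F z) * ennreal (1 / dist z x ^ m) \<partial>lborel)
      + (ennreal (\<omega> * a k) + (\<Sum>j\<in>{k..<J}. ennreal (a (Suc j)) * M j x) + ennreal U * M J x)"
    unfolding R_def m_def
    by (intro add_mono nn_integral_ray_integral_le dim F order_refl sum_mono mult_left_mono Nle) auto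
  finally show ?thesis .
qed

text \<open>Collects the constants of the preceding estimates: \<open>c0\<close> from averaging over
  directions, \<open>Kc\<close> from the kernel over \<open>\<Omega>\<close>, \<open>D\<close> from
  the cones, \<open>CR\<close> for the Riesz part and \<open>CB\<close> for the boundary part.
  \<open>A\<close> and \<open>\<kappa>\<close> normalise the dyadic measures on the boundary and
  inside. As an explicit formula it can be fixed before \<open>\<Omega>\<close>, the measure and
  \<open>u\<close>.\<close>

definition key_const :: "nat \<Rightarrow> real \<Rightarrow> real \<Rightarrow> real \<Rightarrow> real \<Rightarrow> real \<Rightarrow> real \<Rightarrow> real" where
  "key_const n K b V N A \<kappa> =
    (let m = n - 1; \<omega> = unit_ball_vol (real n); c0 = \<omega> / 4 ^ Suc n;
         Kc = 2 ^ m * K / (1 - 2 powr (real m - b)) + N;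
         D = cone_const n * Kc * 2 ^ m / unit_ball_vol (real m);
         P = 1 / \<kappa> powr (real m / b);
         L = 2 ^ n * unit_ball_vol (real n) + 1;
         L' = 2 ^ m * K / (1 - 2 powr (real m - b)) + 1;
         CR = (3/2) ^ m * (L * root n V + 2 * L + 2 * L' * P);
         CB = \<omega> + 4 * A * D / \<kappa>
     in (CR + CB + 1) / c0)"

text \<open>The pointwise estimate is integrated over \<open>G\<close> and divided by the measure of
  \<open>G\<close>. As that measure is at least \<open>\<kappa> * (1/2) ^ k\<close>, a boundary set
  of measure \<open>A * (1/2) ^ j\<close> carries in the mean a weight of order
  \<open>2 ^ k * (1/2) ^ j\<close>; this is where \<open>half_tail a k\<close> comes from.\<close>

lemma key_estimate:
  fixes K b V N A \<kappa> :: real and \<nu> :: "(real^'n) measure" and u :: "real^'n \<Rightarrow> real^'n" and a :: "nat \<Rightarrow> real"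
  defines "m \<equiv> CARD('n) - 1"
  assumes dim: "2 \<le> CARD('n)" and K: "0 \<le> K" and b: "real CARD('n) - 1 < b" and V: "0 \<le> V"
    and N: "0 \<le> N" and A: "0 < A" and \<kappa>: "0 < \<kappa>"
    and \<Omega>: "open \<Omega>" and sets[measurable_cong]: "sets \<nu> = sets borel"
      and growth: "\<And>y r. 0 < r \<Longrightarrow> emeasure \<nu> (ball y r) \<le> ennreal (K * r powr b)"
      and mass: "emeasure \<nu> UNIV \<le> ennreal N" and vol: "emeasure lborel \<Omega> \<le> ennreal V"
      and u: "u \<in> C_b (closure \<Omega>)" and E: "has_sym_grad \<Omega> u E"
      and F[measurable]: "F \<in> borel_measurable borel"
      and EF: "AE z in lebesgue. z \<in> \<Omega> \<longrightarrow> norm (E z) \<le> \<Lambda> * F z"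
      and supp: "\<And>y. y \<notin> \<Omega> \<Longrightarrow> F y = 0" and \<Lambda>: "0 < \<Lambda>"
      and int: "(\<integral>\<^sup>+y. ennreal (F y ^ CARD('n)) \<partial>lborel) \<le> 1"
      and a: "\<And>j. 0 \<le> a j"
      and aH: "\<And>j. hausdorff_outer m {y \<in> frontier \<Omega>. a j < norm (u y)} \<le> ennreal (A * (1/2) ^ j)"
      and G[measurable]: "G \<in> sets borel" and G\<Omega>: "G \<subseteq> \<Omega>" and tG: "\<And>x. x \<in> G \<Longrightarrow> t \<le> norm (u x)" and t: "0 \<le> t"
      and \<kappa>G: "ennreal (\<kappa> * (1/2) ^ k) \<le> emeasure \<nu> G"
  shows "ennreal t \<le> ennreal (key_const CARD('n) K b V N A \<kappa>) * level_bound \<Lambda> (level_norm F) a k"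
proof -
  define \<omega> where "\<omega> = unit_ball_vol (real CARD('n))"
  have \<omega>: "0 < \<omega>" by (simp add: \<omega>_def)
  have mb: "real m < b" using b dim by (simp add: m_def of_nat_diff)
  have b0: "0 < b" using mb by (meson of_nat_0_le_iff le_less_trans)
  have q: "2 powr (real m - b) < 1" using mb by (auto simp: powr_less_one)
  define c0 where "c0 = \<omega> / 4 ^ Suc CARD('n)"
  have c0: "0 < c0" using \<omega> by (simp add: c0_def)
  define Kc where "Kc = 2 ^ m * K / (1 - 2 powr (real m - b)) + N"
  have Kc: "0 \<le> Kc" using q K N by (simp add: Kc_def)
  define D where "D = cone_const CARD('n) * Kc * 2 ^ m / unit_ball_vol (real m)"
  have D: "0 \<le> D" using Kc cone_const_pos[of "CARD('n)"] by (simp add: D_def)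
  define P where "P = 1 / \<kappa> powr (real m / b)"
  have P: "0 \<le> P" by (simp add: P_def)
  define L where "L = 2 ^ CARD('n) * unit_ball_vol (real CARD('n)) + 1"
  define L' where "L' = 2 ^ m * K / (1 - 2 powr (real m - b)) + 1"
  define CR where "CR = (3/2) ^ m * (L * root CARD('n) V + 2 * L + 2 * L' * P)"
  have L: "0 \<le> L" "0 \<le> L'" using q K by (simp_all add: L_def L'_def)
  then have CR: "0 \<le> CR" using V P by (simp add: CR_def)
  define CB where "CB = \<omega> + 4 * A * D / \<kappa>"
  have CB: "0 \<le> CB" using \<omega> A D \<kappa> by (simp add: CB_def)
  define C where "C = (CR + CB + 1) / c0"
  have C_eq: "key_const CARD('n) K b V N A \<kappa> = C"
    unfolding key_const_def Let_def C_def CR_def CB_def c0_def D_def Kc_def P_def L_def L'_def \<omega>_def m_def ..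
  let ?N = "emeasure \<nu> G"
  let ?Y = "\<lambda>j. {y \<in> frontier \<Omega>. a j < norm (u y)}"
  have sp: "space \<nu> = UNIV" using sets_eq_imp_space_eq[OF sets] by simp
  have [measurable]: "\<Omega> \<in> sets borel" using \<Omega> by simp
  have fin: "finite_measure \<nu>"
    using mass by (intro finite_measureI) (auto simp: sp top_unique)
  have Nfin: "?N < top" using finite_measure.emeasure_finite[OF fin, of G] by (simp add: less_top)
  have Npos: "0 < ?N" using \<kappa>G \<kappa> by (intro less_le_trans[OF _ \<kappa>G]) simp
  define g where "g = enn2real ?N"
  have g: "?N = ennreal g" "0 < g"
    using Nfin Npos by (simp_all add: g_def enn2real_positive_iff)
  have \<kappa>g: "\<kappa> * (1/2) ^ k \<le> g" using \<kappa>G g \<kappa> by simp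
  \<comment> \<open>Split at radius 1: the far part of the kernel is at most 1 and costs the total
    mass \<open>N\<close>.\<close>
  have kern: "(\<integral>\<^sup>+x\<in>\<Omega>. ennreal (1 / dist x y ^ m) \<partial>\<nu>) \<le> ennreal Kc" for y
  proof -
    have "(\<integral>\<^sup>+x\<in>\<Omega>. ennreal (1 / dist x y ^ m) \<partial>\<nu>)
       \<le> ennreal (2 ^ m * K * 1 powr (b - m) / (1 - 2 powr (m - b))) + ennreal (1 / 1 ^ m) * emeasure \<nu> \<Omega>"
      using growth by (intro nn_integral_kernel_le sets K mb) simp_all
    also have "emeasure \<nu> \<Omega> \<le> ennreal N"
      by (rule order_trans[OF emeasure_mono mass]) (simp_all add: sets)
    finally show ?thesis using K N q by (simp add: Kc_def add_left_mono)
  qed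
  have "\<exists>M. M \<in> borel_measurable borel \<and>
    (\<forall>x. x \<notin> ?Y j \<longrightarrow> (\<exists>N\<in>sets borel. {v \<in> ball 0 1. \<exists>s>0. x + s *\<^sub>R v \<in> ?Y j} \<subseteq> N \<and> emeasure lborel N \<le> M x)) \<and>
    (\<integral>\<^sup>+x\<in>\<Omega>. M x \<partial>\<nu>) \<le> ennreal D * ennreal (2 * A * (1/2) ^ j)" for j
  proof -
    \<comment> \<open>The factor 2 provides the strict inequality that
      \<open>hausdorff_cone_majorant\<close> asks for.\<close>
    have "hausdorff_outer m (?Y j) < ennreal (2 * A * (1/2) ^ j)"
      using A by (intro le_less_trans[OF aH] ennreal_lessI) auto
    then have lt: "hausdorff_outer (DIM(real^'n) - 1) (?Y j) < ennreal (2 * A * (1/2) ^ j)" by (simp add: m_def)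
    have kern': "(\<integral>\<^sup>+x\<in>\<Omega>. ennreal (1 / dist x y ^ (DIM(real^'n) - 1)) \<partial>\<nu>) \<le> ennreal Kc" for y
      using kern[of y] by (simp add: m_def)
    obtain M where "M \<in> borel_measurable borel"
      "\<And>x. x \<notin> ?Y j \<Longrightarrow> \<exists>N\<in>sets borel. {v \<in> ball 0 1. \<exists>s>0. x + s *\<^sub>R v \<in> ?Y j} \<subseteq> N \<and> emeasure lborel N \<le> M x"
      "(\<integral>\<^sup>+x\<in>\<Omega>. M x \<partial>\<nu>) \<le> ennreal (cone_const DIM(real^'n) * Kc * 2 ^ (DIM(real^'n) - 1)
          / unit_ball_vol (real (DIM(real^'n) - 1))) * ennreal (2 * A * (1/2) ^ j)"
      using hausdorff_cone_majorant[OF sets _ kern' Kc lt] by auto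
    moreover have "cone_const DIM(real^'n) * Kc * 2 ^ (DIM(real^'n) - 1) / unit_ball_vol (real (DIM(real^'n) - 1)) = D"
      by (simp add: D_def m_def)
    ultimately have "M \<in> borel_measurable borel \<and>
      (\<forall>x. x \<notin> ?Y j \<longrightarrow> (\<exists>N\<in>sets borel. {v \<in> ball 0 1. \<exists>s>0. x + s *\<^sub>R v \<in> ?Y j} \<subseteq> N \<and> emeasure lborel N \<le> M x)) \<and>
      (\<integral>\<^sup>+x\<in>\<Omega>. M x \<partial>\<nu>) \<le> ennreal D * ennreal (2 * A * (1/2) ^ j)"
      by simp
    then show ?thesis by blast
  qed
  then have "\<forall>j. \<exists>M. M \<in> borel_measurable borel \<and>
    (\<forall>x. x \<notin> ?Y j \<longrightarrow> (\<exists>N\<in>sets borel. {v \<in> ball 0 1. \<exists>s>0. x + s *\<^sub>R v \<in> ?Y j} \<subseteq> N \<and> emeasure lborel N \<le> M x)) \<and>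
    (\<integral>\<^sup>+x\<in>\<Omega>. M x \<partial>\<nu>) \<le> ennreal D * ennreal (2 * A * (1/2) ^ j)" by blast
  from choice[OF this] obtain M where M[measurable]: "\<And>j. M j \<in> borel_measurable borel"
    and Mcov: "\<And>j x. x \<notin> ?Y j \<Longrightarrow> \<exists>N\<in>sets borel. {v \<in> ball 0 1. \<exists>s>0. x + s *\<^sub>R v \<in> ?Y j} \<subseteq> N \<and> emeasure lborel N \<le> M j x"
    and Mint: "\<And>j. (\<integral>\<^sup>+x\<in>\<Omega>. M j x \<partial>\<nu>) \<le> ennreal D * ennreal (2 * A * (1/2) ^ j)" by blast
  have notY: "x \<notin> ?Y j" if "x \<in> \<Omega>" for x j
    using that \<Omega> by (auto simp: frontier_def interior_open)
  have MG: "(\<integral>\<^sup>+x\<in>G. M j x \<partial>\<nu>) \<le> ?N * ennreal (2 * A * D / \<kappa> * (2 ^ k * (1/2) ^ j))" for j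
  proof -
    have "(\<integral>\<^sup>+x\<in>G. M j x \<partial>\<nu>) \<le> (\<integral>\<^sup>+x\<in>\<Omega>. M j x \<partial>\<nu>)"
      using G\<Omega> by (intro nn_integral_mono mult_left_mono) (auto simp: indicator_def)
    also have "\<dots> \<le> ennreal (D * (2 * A * (1/2) ^ j))"
      using Mint[of j] D A by (simp add: ennreal_mult')
    also have "\<dots> \<le> ennreal (g * (2 * A * D / \<kappa> * (2 ^ k * (1/2) ^ j)))"
    proof (rule ennreal_leI)
      have "\<kappa> \<le> g * 2 ^ k" using \<kappa>g by (simp add: power_divide field_simps)
      then have "1 \<le> g * 2 ^ k / \<kappa>" using \<kappa> by simp
      then have "(D * (2 * A * (1/2) ^ j)) * 1 \<le> (D * (2 * A * (1/2) ^ j)) * (g * 2 ^ k / \<kappa>)"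
        using D A by (intro mult_left_mono) auto
      then show "D * (2 * A * (1/2) ^ j) \<le> g * (2 * A * D / \<kappa> * (2 ^ k * (1/2) ^ j))"
        by (simp add: mult_ac)
    qed
    also have "\<dots> = ?N * ennreal (2 * A * D / \<kappa> * (2 ^ k * (1/2) ^ j))"
      unfolding g(1) using g(2) by (intro ennreal_mult') simp
    finally show ?thesis .
  qed
  obtain U where U_nonneg: "0 \<le> U" and U: "\<And>y. y \<in> closure \<Omega> \<Longrightarrow> norm (u y) \<le> U"
    by (rule C_b_bounded[OF u]) blast
  have frontier_closure: "y \<in> closure \<Omega>" if "y \<in> frontier \<Omega>" for y
    using that by (simp add: frontier_def)
  let ?c = "level_norm F"
  let ?S = "1 + (\<Sum>j<k. ennreal (?c j)) + (half_tail ?c k)"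
  let ?T = "half_tail a k"
  \<comment> \<open>\<open>r powr b\<close> is the guaranteed measure of \<open>G\<close>. Then
    \<open>1 / r ^ m\<close> grows like \<open>2 powr (k * m / b)\<close>, and \<open>m < b\<close>
    bounds it by a multiple of \<open>2 ^ k\<close>.\<close>
  define r where "r = (\<kappa> * (1/2) ^ k) powr (1 / b)"
  have r: "0 < r" "r powr b = \<kappa> * (1/2) ^ k"
    using \<kappa> b0 by (simp_all add: r_def powr_powr)
  have rP: "1 / r ^ m \<le> P * 2 ^ k"
  proof -
    have "r ^ m = (\<kappa> * (1/2) ^ k) powr (real m / b)"
      using r(1) by (simp add: powr_realpow[symmetric] r_def powr_powr)
    also have "\<dots> = \<kappa> powr (real m / b) * ((1/2) ^ k) powr (real m / b)"
      using \<kappa> by (simp add: powr_mult)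
    finally have "1 / r ^ m = P * (1 / ((1/2) ^ k) powr (real m / b))" by (simp add: P_def)
    also have "1 / ((1/2) ^ k) powr (real m / b) = (2 ^ k) powr (real m / b)"
      by (simp add: power_divide powr_divide)
    also have "P * (2 ^ k) powr (real m / b) \<le> P * (2 ^ k) powr 1"
      using P mb b0 by (intro mult_left_mono powr_mono) auto
    finally show ?thesis by simp
  qed
  have riesz: "(\<integral>\<^sup>+x\<in>G. (\<integral>\<^sup>+y. ennreal (F y) * ennreal (1 / dist y x ^ m) \<partial>lborel) \<partial>\<nu>)
    \<le> ?N * ennreal (L * root CARD('n) V + 2 * L + 2 * L' * P) * ?S"
    using riesz_level_bound[OF _ sets fin growth K _ F _ vol V supp, of G r P k]
      dim mb int r rP P \<kappa>G unfolding L_def L'_def m_def by simp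
  have F0: "(\<integral>\<^sup>+z. ennreal (\<Lambda> * F z) * ennreal (1 / dist z x ^ m) \<partial>lborel)
     = ennreal \<Lambda> * (\<integral>\<^sup>+z. ennreal (F z) * ennreal (1 / dist z x ^ m) \<partial>lborel)" for x
    using \<Lambda> by (subst nn_integral_cmult[symmetric]) (auto simp: ennreal_mult' mult.assoc)
  have alg: "p * (l * (N * q * s)) + (w * N + (\<Sum>j\<in>I. f j * (N * e j)) + z * (N * y))
      = (p * q * (l * s) + (w + (\<Sum>j\<in>I. f j * e j) + z * y)) * N"
    for p l N q s w z y :: ennreal and f e :: "nat \<Rightarrow> ennreal" and I
  proof -
    have "(\<Sum>j\<in>I. f j * (N * e j)) = (\<Sum>j\<in>I. f j * e j) * N"
      unfolding sum_distrib_right by (intro sum.cong refl) (simp only: mult_ac)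
    then show ?thesis by (simp only: distrib_right distrib_left mult_ac)
  qed
  \<comment> \<open>Cut-off after \<open>i\<close> further levels: boundary values beyond level
    \<open>k + i\<close> are bounded by \<open>U\<close>, on directions whose weight decays like
    \<open>(1/2) ^ i\<close>. Letting \<open>i\<close> tend to infinity removes
    \<open>U\<close>.\<close>
  have step: "ennreal (c0 * t) \<le> ennreal CR * (ennreal \<Lambda> * ?S) + ennreal CB * ?T + ennreal (U * (2 * A * D / \<kappa>) * (1/2) ^ i)" for i
  proof -
    let ?J = "k + i"
    let ?e = "\<lambda>j. 2 * A * D / \<kappa> * (2 ^ k * (1/2) ^ j)"
    have e0: "0 \<le> ?e j" for j using A D \<kappa> by simp
    have pt: "ennreal (c0 * t) * indicator G x
      \<le> ennreal ((3 / 2) ^ m) * (ennreal \<Lambda> * ((\<integral>\<^sup>+z. ennreal (F z) * ennreal (1 / dist z x ^ m) \<partial>lborel) * indicator G x))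
        + (ennreal (\<omega> * a k) * indicator G x + (\<Sum>j\<in>{k..<?J}. ennreal (a (Suc j)) * (M j x * indicator G x)) + ennreal U * (M ?J x * indicator G x))" for x
    proof (cases "x \<in> G")
      case True
      then have x: "x \<in> \<Omega>" using G\<Omega> by blast
      have "ennreal (c0 * t) \<le> ennreal (c0 * norm (u x))"
        using True tG c0 by (intro ennreal_leI mult_left_mono) auto
      also have "\<dots> \<le> ennreal ((3 / 2) ^ m) * (\<integral>\<^sup>+z. ennreal (\<Lambda> * F z) * ennreal (1 / dist z x ^ m) \<partial>lborel)
        + (ennreal (\<omega> * a k) + (\<Sum>j\<in>{k..<?J}. ennreal (a (Suc j)) * M j x) + ennreal U * M ?J x)"
        unfolding c0_def \<omega>_def m_def
        by (rule pointwise_estimate[where M = M and a = a, OF dim \<Omega> u E _ EF x _ a U[OF frontier_closure] Mcov[OF notY[OF x]]]) auto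
      finally show ?thesis using True by (simp add: F0)
    qed simp
    have "ennreal (c0 * t) * ?N = (\<integral>\<^sup>+x. ennreal (c0 * t) * indicator G x \<partial>\<nu>)"
      by (rule nn_integral_cmult_indicator[symmetric]) (simp add: sets)
    also have "\<dots> \<le> (\<integral>\<^sup>+x. ennreal ((3 / 2) ^ m) * (ennreal \<Lambda> * ((\<integral>\<^sup>+z. ennreal (F z) * ennreal (1 / dist z x ^ m) \<partial>lborel) * indicator G x))
        + (ennreal (\<omega> * a k) * indicator G x + (\<Sum>j\<in>{k..<?J}. ennreal (a (Suc j)) * (M j x * indicator G x)) + ennreal U * (M ?J x * indicator G x)) \<partial>\<nu>)"
      by (intro nn_integral_mono pt)
    also have "\<dots> = ennreal ((3 / 2) ^ m) * (ennreal \<Lambda> * (\<integral>\<^sup>+x\<in>G. (\<integral>\<^sup>+z. ennreal (F z) * ennreal (1 / dist z x ^ m) \<partial>lborel) \<partial>\<nu>))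
        + (ennreal (\<omega> * a k) * ?N + (\<Sum>j\<in>{k..<?J}. ennreal (a (Suc j)) * (\<integral>\<^sup>+x\<in>G. M j x \<partial>\<nu>)) + ennreal U * (\<integral>\<^sup>+x\<in>G. M ?J x \<partial>\<nu>))"
    proof -
      have "(\<integral>\<^sup>+x. ennreal (\<omega> * a k) * indicator G x \<partial>\<nu>) = ennreal (\<omega> * a k) * ?N"
        by (rule nn_integral_cmult_indicator) (simp add: sets)
      then show ?thesis by (simp add: nn_integral_add nn_integral_cmult nn_integral_sum)
    qed
    also have "\<dots> \<le> ennreal ((3 / 2) ^ m) * (ennreal \<Lambda> * (?N * ennreal (L * root CARD('n) V + 2 * L + 2 * L' * P) * ?S))
        + (ennreal (\<omega> * a k) * ?N + (\<Sum>j\<in>{k..<?J}. ennreal (a (Suc j)) * (?N * ennreal (?e j))) + ennreal U * (?N * ennreal (?e ?J)))"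
      by (intro add_mono mult_left_mono riesz order_refl sum_mono MG) auto
    also have "\<dots> = (ennreal ((3 / 2) ^ m) * ennreal (L * root CARD('n) V + 2 * L + 2 * L' * P) * (ennreal \<Lambda> * ?S)
        + (ennreal (\<omega> * a k) + (\<Sum>j\<in>{k..<?J}. ennreal (a (Suc j)) * ennreal (?e j)) + ennreal U * ennreal (?e ?J))) * ?N"
      by (rule alg)
    finally have "ennreal (c0 * t) \<le> ennreal ((3 / 2) ^ m) * ennreal (L * root CARD('n) V + 2 * L + 2 * L' * P) * (ennreal \<Lambda> * ?S)
        + (ennreal (\<omega> * a k) + (\<Sum>j\<in>{k..<?J}. ennreal (a (Suc j)) * ennreal (?e j)) + ennreal U * ennreal (?e ?J))"
      using Npos Nfin unfolding mult.commute[of _ ?N] by (subst (asm) ennreal_mult_le_mult_iff) auto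
    also have "ennreal ((3 / 2) ^ m) * ennreal (L * root CARD('n) V + 2 * L + 2 * L' * P) = ennreal CR"
      by (simp add: CR_def ennreal_mult')
    also have "ennreal U * ennreal (?e ?J) = ennreal (U * (2 * A * D / \<kappa>) * (1/2) ^ i)"
      using U_nonneg by (simp add: ennreal_mult'[symmetric] power_add power_divide mult_ac)
    also have "ennreal (\<omega> * a k) + (\<Sum>j\<in>{k..<?J}. ennreal (a (Suc j)) * ennreal (?e j)) \<le> ennreal CB * ?T"
    proof -
      have "ennreal (\<omega> * a k) \<le> ennreal \<omega> * ?T"
      proof -
        have "ennreal ((1/2) ^ 0 * a (k + 0)) \<le> ?T"
          using sum_le_suminf[OF summableI, of "{0}" "\<lambda>i. ennreal ((1/2) ^ i * a (k + i))"] by simp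
        then show ?thesis using \<omega> by (simp add: ennreal_mult' mult_left_mono)
      qed
      \<comment> \<open>The level is \<open>a (Suc j)\<close> but its weight has index
        \<open>j\<close>; the shift turns the 2 in \<open>?e\<close> into the 4 in
        \<open>CB\<close>.\<close>
      moreover have "(\<Sum>j\<in>{k..<?J}. ennreal (a (Suc j)) * ennreal (?e j)) \<le> ennreal (4 * A * D / \<kappa>) * ?T"
      proof -
        have "(\<Sum>j\<in>{k..<?J}. ennreal (a (Suc j)) * ennreal (?e j))
           = (\<Sum>l<i. ennreal (a (Suc (k + l))) * ennreal (?e (k + l)))"
          by (rule sum.reindex_bij_witness[of _ "\<lambda>l. k + l" "\<lambda>j. j - k"]) auto
        also have "\<dots> = (\<Sum>l<i. ennreal (4 * A * D / \<kappa>) * ennreal ((1/2) ^ Suc l * a (k + Suc l)))"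
        proof (intro sum.cong refl)
          fix l
          have "a (Suc (k + l)) * ?e (k + l) = (4 * A * D / \<kappa>) * ((1/2) ^ Suc l * a (k + Suc l))"
            by (simp add: power_add power_divide)
          then show "ennreal (a (Suc (k + l))) * ennreal (?e (k + l)) = ennreal (4 * A * D / \<kappa>) * ennreal ((1/2) ^ Suc l * a (k + Suc l))"
            using a A D \<kappa> by (subst (1 2) ennreal_mult'[symmetric]) auto
        qed
        also have "\<dots> = ennreal (4 * A * D / \<kappa>) * (\<Sum>l<i. ennreal ((1/2) ^ Suc l * a (k + Suc l)))"
          by (rule sum_distrib_left[symmetric])
        also have "(\<Sum>l<i. ennreal ((1/2) ^ Suc l * a (k + Suc l))) = (\<Sum>l\<in>Suc ` {..<i}. ennreal ((1/2) ^ l * a (k + l)))"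
          by (subst sum.reindex) auto
        also have "\<dots> \<le> ?T" by (rule sum_le_suminf) auto
        finally show ?thesis by (simp add: mult_left_mono)
      qed
      ultimately have "ennreal (\<omega> * a k) + (\<Sum>j\<in>{k..<?J}. ennreal (a (Suc j)) * ennreal (?e j))
        \<le> ennreal \<omega> * ?T + ennreal (4 * A * D / \<kappa>) * ?T" by (rule add_mono)
      also have "\<dots> = ennreal CB * ?T"
        using \<omega> A D \<kappa> by (simp add: CB_def distrib_right)
      finally show ?thesis .
    qed
    finally show ?thesis by (simp add: add.assoc add_left_mono add_right_mono)
  qed
  have "(\<lambda>i. ennreal (U * (2 * A * D / \<kappa>) * (1/2) ^ i)) \<longlonglongrightarrow> ennreal (U * (2 * A * D / \<kappa>) * 0)"
    by (intro tendsto_ennrealI tendsto_mult tendsto_const LIMSEQ_realpow_zero) auto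
  then have "(\<lambda>i. ennreal CR * (ennreal \<Lambda> * ?S) + ennreal CB * ?T + ennreal (U * (2 * A * D / \<kappa>) * (1/2) ^ i))
    \<longlonglongrightarrow> ennreal CR * (ennreal \<Lambda> * ?S) + ennreal CB * ?T + ennreal (U * (2 * A * D / \<kappa>) * 0)"
    by (intro tendsto_add tendsto_const)
  then have "ennreal (c0 * t) \<le> ennreal CR * (ennreal \<Lambda> * ?S) + ennreal CB * ?T + ennreal (U * (2 * A * D / \<kappa>) * 0)"
    by (rule LIMSEQ_le_const) (use step in blast)
  also have "\<dots> \<le> ennreal (c0 * C) * (ennreal \<Lambda> * ?S) + ennreal (c0 * C) * ?T"
    using CR CB c0 by (auto simp: C_def intro!: add_mono mult_right_mono ennreal_leI)
  finally have "ennreal (c0 * t) \<le> ennreal (c0 * C) * (ennreal \<Lambda> * ?S + ?T)"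
    by (simp only: distrib_left)
  then have "ennreal (1 / c0) * ennreal (c0 * t) \<le> ennreal (1 / c0) * (ennreal (c0 * C) * (ennreal \<Lambda> * ?S + ?T))"
    by (rule mult_left_mono) simp
  moreover have "ennreal (1 / c0) * ennreal (c0 * s) = ennreal s" for s
    using c0 by (subst ennreal_mult'[symmetric]) auto
  ultimately show "ennreal t \<le> ennreal (key_const CARD('n) K b V N A \<kappa>) * (ennreal \<Lambda> * ?S + ?T)"
    unfolding C_eq by (simp only: mult.assoc[symmetric])
qed

section \<open>Borel representatives, measurability and the reduction to the whole space\<close>

lemma E1_has_sym_grad:
  assumes "u \<in> E1 p \<Omega>" shows "has_sym_grad \<Omega> u (sym_grad \<Omega> u)"
proof -
  obtain E where "has_sym_grad \<Omega> u E" using assms by (auto simp: E1_def)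
  then show ?thesis unfolding sym_grad_def by (rule someI[of "has_sym_grad \<Omega> u"])
qed

text \<open>Local integrability gives measurability on each set of a compact exhaustion, whose
  indicators converge pointwise.\<close>

lemma L1_loc_measurable:
  fixes f :: "real^'n \<Rightarrow> 'b::{banach, second_countable_topology}"
  assumes \<Omega>: "open \<Omega>" and f: "f \<in> L1_loc \<Omega>"
  shows "(\<lambda>x. indicator \<Omega> x *\<^sub>R f x) \<in> borel_measurable lebesgue"
proof (rule open_Union_compact_subsets[OF \<Omega>])
  fix C :: "nat \<Rightarrow> (real^'n) set"
  assume C: "\<And>n. compact (C n)" "\<And>n. C n \<subseteq> \<Omega>"
    and "\<And>n. C n \<subseteq> interior (C (Suc n))" "\<Union> (range C) = \<Omega>"
    and C': "\<And>K. compact K \<Longrightarrow> K \<subseteq> \<Omega> \<Longrightarrow> \<exists>N. \<forall>n\<ge>N. K \<subseteq> C n"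
  show ?thesis
  proof (rule borel_measurable_LIMSEQ_metric)
    fix i :: nat
    have "set_integrable lebesgue (C i) f" using f C by (auto simp: L1_loc_def)
    then show "(\<lambda>x. indicator (C i) x *\<^sub>R f x) \<in> borel_measurable lebesgue"
      unfolding set_integrable_def by (rule borel_measurable_integrable)
  next
    fix x
    show "(\<lambda>i. indicator (C i) x *\<^sub>R f x) \<longlonglongrightarrow> indicator \<Omega> x *\<^sub>R f x"
    proof (cases "x \<in> \<Omega>")
      case True
      then obtain N where "\<forall>n\<ge>N. {x} \<subseteq> C n" using C'[of "{x}"] by auto
      then have "eventually (\<lambda>i. indicator (C i) x *\<^sub>R f x = indicator \<Omega> x *\<^sub>R f x) sequentially"
        using True by (intro eventually_sequentiallyI[of N]) auto
      then show ?thesis by (rule tendsto_eventually)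
    next
      case False
      then have "indicator (C i) x = (0::real)" for i using C(2)[of i] by (auto simp: indicator_def)
      then show ?thesis using False by simp
    qed
  qed
qed

text \<open>Division by \<open>\<Lambda>\<close> normalises the integral to at most 1;
  \<open>\<Lambda>\<close> is any positive bound rather than the norm, which may be 0. A Borel
  function is wanted because the potentials are integrated by Fubini's theorem over products with
  \<open>lborel\<close>.\<close>

lemma sym_grad_borel_representative:
  fixes u :: "real^'n \<Rightarrow> real^'n"
  assumes \<Omega>: "open \<Omega>" and u: "u \<in> E1 (real CARD('n)) \<Omega>" and \<Lambda>: "0 < \<Lambda>"
    and norm: "sym_grad_norm (real CARD('n)) \<Omega> u \<le> ennreal \<Lambda>"
  obtains F where "F \<in> borel_measurable borel" "\<And>y. y \<notin> \<Omega> \<Longrightarrow> F y = 0"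
    "AE z in lebesgue. z \<in> \<Omega> \<longrightarrow> norm (sym_grad \<Omega> u z) \<le> \<Lambda> * F z"
    "(\<integral>\<^sup>+y. ennreal (F y ^ CARD('n)) \<partial>lborel) \<le> 1"
proof -
  let ?E = "sym_grad \<Omega> u" and ?n = "CARD('n)"
  define h where "h x = norm (indicator \<Omega> x *\<^sub>R ?E x) / \<Lambda>" for x
  have "?E \<in> L1_loc \<Omega>" using E1_has_sym_grad[OF u] by (simp add: has_sym_grad_def)
  from L1_loc_measurable[OF \<Omega> this] have "h \<in> borel_measurable lebesgue"
    unfolding h_def by measurable
  then obtain g where g[measurable]: "g \<in> borel_measurable borel" and gh: "AE x in lborel. h x = g x"
    using completion_ex_borel_measurable_real[of h lborel] by (auto simp del: measurable_completion)
  define F where "F x = indicator \<Omega> x * \<bar>g x\<bar>" for x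
  have [measurable]: "\<Omega> \<in> sets borel" using \<Omega> by simp
  have F: "F \<in> borel_measurable borel" unfolding F_def[abs_def] by measurable
  have Fh: "AE x in lborel. F x = h x"
    using gh
  proof eventually_elim
    case (elim x)
    have "0 \<le> h x" using \<Lambda> by (simp add: h_def)
    with elim show ?case by (auto simp: F_def h_def indicator_def)
  qed
  have "(\<integral>\<^sup>+y. ennreal (F y ^ ?n) \<partial>lborel) = (\<integral>\<^sup>+y. ennreal (h y ^ ?n) \<partial>lebesgue)"
    unfolding nn_integral_completion
    by (rule nn_integral_cong_AE) (use Fh in \<open>eventually_elim, simp\<close>)
  also have "\<dots> = (\<integral>\<^sup>+y. ennreal (1 / \<Lambda> ^ ?n) * (ennreal (norm (?E y)) ^ ?n * indicator \<Omega> y) \<partial>lebesgue)"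
  proof (rule nn_integral_cong)
    fix y
    have "h y ^ ?n = 1 / \<Lambda> ^ ?n * (norm (?E y) ^ ?n * indicator \<Omega> y)"
      by (simp add: h_def indicator_def power_divide)
    then show "ennreal (h y ^ ?n) = ennreal (1 / \<Lambda> ^ ?n) * (ennreal (norm (?E y)) ^ ?n * indicator \<Omega> y)"
      using \<Lambda> by (auto simp: ennreal_power ennreal_mult[symmetric] indicator_def)
  qed
  also have "\<dots> = ennreal (1 / \<Lambda> ^ ?n) * (\<integral>\<^sup>+y. ennreal (norm (?E y)) ^ ?n * indicator \<Omega> y \<partial>lebesgue)"
  proof (rule nn_integral_cmult)
    have "ennreal (norm (?E y)) ^ ?n * indicator \<Omega> y = ennreal (norm (indicator \<Omega> y *\<^sub>R ?E y)) ^ ?n" for y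
      by (auto simp: indicator_def)
    moreover have "(\<lambda>y. ennreal (norm (indicator \<Omega> y *\<^sub>R ?E y)) ^ ?n) \<in> borel_measurable lebesgue"
      using L1_loc_measurable[OF \<Omega> \<open>?E \<in> L1_loc \<Omega>\<close>] by measurable
    ultimately show "(\<lambda>y. ennreal (norm (?E y)) ^ ?n * indicator \<Omega> y) \<in> borel_measurable lebesgue"
      by (simp only:)
  qed
  also have "(\<integral>\<^sup>+y. ennreal (norm (?E y)) ^ ?n * indicator \<Omega> y \<partial>lebesgue)
      = (\<integral>\<^sup>+y. ennreal (norm (?E y)) ^ ?n \<partial>lebesgue_on \<Omega>)"
    using \<Omega> by (intro nn_integral_restrict_space[symmetric]) simp
  also have "\<dots> = sym_grad_norm (real ?n) \<Omega> u ^ ?n"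
    unfolding sym_grad_norm_def Lp_enorm_def by (simp add: epowr_of_nat epowr_inverse_power)
  also have "ennreal (1 / \<Lambda> ^ ?n) * \<dots> \<le> ennreal (1 / \<Lambda> ^ ?n) * ennreal \<Lambda> ^ ?n"
    by (intro mult_left_mono power_mono norm) auto
  also have "\<dots> = 1" using \<Lambda> by (simp add: ennreal_power ennreal_mult[symmetric])
  finally have int: "(\<integral>\<^sup>+y. ennreal (F y ^ ?n) \<partial>lborel) \<le> 1" .
  have "AE z in lebesgue. z \<in> \<Omega> \<longrightarrow> norm (?E z) \<le> \<Lambda> * F z"
    using AE_completion[OF Fh]
  proof eventually_elim
    case (elim z)
    then show ?case using \<Lambda> by (auto simp: h_def)
  qed
  moreover have "F y = 0" if "y \<notin> \<Omega>" for y using that by (simp add: F_def)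
  ultimately show thesis using F int by (intro that[of F])
qed

lemma C_b_measurable:
  fixes u :: "real^'n \<Rightarrow> real^'n"
  assumes u: "u \<in> C_b S" and T: "T \<subseteq> S" "T \<in> sets borel"
  shows "u \<in> borel_measurable (restrict_space borel T)" "{x \<in> T. t < norm (u x)} \<in> sets borel"
proof -
  have "continuous_on T u" using u T by (auto simp: C_b_def intro: continuous_on_subset)
  then show m[measurable]: "u \<in> borel_measurable (restrict_space borel T)"
    by (rule borel_measurable_continuous_on_restrict)
  have "{x \<in> space (restrict_space borel T). t < norm (u x)} \<in> sets (restrict_space borel T)"
    by measurable
  then show "{x \<in> T. t < norm (u x)} \<in> sets borel"
    using T(2) by (auto simp: sets_restrict_space_iff space_restrict_space)
qed

lemma emeasure_boundary_measure:
  "A \<in> sets borel \<Longrightarrow> A \<subseteq> frontier \<Omega> \<Longrightarrow>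
    emeasure (boundary_measure \<Omega>) A = hausdorff_outer (CARD('n) - 1) (A :: (real^'n) set)"
  unfolding boundary_measure_def by (simp add: emeasure_restrict_space emeasure_hausdorff)

lemma space_boundary_measure [simp]: "space (boundary_measure \<Omega>) = frontier \<Omega>"
  by (simp add: boundary_measure_def space_restrict_space)

text \<open>The measure \<open>\<mu>\<close> lives on \<open>\<Omega>\<close>, while kernels are
  centred at arbitrary points, in particular on the boundary. Its push-forward to the whole space
  obeys the growth condition at every centre, with the constant multiplied by
  \<open>2 powr \<alpha>\<close>: a ball that meets \<open>\<Omega>\<close> at \<open>x\<close> lies
  in the ball about \<open>x\<close> of twice the radius. \<open>A\<close> and
  \<open>\<kappa>\<close> stay free because the exponential estimate takes both to be 1 and the
  Lorentz-Zygmund estimate takes total masses.\<close>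

lemma rearrangement_estimate:
  fixes \<Omega> :: "(real^'n) set" and a :: "nat \<Rightarrow> real"
  assumes dim: "2 \<le> CARD('n)" and \<alpha>: "real CARD('n) - 1 < \<alpha>" and C\<mu>: "0 < C\<^sub>\<mu>"
    and V: "0 \<le> V" and M: "0 \<le> M" and A: "0 < A" and \<kappa>: "0 < \<kappa>"
    and \<Omega>: "open \<Omega>" and sets: "sets \<mu> = sets (restrict_space borel \<Omega>)"
    and growth: "\<forall>x\<in>\<Omega>. \<forall>r>0. emeasure \<mu> (ball x r \<inter> \<Omega>) \<le> ennreal (C\<^sub>\<mu> * r powr \<alpha>)"
    and vol: "emeasure lborel \<Omega> = ennreal V" and mass: "emeasure \<mu> \<Omega> = ennreal M"
    and u: "u \<in> E1 (real CARD('n)) \<Omega> \<inter> C_b (closure \<Omega>)"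
    and \<Lambda>: "0 < \<Lambda>" "sym_grad_norm (real CARD('n)) \<Omega> u \<le> ennreal \<Lambda>"
    and a: "\<And>j. 0 \<le> a j"
    and aH: "\<And>j. emeasure (boundary_measure \<Omega>) {y \<in> frontier \<Omega>. a j < norm (u y)} \<le> ennreal (A * (1/2) ^ j)"
  shows "\<exists>c. (\<forall>j. 0 \<le> c j) \<and> (\<Sum>j. ennreal (c j ^ CARD('n))) \<le> 1 \<and>
    (\<forall>t k. 0 \<le> t \<longrightarrow> ennreal (\<kappa> * (1/2) ^ k) \<le> emeasure \<mu> {x \<in> \<Omega>. t < norm (u x)} \<longrightarrow>
       ennreal t \<le> ennreal (key_const CARD('n) (C\<^sub>\<mu> * 2 powr \<alpha>) \<alpha> V M A \<kappa>) * level_bound \<Lambda> c a k)"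
proof -
  have K: "0 \<le> C\<^sub>\<mu> * 2 powr \<alpha>" using C\<mu> by simp
  have [measurable]: "\<Omega> \<in> sets borel" using \<Omega> by simp
  have sp: "space \<mu> = \<Omega>" using sets_eq_imp_space_eq[OF sets] by (simp add: space_restrict_space)
  have id: "(\<lambda>x. x) \<in> measurable \<mu> borel"
    unfolding measurable_cong_sets[OF sets refl] by (rule measurable_restrict_space1) simp
  define \<nu> where "\<nu> = distr \<mu> borel (\<lambda>x. x)"
  have \<nu>: "emeasure \<nu> B = emeasure \<mu> (B \<inter> \<Omega>)" if "B \<in> sets borel" for B
    using that id unfolding \<nu>_def by (subst emeasure_distr) (simp_all add: sp vimage_def Int_def)
  have \<nu>_growth: "emeasure \<nu> (ball y r) \<le> ennreal ((C\<^sub>\<mu> * 2 powr \<alpha>) * r powr \<alpha>)" if r: "0 < r" for y r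
  proof (cases "ball y r \<inter> \<Omega> = {}")
    case False
    then obtain x where x: "x \<in> \<Omega>" "dist y x < r" by auto
    have "emeasure \<nu> (ball y r) = emeasure \<mu> (ball y r \<inter> \<Omega>)" by (simp add: \<nu>)
    also have "\<dots> \<le> emeasure \<mu> (ball x (2 * r) \<inter> \<Omega>)"
    proof (rule emeasure_mono)
      show "ball y r \<inter> \<Omega> \<subseteq> ball x (2 * r) \<inter> \<Omega>"
      proof
        fix z assume "z \<in> ball y r \<inter> \<Omega>"
        then show "z \<in> ball x (2 * r) \<inter> \<Omega>"
          using x dist_triangle[of x z y] by (simp add: dist_commute)
      qed
      show "ball x (2 * r) \<inter> \<Omega> \<in> sets \<mu>" by (simp add: sets sets_restrict_space_iff)
    qed
    also have "\<dots> \<le> ennreal (C\<^sub>\<mu> * (2 * r) powr \<alpha>)" using growth x r by simp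
    finally show ?thesis using r by (simp add: powr_mult mult_ac)
  qed (simp add: \<nu>)
  obtain F where F: "F \<in> borel_measurable borel" "\<And>y. y \<notin> \<Omega> \<Longrightarrow> F y = 0"
    "AE z in lebesgue. z \<in> \<Omega> \<longrightarrow> norm (sym_grad \<Omega> u z) \<le> \<Lambda> * F z"
    "(\<integral>\<^sup>+y. ennreal (F y ^ CARD('n)) \<partial>lborel) \<le> 1"
    using sym_grad_borel_representative[OF \<Omega> _ \<Lambda>] u by blast
  have Y: "{y \<in> frontier \<Omega>. t < norm (u y)} \<in> sets borel" for t
    using u by (intro C_b_measurable[of u "closure \<Omega>"]) (auto simp: frontier_def)
  have H: "hausdorff_outer (CARD('n) - 1) {y \<in> frontier \<Omega>. a j < norm (u y)} \<le> ennreal (A * (1/2) ^ j)" for j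
    using aH[of j] emeasure_boundary_measure[OF Y[of "a j"]] by auto
  have G: "{x \<in> \<Omega>. t < norm (u x)} \<in> sets borel" for t
    using u closure_subset by (intro C_b_measurable[of u "closure \<Omega>"]) auto
  show ?thesis
  proof (intro exI[of _ "level_norm F"] conjI allI impI level_norm_nonneg)
    show "(\<Sum>j. ennreal (level_norm F j ^ CARD('n))) \<le> 1"
      using sum_level_norm_le[OF F(1)] F(4) by simp
  next
    fix t k
    assume t: "0 \<le> (t::real)" and k: "ennreal (\<kappa> * (1/2) ^ k) \<le> emeasure \<mu> {x \<in> \<Omega>. t < norm (u x)}"
    have "emeasure \<nu> {x \<in> \<Omega>. t < norm (u x)} = emeasure \<mu> {x \<in> \<Omega>. t < norm (u x)}"
      by (subst \<nu>[OF G]) (auto intro!: arg_cong[of _ _ "emeasure \<mu>"])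
    with k have k': "ennreal (\<kappa> * (1/2) ^ k) \<le> emeasure \<nu> {x \<in> \<Omega>. t < norm (u x)}" by simp
    have \<nu>_sets: "sets \<nu> = sets borel" by (simp add: \<nu>_def)
    have \<nu>_mass: "emeasure \<nu> UNIV \<le> ennreal M" using \<nu>[of UNIV] mass by simp
    have u': "u \<in> C_b (closure \<Omega>)" "u \<in> E1 (real CARD('n)) \<Omega>" using u by auto
    have vol': "emeasure lborel \<Omega> \<le> ennreal V" using vol by simp
    have G': "{x \<in> \<Omega>. t < norm (u x)} \<subseteq> \<Omega>" "x \<in> {x \<in> \<Omega>. t < norm (u x)} \<Longrightarrow> t \<le> norm (u x)" for x by auto
    show "ennreal t \<le> ennreal (key_const CARD('n) (C\<^sub>\<mu> * 2 powr \<alpha>) \<alpha> V M A \<kappa>) * level_bound \<Lambda> (level_norm F) a k"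
      by (rule key_estimate[OF dim K \<alpha> V M A \<kappa> \<Omega> \<nu>_sets \<nu>_growth \<nu>_mass vol' u'(1) E1_has_sym_grad[OF u'(2)]
            F(1,3,2) \<Lambda>(1) F(4) a H G G' t k'])
  qed
qed

section \<open>The exponential and the Lorentz--Zygmund estimates\<close>

text \<open>Convexity against the point 0. It gives monotonicity, and it lets a bound on the
  integral be traded for a larger scale in the Luxemburg norm.\<close>

lemma young_function_scale:
  assumes A: "young_function A" and t: "0 \<le> t" and \<theta>: "0 \<le> \<theta>" "\<theta> \<le> 1"
  shows "A (\<theta> * t) \<le> ennreal \<theta> * A t"
proof -
  from A have A0: "A 0 = 0" and conv: "\<And>s t \<theta>. 0 \<le> s \<Longrightarrow> 0 \<le> t \<Longrightarrow> \<theta> \<in> {0..1} \<Longrightarrow>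
      A (\<theta> * s + (1 - \<theta>) * t) \<le> ennreal \<theta> * A s + ennreal (1 - \<theta>) * A t"
    by (simp_all add: young_function_def)
  from conv[of t 0 \<theta>] t \<theta> show ?thesis by (simp add: A0)
qed

lemma young_function_mono:
  assumes A: "young_function A" and st: "0 \<le> s" "s \<le> t"
  shows "A s \<le> A t"
proof (cases "t = 0")
  case False
  then have "A (s / t * t) \<le> ennreal (s / t) * A t"
    using st by (intro young_function_scale[OF A]) (auto simp: divide_le_eq_1)
  also have "\<dots> \<le> 1 * A t"
    using False st by (intro mult_right_mono) (auto simp: ennreal_le_1 divide_le_eq_1)
  finally show ?thesis using False by simp
qed (use st in simp)

lemma exp_young_lower:
  assumes "exp_young \<sigma> B"
  shows "\<exists>k \<tau>. 0 < k \<and> 0 < \<tau> \<and> (\<forall>t\<ge>\<tau>. ennreal (exp ((t / k) powr \<sigma>) - 1) \<le> B t)"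
proof -
  obtain k where k: "1 \<le> k" "eventually (\<lambda>t. B (t / k) \<le> ennreal (exp (t powr \<sigma>) - 1) \<and> ennreal (exp (t powr \<sigma>) - 1) \<le> B (k * t)) at_top"
    using assms unfolding exp_young_def equivalent_near_infinity_def by blast
  then obtain T where T: "\<And>t. T \<le> t \<Longrightarrow> ennreal (exp (t powr \<sigma>) - 1) \<le> B (k * t)"
    unfolding eventually_at_top_linorder by blast
  show ?thesis
  proof (rule exI[of _ k], rule exI[of _ "k * max T 1"], intro conjI allI impI)
    fix t assume t: "k * max T 1 \<le> t"
    moreover have "k * T \<le> k * max T 1" using k by (intro mult_left_mono) auto
    ultimately have "k * T \<le> t" by linarith
    then have "T \<le> t / k" using k(1) by (simp add: field_simps)
    from T[OF this] show "ennreal (exp ((t / k) powr \<sigma>) - 1) \<le> B t" using k by simp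
  qed (use k in auto)
qed

text \<open>Below the threshold of the equivalence, monotonicity bounds \<open>A\<close> by a value
  above it, and \<open>P\<close> absorbs this. The bound thus holds for all arguments, as an
  integral over the whole space requires.\<close>

lemma exp_young_upper:
  assumes A: "exp_young \<sigma> A"
  shows "\<exists>k P. 0 < k \<and> 0 \<le> P \<and> (\<forall>t\<ge>0. A t \<le> ennreal (P + exp ((k * t) powr \<sigma>)))"
proof -
  have Y: "young_function A" using A by (simp add: exp_young_def)
  obtain k where k: "1 \<le> k" "eventually (\<lambda>t. A (t / k) \<le> ennreal (exp (t powr \<sigma>) - 1) \<and> ennreal (exp (t powr \<sigma>) - 1) \<le> A (k * t)) at_top"
    using A unfolding exp_young_def equivalent_near_infinity_def by blast
  then obtain T where T: "\<And>t. T \<le> t \<Longrightarrow> A (t / k) \<le> ennreal (exp (t powr \<sigma>) - 1)"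
    unfolding eventually_at_top_linorder by blast
  define \<tau> where "\<tau> = max T 1"
  define P where "P = max (exp (\<tau> powr \<sigma>) - 1) 0"
  show ?thesis
  proof (rule exI[of _ k], rule exI[of _ P], intro conjI allI impI)
    fix t :: real assume t: "0 \<le> t"
    show "A t \<le> ennreal (P + exp ((k * t) powr \<sigma>))"
    proof (cases "\<tau> \<le> k * t")
      case True
      then have "A (k * t / k) \<le> ennreal (exp ((k * t) powr \<sigma>) - 1)" by (intro T) (simp add: \<tau>_def)
      also have "\<dots> \<le> ennreal (P + exp ((k * t) powr \<sigma>))" by (intro ennreal_leI) (simp add: P_def)
      finally show ?thesis using k by simp
    next
      case False
      then have "t \<le> \<tau> / k" using k by (simp add: field_simps)
      then have "A t \<le> A (\<tau> / k)" using t by (intro young_function_mono[OF Y])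
      also have "\<dots> \<le> ennreal (exp (\<tau> powr \<sigma>) - 1)" by (intro T) (simp add: \<tau>_def)
      also have "\<dots> \<le> ennreal (P + exp ((k * t) powr \<sigma>))" by (intro ennreal_leI) (simp add: P_def add_increasing2)
      finally show ?thesis .
    qed
  qed (use k in \<open>auto simp: P_def\<close>)
qed

text \<open>Hoelder's inequality for \<open>k\<close> terms, from \<open>weighted_mean_le\<close>
  with \<open>y\<close> normalised by \<open>k * y ^ n = 1\<close>. This is the source of the
  exponent: sums of \<open>k\<close> level norms grow at most like
  \<open>k powr (1 / \<sigma>)\<close> with \<open>\<sigma> = n / (n - 1)\<close>.\<close>

lemma sum_le_powr:
  fixes c :: "nat \<Rightarrow> real"
  assumes n: "2 \<le> n" and c: "\<And>j. 0 \<le> c j" and sum: "(\<Sum>j. ennreal (c j ^ n)) \<le> 1"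
  shows "(\<Sum>j<k. c j) \<le> real k powr ((real n - 1) / real n)"
proof (cases "k = 0")
  case False
  obtain m where m: "n = Suc m" using n by (cases n) auto
  define y where "y = real k powr (- 1 / real n)"
  have y: "0 < y" using False by (simp add: y_def)
  have yn: "real k * y ^ n = 1"
  proof -
    have "y ^ n = real k powr (- 1 / real n * real n)"
      using y False by (simp only: powr_realpow[symmetric] y_def powr_powr)
    also have "- 1 / real n * real n = - 1" using n by simp
    finally show ?thesis using False by (simp add: powr_minus)
  qed
  have "ennreal (\<Sum>j<k. c j ^ n) \<le> 1"
    using order_trans[OF sum_le_suminf[OF summableI, of "{..<k}" "\<lambda>j. ennreal (c j ^ n)"] sum] c
    by (simp add: sum_ennreal)
  then have c1: "(\<Sum>j<k. c j ^ n) \<le> 1" by (simp add: ennreal_le_1)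
  have "real n * ((\<Sum>j<k. c j) * y ^ m) = (\<Sum>j<k. real n * (c j * y ^ m))"
    by (simp add: sum_distrib_left sum_distrib_right)
  also have "\<dots> \<le> (\<Sum>j<k. c j ^ n + real m * y ^ n)"
    unfolding m using c y by (intro sum_mono weighted_mean_le) auto
  also have "\<dots> = (\<Sum>j<k. c j ^ n) + real m * (real k * y ^ n)"
    by (simp add: sum.distrib mult_ac)
  also have "\<dots> \<le> real n" using c1 yn m by simp
  finally have "(\<Sum>j<k. c j) * y ^ m \<le> 1" using n by simp
  then have "(\<Sum>j<k. c j) \<le> 1 / y ^ m" using y by (simp add: field_simps)
  also have "1 / y ^ m = real k powr ((real n - 1) / real n)"
  proof -
    have "y ^ m = real k powr (- 1 / real n * real m)"
      using y False by (simp only: powr_realpow[symmetric] y_def powr_powr)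
    also have "- 1 / real n * real m = - ((real n - 1) / real n)" using m by simp
    finally show ?thesis by (simp add: powr_minus_divide)
  qed
  finally show ?thesis .
qed simp

lemma suminf_half_Suc_le: "(\<Sum>i. ennreal ((1/2) ^ i * real (Suc i))) \<le> ennreal 11"
proof -
  have "(1/2) ^ i * real (Suc i) \<le> 4 * (5/8) ^ i" for i
  proof -
    have "(1/2) ^ i * real (Suc i) \<le> (1/2) ^ i * (4 * (5/4) ^ i)"
      by (intro mult_left_mono Suc_le_geometric) simp
    also have "\<dots> = 4 * (5/8) ^ i" by (simp add: power_mult_distrib[symmetric])
    finally show ?thesis .
  qed
  then have "(\<Sum>i. ennreal ((1/2) ^ i * real (Suc i))) \<le> (\<Sum>i. ennreal (4 * (5/8) ^ i))"
    by (intro suminf_le ennreal_leI) auto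
  also have "\<dots> = ennreal (4 * (8/3))"
    using sums_mult[OF geometric_sums[of "5/8::real"], of 4] by (intro suminf_ennreal_eq) auto
  also have "\<dots> \<le> ennreal 11" by (intro ennreal_leI) simp
  finally show ?thesis .
qed

text \<open>\<open>Suc (k + i) \<le> Suc k * Suc i\<close> separates the indices, and
  \<open>p \<le> 1\<close> reduces the sum over \<open>i\<close> to
  \<open>suminf_half_Suc_le\<close>.\<close>

lemma tail_powr_le:
  assumes p: "0 \<le> p" "p \<le> 1" and l: "0 \<le> l"
  shows "(\<Sum>i. ennreal ((1/2) ^ i * (l * real (Suc (k + i)) powr p))) \<le> ennreal (11 * l * real (Suc k) powr p)"
proof -
  have "(1/2) ^ i * (l * real (Suc (k + i)) powr p) \<le> (l * real (Suc k) powr p) * ((1/2) ^ i * real (Suc i))" for i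
  proof -
    have "real (Suc (k + i)) \<le> real (Suc k) * real (Suc i)" by (simp add: algebra_simps)
    then have "real (Suc (k + i)) powr p \<le> (real (Suc k) * real (Suc i)) powr p"
      using p by (intro powr_mono2) auto
    also have "\<dots> = real (Suc k) powr p * real (Suc i) powr p" by (rule powr_mult)
    also have "real (Suc i) powr p \<le> real (Suc i) powr 1" using p by (intro powr_mono) auto
    finally have "real (Suc (k + i)) powr p \<le> real (Suc k) powr p * real (Suc i)"
      by (simp add: mult_left_mono)
    then have "((1/2) ^ i * l) * real (Suc (k + i)) powr p \<le> ((1/2) ^ i * l) * (real (Suc k) powr p * real (Suc i))"
      using l by (intro mult_left_mono) auto
    then show ?thesis by (simp add: mult_ac)
  qed
  then have "(\<Sum>i. ennreal ((1/2) ^ i * (l * real (Suc (k + i)) powr p)))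
      \<le> (\<Sum>i. ennreal ((l * real (Suc k) powr p) * ((1/2) ^ i * real (Suc i))))"
    by (intro suminf_le ennreal_leI) auto
  also have "\<dots> = (\<Sum>i. ennreal (l * real (Suc k) powr p) * ennreal ((1/2) ^ i * real (Suc i)))"
    using l by (intro suminf_cong ennreal_mult') simp
  also have "\<dots> = ennreal (l * real (Suc k) powr p) * (\<Sum>i. ennreal ((1/2) ^ i * real (Suc i)))"
    by (rule ennreal_suminf_cmult)
  also have "\<dots> \<le> ennreal (l * real (Suc k) powr p) * ennreal 11"
    by (intro mult_left_mono suminf_half_Suc_le) simp
  also have "\<dots> = ennreal (11 * l * real (Suc k) powr p)"
    using l by (subst ennreal_mult[symmetric]) (auto simp: mult_ac)
  finally show ?thesis .
qed

text \<open>With \<open>y = (norm (f x) / Z) powr \<sigma>\<close>, the scale \<open>L * Z\<close>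
  makes the exponent \<open>y / 2\<close>. The set where \<open>y > k + 1\<close> has measure at
  most \<open>(1/2) ^ k\<close>, so the integral is dominated by a geometric series of ratio
  \<open>q = exp (1/2) / 2\<close>; halving the exponent is what brings this ratio below 1.
  Convexity then reduces the bound \<open>W\<close> to 1 at the price of a factor \<open>W\<close>
  in the scale.\<close>

lemma exp_integral_bound:
  fixes f :: "'a \<Rightarrow> 'b::real_normed_vector"
  assumes meas: "\<And>t. {x \<in> space \<mu>. t < norm (f x)} \<in> sets \<mu>"
    and mass: "emeasure \<mu> (space \<mu>) = ennreal M" "0 \<le> M"
    and Z: "0 < Z" and \<sigma>: "0 < \<sigma>"
    and tail: "\<And>k. emeasure \<mu> {x \<in> space \<mu>. Z * real (Suc k) powr (1 / \<sigma>) < norm (f x)} \<le> ennreal ((1/2) ^ k)"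
    and A: "young_function A" and A_le: "\<And>t. 0 \<le> t \<Longrightarrow> A t \<le> ennreal (P + exp ((\<kappa> * t) powr \<sigma>))"
    and P: "0 \<le> P" and \<kappa>: "0 < \<kappa>"
  shows "luxemburg_norm A \<mu> f \<le> ennreal (\<kappa> * 2 powr (1 / \<sigma>) * ((P + 2) * M + 3 / (1 - exp (1/2) / 2) + 1) * Z)"
proof -
  let ?Y = "\<lambda>k. {x \<in> space \<mu>. Z * real (Suc k) powr (1 / \<sigma>) < norm (f x)}"
  define L where "L = \<kappa> * 2 powr (1 / \<sigma>)"
  have L: "0 < L" using \<kappa> by (simp add: L_def)
  define q where "q = exp (1/2 :: real) / 2"
  have e: "exp (1::real) \<le> 3" by (rule exp_le)
  have eh: "exp (1/2 :: real) < 2"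
  proof (rule power_less_imp_less_base)
    show "exp (1/2 :: real) ^ 2 < 2 ^ 2" using e by (simp add: exp_of_nat_mult[symmetric])
  qed simp
  have q: "0 < q" "q < 1" using eh by (auto simp: q_def)
  define W where "W = (P + 2) * M + 3 / (1 - q) + 1"
  have W: "1 \<le> W" using P mass q by (simp add: W_def)
  have ptw: "A (norm (f x) / (L * Z)) \<le> ennreal (P + 2) + (\<Sum>k. ennreal (exp (1 + real k / 2)) * indicator (?Y k) x)"
    if x: "x \<in> space \<mu>" for x
  proof -
    define y where "y = (norm (f x) / Z) powr \<sigma>"
    have "(\<kappa> * (norm (f x) / (L * Z))) powr \<sigma> = (norm (f x) / Z / 2 powr (1 / \<sigma>)) powr \<sigma>"
      using \<kappa> by (simp add: L_def mult.commute)
    also have "\<dots> = y / (2 powr (1 / \<sigma>)) powr \<sigma>"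
      using Z by (simp add: y_def powr_divide powr_mult)
    also have "(2 powr (1 / \<sigma>)) powr \<sigma> = (2::real)" using \<sigma> by (simp add: powr_powr)
    finally have eq: "(\<kappa> * (norm (f x) / (L * Z))) powr \<sigma> = y / 2" .
    have "0 \<le> norm (f x) / (L * Z)" using L Z by simp
    from A_le[OF this] have le: "A (norm (f x) / (L * Z)) \<le> ennreal (P + exp (y / 2))"
      unfolding eq .
    show ?thesis
    \<comment> \<open>The tail hypothesis speaks of \<open>y > 1\<close> only; below, the integrand
      is at most \<open>P + 2\<close>.\<close>
    proof (cases "y \<le> 1")
      case True
      then have "exp (y / 2) \<le> exp (1/2)" by simp
      then have "ennreal (P + exp (y / 2)) \<le> ennreal (P + 2)" using eh by (intro ennreal_leI) linarith
      with le show ?thesis by (intro add_increasing2) (auto intro: order_trans)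
    next
      case False
      define k where "k = nat \<lceil>y\<rceil> - 2"
      have k: "real (Suc k) < y" "y \<le> real k + 2"
        using False unfolding k_def by linarith+
      have "real (Suc k) powr (1 / \<sigma>) < y powr (1 / \<sigma>)"
        using k \<sigma> by (intro powr_less_mono2) auto
      also have "y powr (1 / \<sigma>) = norm (f x) / Z" using Z \<sigma> by (simp add: y_def powr_powr)
      finally have xY: "x \<in> ?Y k" using Z x by (simp add: field_simps)
      have "exp (y / 2) \<le> exp (1 + real k / 2)" using k by simp
      then have "ennreal (P + exp (y / 2)) \<le> ennreal ((P + 2) + exp (1 + real k / 2))"
        by (intro ennreal_leI) linarith
      also have "\<dots> = ennreal (P + 2) + ennreal (exp (1 + real k / 2))"
        using P by (intro ennreal_plus) auto
      also have "ennreal (exp (1 + real k / 2)) = ennreal (exp (1 + real k / 2)) * indicator (?Y k) x"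
        using xY by simp
      also have "\<dots> \<le> (\<Sum>k. ennreal (exp (1 + real k / 2)) * indicator (?Y k) x)"
        using sum_le_suminf[OF summableI, of "{k}" "\<lambda>k. ennreal (exp (1 + real k / 2)) * indicator (?Y k) x"]
        by (simp del: sum_mult_indicator)
      finally have "ennreal (P + exp (y / 2)) \<le> ennreal (P + 2) + (\<Sum>k. ennreal (exp (1 + real k / 2)) * indicator (?Y k) x)"
        by (simp only: add_left_mono)
      with le show ?thesis by (rule order_trans)
    qed
  qed
  have int: "(\<integral>\<^sup>+x. ennreal (P + 2) + (\<Sum>k. ennreal (exp (1 + real k / 2)) * indicator (?Y k) x) \<partial>\<mu>) \<le> ennreal W"
  proof -
    have "(\<integral>\<^sup>+x. ennreal (P + 2) + (\<Sum>k. ennreal (exp (1 + real k / 2)) * indicator (?Y k) x) \<partial>\<mu>)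
       = (\<integral>\<^sup>+x. ennreal (P + 2) \<partial>\<mu>) + (\<integral>\<^sup>+x. (\<Sum>k. ennreal (exp (1 + real k / 2)) * indicator (?Y k) x) \<partial>\<mu>)"
      by (intro nn_integral_add borel_measurable_const borel_measurable_suminf_order
          borel_measurable_times_ennreal borel_measurable_indicator meas)
    also have "(\<integral>\<^sup>+x. (\<Sum>k. ennreal (exp (1 + real k / 2)) * indicator (?Y k) x) \<partial>\<mu>)
       = (\<Sum>k. \<integral>\<^sup>+x. ennreal (exp (1 + real k / 2)) * indicator (?Y k) x \<partial>\<mu>)"
      by (intro nn_integral_suminf borel_measurable_times_ennreal borel_measurable_const borel_measurable_indicator meas)
    also have "\<dots> = (\<Sum>k. ennreal (exp (1 + real k / 2)) * emeasure \<mu> (?Y k))"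
      by (intro suminf_cong nn_integral_cmult_indicator meas)
    also have "\<dots> \<le> (\<Sum>k. ennreal (exp 1 * q ^ k))"
    proof (intro suminf_le summableI)
      fix k
      have "ennreal (exp (1 + real k / 2)) * emeasure \<mu> (?Y k) \<le> ennreal (exp (1 + real k / 2)) * ennreal ((1/2) ^ k)"
        by (intro mult_left_mono tail) simp
      also have "\<dots> = ennreal (exp (1 + real k / 2) * (1/2) ^ k)" by (rule ennreal_mult'[symmetric]) simp
      also have "exp (1 + real k / 2) * (1/2) ^ k = exp 1 * q ^ k"
        by (simp add: q_def exp_add power_divide exp_of_nat_mult[symmetric])
      finally show "ennreal (exp (1 + real k / 2)) * emeasure \<mu> (?Y k) \<le> ennreal (exp 1 * q ^ k)" .
    qed
    also have "\<dots> = ennreal (exp 1 * (1 / (1 - q)))"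
      using q sums_mult[OF geometric_sums[of q], of "exp 1"] by (intro suminf_ennreal_eq) auto
    also have "\<dots> \<le> ennreal (3 / (1 - q))"
      using q e by (intro ennreal_leI) (simp add: divide_right_mono)
    also have "(\<integral>\<^sup>+x. ennreal (P + 2) \<partial>\<mu>) = ennreal ((P + 2) * M)"
      using P unfolding nn_integral_const mass(1) by (intro ennreal_mult'[symmetric]) simp
    also have "ennreal ((P + 2) * M) + ennreal (3 / (1 - q)) = ennreal ((P + 2) * M + 3 / (1 - q))"
      using P mass q by (intro ennreal_plus[symmetric]) auto
    also have "\<dots> \<le> ennreal W" by (intro ennreal_leI) (simp add: W_def)
    finally show ?thesis by (simp add: add_left_mono)
  qed
  have "(\<integral>\<^sup>+x. A (norm (f x) / (L * Z * W)) \<partial>\<mu>)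
     \<le> (\<integral>\<^sup>+x. ennreal (1 / W) * (ennreal (P + 2) + (\<Sum>k. ennreal (exp (1 + real k / 2)) * indicator (?Y k) x)) \<partial>\<mu>)"
  proof (rule nn_integral_mono)
    fix x assume x: "x \<in> space \<mu>"
    have "A (norm (f x) / (L * Z * W)) = A (1 / W * (norm (f x) / (L * Z)))" by (simp add: mult.commute)
    also have "\<dots> \<le> ennreal (1 / W) * A (norm (f x) / (L * Z))"
      using L Z W by (intro young_function_scale[OF A]) auto
    also have "\<dots> \<le> ennreal (1 / W) * (ennreal (P + 2) + (\<Sum>k. ennreal (exp (1 + real k / 2)) * indicator (?Y k) x))"
      by (intro mult_left_mono ptw[OF x]) simp
    finally show "A (norm (f x) / (L * Z * W)) \<le> \<dots>" .
  qed
  also have "\<dots> = ennreal (1 / W) * (\<integral>\<^sup>+x. ennreal (P + 2) + (\<Sum>k. ennreal (exp (1 + real k / 2)) * indicator (?Y k) x) \<partial>\<mu>)"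
    by (intro nn_integral_cmult borel_measurable_add borel_measurable_const borel_measurable_suminf_order
          borel_measurable_times_ennreal borel_measurable_indicator meas)
  also have "\<dots> \<le> ennreal (1 / W) * ennreal W" by (intro mult_left_mono int) simp
  also have "\<dots> = 1" using W by (subst ennreal_mult[symmetric]) auto
  finally have "(\<integral>\<^sup>+x. A (norm (f x) / (L * Z * W)) \<partial>\<mu>) \<le> 1" .
  then have "luxemburg_norm A \<mu> f \<le> ennreal (L * Z * W)"
    unfolding luxemburg_norm_def using L Z W by (intro Inf_lower) auto
  then show ?thesis by (simp add: L_def W_def q_def mult_ac)
qed

text \<open>The estimates are proved for positive real bounds of the two norms, either of which may
  be 0; a small slack recovers the norms. For infinite \<open>b\<close> the claim needs
  \<open>max 1 C\<close> to be positive, since \<open>0 * top\<close> is 0.\<close>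

lemma ennreal_le_of_approx:
  fixes x s b :: ennreal
  assumes C: "0 \<le> C"
    and le: "\<And>\<Lambda> l. 0 < \<Lambda> \<Longrightarrow> s \<le> ennreal \<Lambda> \<Longrightarrow> b \<le> ennreal l \<Longrightarrow> 0 < l \<Longrightarrow> x \<le> ennreal (C * (\<Lambda> + l))"
    and s: "s < top"
  shows "x \<le> ennreal (max 1 C) * (s + b)"
proof (cases b)
  case (real b')
  obtain s' where s': "s = ennreal s'" "0 \<le> s'" using s by (cases s) auto
  have "x \<le> ennreal (C * (s' + b'))"
  proof (rule ennreal_le_epsilon)
    fix e :: real assume e: "0 < e"
    define d where "d = e / (2 * (C + 1))"
    have d: "0 < d" "C * (2 * d) \<le> e" using e C by (auto simp: d_def field_simps)
    have "x \<le> ennreal (C * ((s' + d) + (b' + d)))"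
      using s' real d by (intro le ennreal_leI) (auto intro: add_nonneg_pos ennreal_leI)
    also have "C * ((s' + d) + (b' + d)) \<le> C * (s' + b') + e"
      using d(2) by (simp add: algebra_simps)
    also have "ennreal (C * (s' + b') + e) = ennreal (C * (s' + b')) + ennreal e"
      using C s' real e by (intro ennreal_plus) auto
    finally show "x \<le> ennreal (C * (s' + b')) + ennreal e" by (simp add: ennreal_leI)
  qed
  also have "\<dots> \<le> ennreal (max 1 C * (s' + b'))"
    using s' real by (intro ennreal_leI mult_right_mono) auto
  also have "\<dots> = ennreal (max 1 C) * (s + b)"
    using s' real by (simp add: ennreal_mult)
  finally show ?thesis .
qed (simp add: ennreal_mult_top)

lemma borel_sets_restrict: "open \<Omega> \<Longrightarrow> A \<in> sets borel \<Longrightarrow> A \<subseteq> \<Omega> \<Longrightarrow> A \<in> sets (restrict_space borel \<Omega>)"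
  by (simp add: sets_restrict_space_iff)

text \<open>The boundary norm enters by Chebyshev's inequality: where
  \<open>norm (u y) > a j\<close>, the value of \<open>B\<close> at \<open>norm (u y) / l\<close> is
  at least \<open>2 ^ j\<close>. With levels \<open>a j\<close> of order
  \<open>Suc j powr p\<close>, the rearrangement at \<open>(1/2) ^ k\<close> is at most of order
  \<open>Suc k powr p\<close>, which is the tail condition of
  \<open>exp_integral_bound\<close>.\<close>

lemma exp_orlicz_estimate:
  fixes A B :: "real \<Rightarrow> ennreal"
  assumes dim: "2 \<le> CARD('n::finite)" and \<alpha>: "real CARD('n) - 1 < \<alpha>" and C\<mu>: "0 < C\<^sub>\<mu>"
    and V: "0 \<le> V" and M: "0 \<le> M"
    and AY: "exp_young (real CARD('n) / (real CARD('n) - 1)) A"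
    and BY: "exp_young (real CARD('n) / (real CARD('n) - 1)) B"
  shows "\<exists>C::real. 0 < C \<and> (\<forall>(\<Omega>::(real^'n) set) \<mu> u.
      open \<Omega> \<longrightarrow> sets \<mu> = sets (restrict_space borel \<Omega>) \<longrightarrow>
      (\<forall>x\<in>\<Omega>. \<forall>r>0. emeasure \<mu> (ball x r \<inter> \<Omega>) \<le> ennreal (C\<^sub>\<mu> * r powr \<alpha>)) \<longrightarrow>
      emeasure lborel \<Omega> = ennreal V \<longrightarrow> emeasure \<mu> \<Omega> = ennreal M \<longrightarrow>
      u \<in> E1 (real CARD('n)) \<Omega> \<inter> C_b (closure \<Omega>) \<longrightarrow>
      luxemburg_norm A \<mu> u
        \<le> ennreal C * (sym_grad_norm (real CARD('n)) \<Omega> u + luxemburg_norm B (boundary_measure \<Omega>) u))"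
proof -
  define n where "n = CARD('n)"
  define \<sigma> where "\<sigma> = real n / (real n - 1)"
  define p where "p = (real n - 1) / real n"
  have n: "2 \<le> n" using dim by (simp add: n_def)
  have \<sigma>: "0 < \<sigma>" "1 / \<sigma> = p" and p: "0 < p" "p \<le> 1" using n by (auto simp: \<sigma>_def p_def field_simps)
  obtain k0 \<tau> where k0: "0 < k0" and \<tau>: "0 < \<tau>" and B: "\<forall>t\<ge>\<tau>. ennreal (exp ((t / k0) powr \<sigma>) - 1) \<le> B t"
    using exp_young_lower[OF BY] unfolding \<sigma>_def n_def by blast
  obtain k1 P where k1: "0 < k1" and P: "0 \<le> P" and A: "\<forall>t\<ge>0. A t \<le> ennreal (P + exp ((k1 * t) powr \<sigma>))"
    using exp_young_upper[OF AY] unfolding \<sigma>_def n_def by blast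
  define C1 where "C1 = max 1 (key_const CARD('n) (C\<^sub>\<mu> * 2 powr \<alpha>) \<alpha> V M 1 1)"
  \<comment> \<open>The factor 2 makes the contradiction in \<open>tail\<close> strict, 4 bounds
    \<open>1 + w + 2\<close> by \<open>4 * w\<close> for \<open>w \<ge> 1\<close>, and 11 is the
    constant of \<open>tail_powr_le\<close>.\<close>
  define C2 where "C2 = 2 * C1 * (4 + 11 * (\<tau> + k0))"
  have C1: "1 \<le> C1" "key_const CARD('n) (C\<^sub>\<mu> * 2 powr \<alpha>) \<alpha> V M 1 1 \<le> C1" by (auto simp: C1_def)
  have C2: "0 < C2" using C1(1) \<tau> k0 by (simp add: C2_def add_pos_pos)
  define C3 where "C3 = k1 * 2 powr (1 / \<sigma>) * ((P + 2) * M + 3 / (1 - exp (1/2) / 2) + 1) * C2"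
  show ?thesis
  proof (intro exI[of _ "max 1 C3"] conjI allI impI)
    fix \<Omega> :: "(real^'n) set" and \<mu> u
    assume \<Omega>: "open \<Omega>" and sets: "sets \<mu> = sets (restrict_space borel \<Omega>)"
      and growth: "\<forall>x\<in>\<Omega>. \<forall>r>0. emeasure \<mu> (ball x r \<inter> \<Omega>) \<le> ennreal (C\<^sub>\<mu> * r powr \<alpha>)"
      and vol: "emeasure lborel \<Omega> = ennreal V" and mass: "emeasure \<mu> \<Omega> = ennreal M"
      and u: "u \<in> E1 (real CARD('n)) \<Omega> \<inter> C_b (closure \<Omega>)"
    let ?s = "sym_grad_norm (real CARD('n)) \<Omega> u" and ?H = "boundary_measure \<Omega>"
    have sp: "space \<mu> = \<Omega>" using sets_eq_imp_space_eq[OF sets] by (simp add: space_restrict_space)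
    have G: "{x \<in> space \<mu>. t < norm (u x)} \<in> sets \<mu>" for t
      unfolding sp sets using u closure_subset \<Omega>
      by (intro borel_sets_restrict C_b_measurable[of u "closure \<Omega>"]) auto
    have Yb: "{y \<in> frontier \<Omega>. t < norm (u y)} \<in> sets borel" for t
      using u by (intro C_b_measurable[of u "closure \<Omega>"]) (auto simp: frontier_def)
    then have Y: "{y \<in> frontier \<Omega>. t < norm (u y)} \<in> sets ?H" for t
      unfolding boundary_measure_def by (simp add: sets_restrict_space_iff)
    have main: "luxemburg_norm A \<mu> u \<le> ennreal (C3 * (\<Lambda> + l))"
      if \<Lambda>: "0 < \<Lambda>" "?s \<le> ennreal \<Lambda>" and l: "0 < l" "(\<integral>\<^sup>+y. B (norm (u y) / l) \<partial>?H) \<le> 1" for \<Lambda> l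
    proof -
      \<comment> \<open>The summand \<open>\<tau>\<close> keeps the argument of \<open>B\<close> in
        the range of its lower bound, and \<open>k0\<close> cancels the dilation inside the
        exponential.\<close>
      define a where "a j = l * (\<tau> + k0) * real (Suc j) powr p" for j
      have a0: "0 \<le> a j" for j using l \<tau> k0 by (simp add: a_def)
      have aH: "emeasure ?H {y \<in> frontier \<Omega>. a j < norm (u y)} \<le> ennreal (1 * (1/2) ^ j)" for j
      proof -
        let ?Y = "{y \<in> frontier \<Omega>. a j < norm (u y)}"
        have "ennreal (2 ^ j) * emeasure ?H ?Y = (\<integral>\<^sup>+y. ennreal (2 ^ j) * indicator ?Y y \<partial>?H)"
          by (rule nn_integral_cmult_indicator[OF Y, symmetric])
        also have "\<dots> \<le> (\<integral>\<^sup>+y. B (norm (u y) / l) \<partial>?H)"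
        proof (rule nn_integral_mono)
          fix y
          show "ennreal (2 ^ j) * indicator ?Y y \<le> B (norm (u y) / l)"
          proof (cases "y \<in> ?Y")
            case True
            define t where "t = norm (u y) / l"
            have t: "(\<tau> + k0) * real (Suc j) powr p < t"
              using True l by (simp add: a_def t_def field_simps)
            have one: "1 \<le> real (Suc j) powr p" using p by (intro ge_one_powr_ge_zero) auto
            have "\<tau> * 1 \<le> \<tau> * real (Suc j) powr p" using \<tau> one by (intro mult_left_mono) auto
            moreover have "0 \<le> k0 * real (Suc j) powr p" using k0 by simp
            ultimately have t\<tau>: "\<tau> \<le> t" using t by (simp add: distrib_right)
            have "0 \<le> \<tau> * real (Suc j) powr p" using \<tau> by simp
            then have "k0 * real (Suc j) powr p \<le> t" using t by (simp add: distrib_right)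
            then have "real (Suc j) powr p \<le> t / k0" using k0 by (simp add: field_simps)
            then have "(real (Suc j) powr p) powr \<sigma> \<le> (t / k0) powr \<sigma>"
              using \<sigma> by (intro powr_mono2) auto
            moreover have "(real (Suc j) powr p) powr \<sigma> = real (Suc j)"
              using \<sigma> by (simp add: powr_powr \<sigma>(2)[symmetric])
            ultimately have "exp (real (Suc j)) \<le> exp ((t / k0) powr \<sigma>)" by simp
            \<comment> \<open>The spare power of 2 absorbs the subtracted 1:
              \<open>2 ^ Suc j - 1 \<ge> 2 ^ j\<close>.\<close>
            moreover have "(2::real) ^ Suc j \<le> exp 1 ^ Suc j"
              using exp_ge_add_one_self[of 1] by (intro power_mono) auto
            then have "(2::real) ^ Suc j \<le> exp (real (Suc j))" by (simp add: exp_of_nat_mult[symmetric] del: power_Suc)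
            moreover have "(1::real) \<le> 2 ^ j" by simp
            moreover have "(2::real) ^ Suc j = 2 ^ j + 2 ^ j" by simp
            ultimately have "2 ^ j \<le> exp ((t / k0) powr \<sigma>) - 1" by linarith
            then have "ennreal (2 ^ j) \<le> ennreal (exp ((t / k0) powr \<sigma>) - 1)" by (rule ennreal_leI)
            also have "\<dots> \<le> B t" using B t\<tau> by blast
            finally have "ennreal (2 ^ j) \<le> B t" .
            then show ?thesis using True by (simp add: t_def)
          qed simp
        qed
        also note l(2)
        finally have "ennreal ((1/2) ^ j) * (ennreal (2 ^ j) * emeasure ?H ?Y) \<le> ennreal ((1/2) ^ j) * 1"
          by (rule mult_left_mono) simp
        moreover have "ennreal ((1/2) ^ j) * ennreal (2 ^ j) = 1"
          by (simp add: ennreal_mult[symmetric] power_mult_distrib[symmetric])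
        ultimately show ?thesis by (simp add: mult.assoc[symmetric])
      qed
      obtain c where c0: "\<forall>j. 0 \<le> c j" and c1: "(\<Sum>j. ennreal (c j ^ CARD('n))) \<le> 1"
        and est: "\<forall>t k. 0 \<le> t \<longrightarrow> ennreal (1 * (1/2) ^ k) \<le> emeasure \<mu> {x \<in> \<Omega>. t < norm (u x)} \<longrightarrow>
         ennreal t \<le> ennreal (key_const CARD('n) (C\<^sub>\<mu> * 2 powr \<alpha>) \<alpha> V M 1 1) * level_bound \<Lambda> c a k"
        using rearrangement_estimate[OF dim \<alpha> C\<mu> V M zero_less_one zero_less_one \<Omega> sets growth vol mass u \<Lambda> a0 aH]
        by blast
      note c0 = c0[rule_format]
      have c1': "(\<Sum>j. ennreal (c j ^ n)) \<le> 1" using c1 by (simp add: n_def)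
      have cle: "c j \<le> 1" for j
      proof -
        have "ennreal (c j ^ n) \<le> (\<Sum>j. ennreal (c j ^ n))"
          using sum_le_suminf[OF summableI, of "{j}" "\<lambda>j. ennreal (c j ^ n)"] by simp
        with c1' have "c j ^ n \<le> 1" by (meson order_trans ennreal_le_1)
        then show ?thesis using power_le_one_iff[OF c0, of j n] n by auto
      qed
      define Z where "Z = C2 * (\<Lambda> + l)"
      have Z: "0 < Z" using C2 \<Lambda> l by (simp add: Z_def)
      have tail: "emeasure \<mu> {x \<in> space \<mu>. Z * real (Suc k) powr (1 / \<sigma>) < norm (u x)} \<le> ennreal ((1/2) ^ k)" for k
      proof (rule ccontr)
        let ?w = "real (Suc k) powr p"
        have w: "1 \<le> ?w" using p by (intro ge_one_powr_ge_zero) auto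
        assume "\<not> ?thesis"
        then have "ennreal (1 * (1/2) ^ k) \<le> emeasure \<mu> {x \<in> \<Omega>. Z * ?w < norm (u x)}"
          unfolding sp \<sigma>(2) by simp
        then have "ennreal (Z * ?w) \<le> ennreal (key_const CARD('n) (C\<^sub>\<mu> * 2 powr \<alpha>) \<alpha> V M 1 1) * level_bound \<Lambda> c a k"
          using Z by (intro est[rule_format]) auto
        also have "\<dots> \<le> ennreal C1 * (ennreal \<Lambda> * ennreal (4 * ?w) + ennreal (11 * (l * (\<tau> + k0)) * ?w))"
        proof (intro mult_mono add_mono mult_left_mono ennreal_leI C1(2))
          have s1: "(\<Sum>j<k. ennreal (c j)) \<le> ennreal ?w"
          proof -
            have "(\<Sum>j<k. ennreal (c j)) = ennreal (\<Sum>j<k. c j)" using c0 by (intro sum_ennreal) auto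
            also have "\<dots> \<le> ennreal (real k powr p)"
              unfolding p_def by (intro ennreal_leI sum_le_powr n c0 c1')
            also have "\<dots> \<le> ennreal ?w" using p by (intro ennreal_leI powr_mono2) auto
            finally show ?thesis .
          qed
          have "(half_tail c k) \<le> (\<Sum>i. ennreal ((1/2) ^ i))"
            using cle c0 by (intro suminf_le ennreal_leI) (auto intro: mult_left_le)
          also have "\<dots> = ennreal 2"
            using geometric_sums[of "1/2::real"] by (intro suminf_ennreal_eq) auto
          finally have "1 + (\<Sum>j<k. ennreal (c j)) + (half_tail c k) \<le> ennreal 1 + ennreal ?w + ennreal 2"
            using s1 by (intro add_mono) auto
          also have "\<dots> = ennreal (1 + ?w + 2)"
            by (simp only: ennreal_plus[of "1 + ?w" 2] ennreal_plus[of 1 ?w] add_nonneg_nonneg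
                zero_le_one zero_le_numeral powr_ge_zero)
          also have "\<dots> \<le> ennreal (4 * ?w)" using w by (intro ennreal_leI) linarith
          finally show "1 + (\<Sum>j<k. ennreal (c j)) + (half_tail c k) \<le> ennreal (4 * ?w)" .
          show "(half_tail a k) \<le> ennreal (11 * (l * (\<tau> + k0)) * ?w)"
            unfolding a_def using p l \<tau> k0 by (intro tail_powr_le) auto
        qed auto
        also have "\<dots> = ennreal (C1 * (\<Lambda> * (4 * ?w) + 11 * (l * (\<tau> + k0)) * ?w))"
          using C1(1) \<Lambda> l \<tau> k0 by (simp add: ennreal_mult[symmetric] ennreal_plus[symmetric] del: ennreal_plus)
        finally have "Z * ?w \<le> C1 * (\<Lambda> * (4 * ?w) + 11 * (l * (\<tau> + k0)) * ?w)"
          using C1(1) \<Lambda> l \<tau> k0 by (subst (asm) ennreal_le_iff) auto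
        also have "\<dots> = C1 * (\<Lambda> * 4 + l * (11 * (\<tau> + k0))) * ?w" by (simp add: algebra_simps)
        finally have "Z \<le> C1 * (\<Lambda> * 4 + l * (11 * (\<tau> + k0)))" using w by simp
        also have "\<dots> \<le> C1 * (\<Lambda> * (4 + 11 * (\<tau> + k0)) + l * (4 + 11 * (\<tau> + k0)))"
          using C1(1) \<Lambda> l \<tau> k0 by (intro mult_left_mono add_mono) auto
        also have "\<dots> = Z / 2" by (simp add: Z_def C2_def algebra_simps)
        finally show False using Z by simp
      qed
      have "luxemburg_norm A \<mu> u \<le> ennreal (k1 * 2 powr (1 / \<sigma>) * ((P + 2) * M + 3 / (1 - exp (1/2) / 2) + 1) * Z)"
        using AY mass M sp by (intro exp_integral_bound[OF G _ _ Z \<sigma>(1) tail _ A[rule_format] P k1]) (auto simp: exp_young_def)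
      then show ?thesis by (simp add: Z_def C3_def mult.assoc)
    qed
    have sfin: "?s < top" using u by (simp add: E1_def)
    have C3: "0 \<le> C3"
    proof -
      have "exp (1/2 :: real) ^ 2 = exp 1" by (simp add: exp_of_nat_mult[symmetric])
      also have "\<dots> \<le> 2 ^ 2" using exp_le by simp
      finally have "exp (1/2 :: real) \<le> 2" by (rule power2_le_imp_le) simp
      then show ?thesis using k1 P M C2 unfolding C3_def
        by (intro mult_nonneg_nonneg add_nonneg_nonneg divide_nonneg_nonneg) auto
    qed
    show "luxemburg_norm A \<mu> u \<le> ennreal (max 1 C3) * (?s + luxemburg_norm B ?H u)"
    proof (rule ennreal_le_of_approx[OF C3 _ sfin])
      fix \<Lambda> l :: real
      assume \<Lambda>: "0 < \<Lambda>" "?s \<le> ennreal \<Lambda>" and l: "luxemburg_norm B ?H u \<le> ennreal l" "0 < l"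
      show "luxemburg_norm A \<mu> u \<le> ennreal (C3 * (\<Lambda> + l))"
      proof (rule ennreal_le_epsilon)
        fix e :: real assume e: "0 < e"
        \<comment> \<open>The infimum in the boundary norm need not be attained; \<open>d\<close> is
          the slack for choosing \<open>l'\<close>.\<close>
        define d where "d = e / (C3 + 1)"
        have d: "0 < d" "C3 * d \<le> e" using e C3 by (auto simp: d_def field_simps)
        have "luxemburg_norm B ?H u < ennreal (l + d)"
          using l d by (intro le_less_trans[OF l(1)] ennreal_lessI) auto
        then obtain l' where l': "ennreal l' < ennreal (l + d)" "0 < l'" "(\<integral>\<^sup>+y. B (norm (u y) / l') \<partial>?H) \<le> 1"
          unfolding luxemburg_norm_def Inf_less_iff by blast
        then have "l' < l + d" using ennreal_less_iff[of l' "l + d"] by (simp del: ennreal_plus)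
        have "luxemburg_norm A \<mu> u \<le> ennreal (C3 * (\<Lambda> + l'))" by (rule main[OF \<Lambda> l'(2,3)])
        also have "\<dots> \<le> ennreal (C3 * (\<Lambda> + l) + e)"
        proof (rule ennreal_leI)
          have "C3 * (\<Lambda> + l') \<le> C3 * (\<Lambda> + (l + d))" using \<open>l' < l + d\<close> C3 by (intro mult_left_mono) auto
          then show "C3 * (\<Lambda> + l') \<le> C3 * (\<Lambda> + l) + e" using d(2) by (simp add: algebra_simps)
        qed
        also have "\<dots> = ennreal (C3 * (\<Lambda> + l)) + ennreal e"
          using C3 \<Lambda> l e by (intro ennreal_plus) auto
        finally show "luxemburg_norm A \<mu> u \<le> ennreal (C3 * (\<Lambda> + l)) + ennreal e" .
      qed
    qed
  qed simp
qed

section \<open>Rearrangements and the Lorentz-Zygmund estimate\<close>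

text \<open>The superlevel sets above \<open>d + 1 / Suc k\<close> increase to the one above
  \<open>d\<close>, so continuity from below shows that the infimum is attained.\<close>

lemma decreasing_rearrangement_attained:
  fixes f :: "'a \<Rightarrow> 'b::real_normed_vector"
  assumes meas: "\<And>t. {x \<in> space \<mu>. t < norm (f x)} \<in> sets \<mu>"
    and fin: "decreasing_rearrangement \<mu> f s < top"
  shows "emeasure \<mu> {x \<in> space \<mu>. enn2real (decreasing_rearrangement \<mu> f s) < norm (f x)} \<le> ennreal s"
proof -
  define d where "d = enn2real (decreasing_rearrangement \<mu> f s)"
  have d: "decreasing_rearrangement \<mu> f s = ennreal d" "0 \<le> d" using fin by (simp_all add: d_def)
  define Y where "Y k = {x \<in> space \<mu>. d + 1 / real (Suc k) < norm (f x)}" for k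
  have "{x \<in> space \<mu>. d < norm (f x)} = (\<Union>k. Y k)"
  proof (intro equalityI subsetI)
    fix x assume x: "x \<in> {x \<in> space \<mu>. d < norm (f x)}"
    then obtain k where "1 / real (Suc k) < norm (f x) - d"
      using nat_approx_posE[of "norm (f x) - d"] by auto
    then have "x \<in> Y k" using x by (simp add: Y_def)
    then show "x \<in> (\<Union>k. Y k)" by blast
  next
    fix x assume "x \<in> (\<Union>k. Y k)"
    then obtain k where "x \<in> Y k" by blast
    then have "x \<in> space \<mu>" "d + 1 / real (Suc k) < norm (f x)" by (simp_all add: Y_def)
    moreover have "0 < 1 / real (Suc k)" by simp
    ultimately have "x \<in> space \<mu>" "d < norm (f x)" by linarith+
    then show "x \<in> {x \<in> space \<mu>. d < norm (f x)}" by simp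
  qed
  moreover have "incseq Y"
  proof (rule monoI)
    fix j k :: nat assume "j \<le> k"
    then have "1 / real (Suc k) \<le> 1 / real (Suc j)" by (intro divide_left_mono) auto
    then show "Y j \<subseteq> Y k" by (auto simp: Y_def simp del: of_nat_Suc)
  qed
  moreover have "range Y \<subseteq> sets \<mu>" using meas by (auto simp: Y_def)
  ultimately have "emeasure \<mu> {x \<in> space \<mu>. d < norm (f x)} = (SUP k. emeasure \<mu> (Y k))"
    by (simp only: SUP_emeasure_incseq)
  also have "\<dots> \<le> ennreal s"
  proof (rule SUP_least)
    fix k
    have "decreasing_rearrangement \<mu> f s < ennreal (d + 1 / real (Suc k))"
      unfolding d(1) using d(2) by (intro ennreal_lessI) (auto intro: add_nonneg_pos)
    then obtain t where t: "0 \<le> t" "emeasure \<mu> {x \<in> space \<mu>. t < norm (f x)} \<le> ennreal s"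
      "ennreal t < ennreal (d + 1 / real (Suc k))"
      unfolding decreasing_rearrangement_def Inf_less_iff by blast
    have "t < d + 1 / real (Suc k)" using t ennreal_less_iff[of t "d + 1 / real (Suc k)"] by (simp del: ennreal_plus of_nat_Suc)
    then have "Y k \<subseteq> {x \<in> space \<mu>. t < norm (f x)}" by (auto simp: Y_def simp del: of_nat_Suc)
    then have "emeasure \<mu> (Y k) \<le> emeasure \<mu> {x \<in> space \<mu>. t < norm (f x)}" by (intro emeasure_mono meas)
    with t(2) show "emeasure \<mu> (Y k) \<le> ennreal s" by (rule order_trans[rotated])
  qed
  finally show ?thesis by (simp add: d_def)
qed

lemma decreasing_rearrangement_leI:
  fixes f :: "'a \<Rightarrow> 'b::real_normed_vector"
  assumes "\<And>t. 0 \<le> t \<Longrightarrow> ennreal s \<le> emeasure \<mu> {x \<in> space \<mu>. t < norm (f x)} \<Longrightarrow> ennreal t \<le> y"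
  shows "decreasing_rearrangement \<mu> f s \<le> y"
proof (rule ccontr)
  assume "\<not> ?thesis"
  then obtain z where z: "y < z" "z < decreasing_rearrangement \<mu> f s"
    using dense[of y "decreasing_rearrangement \<mu> f s"] by (auto simp: not_le)
  then obtain t where t: "z = ennreal t" "0 \<le> t" by (cases z) auto
  have "\<not> emeasure \<mu> {x \<in> space \<mu>. t < norm (f x)} \<le> ennreal s"
  proof
    assume "emeasure \<mu> {x \<in> space \<mu>. t < norm (f x)} \<le> ennreal s"
    then have "decreasing_rearrangement \<mu> f s \<le> ennreal t"
      unfolding decreasing_rearrangement_def using t by (intro Inf_lower) blast
    then show False using z t by simp
  qed
  then have "ennreal t \<le> y" using t by (intro assms) auto
  then show False using z t by simp
qed

text \<open>The factor 2 is the price in the geometric weights for shifting the index by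
  one.\<close>

lemma tail_Suc_le:
  assumes "\<And>j. 0 \<le> a j"
  shows "(half_tail a (Suc k)) \<le> 2 * (\<Sum>i. ennreal ((1/2) ^ i) * ennreal (a (k + i)))"
proof -
  have "ennreal ((1/2) ^ i * a (Suc k + i)) = 2 * (ennreal ((1/2) ^ Suc i) * ennreal (a (k + Suc i)))" for i
  proof -
    have "2 * (ennreal ((1/2) ^ Suc i) * ennreal (a (k + Suc i))) = ennreal 2 * ennreal ((1/2) ^ Suc i * a (k + Suc i))"
      by (simp add: ennreal_mult' del: power_Suc)
    also have "\<dots> = ennreal (2 * ((1/2) ^ Suc i * a (k + Suc i)))" by (rule ennreal_mult'[symmetric]) simp
    finally show ?thesis by simp
  qed
  then have "(half_tail a (Suc k)) = 2 * (\<Sum>i. ennreal ((1/2) ^ Suc i) * ennreal (a (k + Suc i)))"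
    by (simp only: ennreal_suminf_cmult)
  also have "\<dots> \<le> 2 * (\<Sum>i. ennreal ((1/2) ^ i) * ennreal (a (k + i)))"
  proof (intro mult_left_mono)
    show "(\<Sum>i. ennreal ((1/2) ^ Suc i) * ennreal (a (k + Suc i))) \<le> (\<Sum>i. ennreal ((1/2) ^ i) * ennreal (a (k + i)))"
      by (subst (2) suminf_offset[OF summableI, of _ 1]) (rule add_increasing2, simp_all)
  qed simp
  finally show ?thesis .
qed

text \<open>The constant in \<open>level_bound\<close> is handled by
  \<open>weighted_sum_one\<close>, the partial sums by Hardy's inequality and both tails by
  \<open>weighted_sum_tail\<close>. The remaining powers of 2 come from splitting powers of sums and
  from \<open>tail_Suc_le\<close>.\<close>

lemma weighted_sum_estimate:
  fixes a c :: "nat \<Rightarrow> real"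
  assumes n: "2 \<le> n" and c: "\<And>j. 0 \<le> c j" "(\<Sum>j. ennreal (c j ^ n)) \<le> 1" and a: "\<And>j. 0 \<le> a j"
    and D: "\<And>k. D k \<le> ennreal C * level_bound \<Lambda> c a (Suc k)"
  shows "weighted_sum n D \<le> (ennreal C * 2) ^ n *
     ennreal (2 ^ n * (2 ^ n * (2 + 4 ^ n) + 2 ^ n * (6 * 16 ^ n))) * (ennreal \<Lambda> ^ n + weighted_sum n (\<lambda>k. ennreal (a k)))"
proof -
  let ?T = "\<lambda>x k. \<Sum>i. ennreal ((1/2) ^ i) * ennreal (x (k + i))"
  let ?S = "\<lambda>k. \<Sum>j<Suc k. ennreal (c j)"
  let ?Q = "2 ^ n * (2 ^ n * (2 + 4 ^ n) + 2 ^ n * (6 * 16 ^ n)) :: real"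
  have wT: "weighted_sum n (?T x) \<le> ennreal (6 * 16 ^ n) * weighted_sum n (\<lambda>k. ennreal (x k))" for x
    using n by (intro weighted_sum_tail) simp
  have two: "(2::ennreal) ^ k = ennreal (2 ^ k)" for k
    using ennreal_power[of 2 k] by simp
  have "weighted_sum n D \<le> weighted_sum n (\<lambda>k. ennreal C * (ennreal \<Lambda> * ((1 + ?S k) + 2 * ?T c k) + 2 * ?T a k))"
  proof (rule weighted_sum_mono)
    fix k
    have "ennreal C * level_bound \<Lambda> c a (Suc k)
       \<le> ennreal C * (ennreal \<Lambda> * ((1 + ?S k) + 2 * ?T c k) + 2 * ?T a k)"
      by (intro mult_left_mono add_mono order_refl tail_Suc_le c a) auto
    with D[of k] show "D k \<le> ennreal C * (ennreal \<Lambda> * ((1 + ?S k) + 2 * ?T c k) + 2 * ?T a k)"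
      by (rule order_trans)
  qed
  also have "\<dots> = ennreal C ^ n * weighted_sum n (\<lambda>k. ennreal \<Lambda> * ((1 + ?S k) + 2 * ?T c k) + 2 * ?T a k)"
    by (rule weighted_sum_cmult)
  also have "\<dots> \<le> ennreal C ^ n * (2 ^ n * (weighted_sum n (\<lambda>k. ennreal \<Lambda> * ((1 + ?S k) + 2 * ?T c k)) + weighted_sum n (\<lambda>k. 2 * ?T a k)))"
    by (intro mult_left_mono weighted_sum_add) simp
  also have "weighted_sum n (\<lambda>k. ennreal \<Lambda> * ((1 + ?S k) + 2 * ?T c k)) = ennreal \<Lambda> ^ n * weighted_sum n (\<lambda>k. (1 + ?S k) + 2 * ?T c k)"
    by (rule weighted_sum_cmult)
  also have "weighted_sum n (\<lambda>k. 2 * ?T a k) = 2 ^ n * weighted_sum n (?T a)"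
    by (rule weighted_sum_cmult)
  also have "ennreal C ^ n * (2 ^ n * (ennreal \<Lambda> ^ n * weighted_sum n (\<lambda>k. (1 + ?S k) + 2 * ?T c k) + 2 ^ n * weighted_sum n (?T a)))
     \<le> ennreal C ^ n * (2 ^ n * (ennreal \<Lambda> ^ n * ennreal ?Q + ennreal ?Q * weighted_sum n (\<lambda>k. ennreal (a k))))"
  proof (intro mult_left_mono add_mono)
    have "weighted_sum n (\<lambda>k. (1 + ?S k) + 2 * ?T c k)
       \<le> 2 ^ n * (weighted_sum n (\<lambda>k. 1 + ?S k) + weighted_sum n (\<lambda>k. 2 * ?T c k))"
      by (rule weighted_sum_add)
    also have "\<dots> \<le> 2 ^ n * (2 ^ n * (weighted_sum n (\<lambda>k. 1) + weighted_sum n ?S) + weighted_sum n (\<lambda>k. 2 * ?T c k))"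
      by (intro mult_left_mono add_right_mono weighted_sum_add) simp
    also have "weighted_sum n (\<lambda>k. 2 * ?T c k) = 2 ^ n * weighted_sum n (?T c)"
      by (rule weighted_sum_cmult)
    also have "2 ^ n * (2 ^ n * (weighted_sum n (\<lambda>k. 1) + weighted_sum n ?S) + 2 ^ n * weighted_sum n (?T c))
       \<le> 2 ^ n * (2 ^ n * (ennreal 2 + ennreal (4 ^ n)) + 2 ^ n * (ennreal (6 * 16 ^ n) * 1))"
    proof (intro mult_left_mono add_mono)
      show "weighted_sum n (\<lambda>k. 1) \<le> ennreal 2" using weighted_sum_one[OF n] by simp
      show "weighted_sum n ?S \<le> ennreal (4 ^ n)" by (rule weighted_sum_partial_sums[OF n c])
      show "weighted_sum n (?T c) \<le> ennreal (6 * 16 ^ n) * 1"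
        by (rule order_trans[OF wT mult_left_mono[OF weighted_sum_le_sum[OF c]]]) simp
    qed simp_all
    also have "\<dots> = ennreal ?Q"
    proof -
      have "ennreal ?Q = ennreal (2 ^ n) * ennreal (2 ^ n * (2 + 4 ^ n) + 2 ^ n * (6 * 16 ^ n))"
        by (rule ennreal_mult') simp
      also have "ennreal (2 ^ n * (2 + 4 ^ n) + 2 ^ n * (6 * 16 ^ n)) = ennreal (2 ^ n * (2 + 4 ^ n)) + ennreal (2 ^ n * (6 * 16 ^ n))"
        by (rule ennreal_plus) simp_all
      also have "ennreal (2 ^ n * (2 + 4 ^ n)) = ennreal (2 ^ n) * ennreal (2 + 4 ^ n)" by (rule ennreal_mult') simp
      also have "ennreal (2 + 4 ^ n) = ennreal 2 + ennreal (4 ^ n)" by (rule ennreal_plus) simp_all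
      also have "ennreal (2 ^ n * (6 * 16 ^ n)) = ennreal (2 ^ n) * ennreal (6 * 16 ^ n)" by (rule ennreal_mult') simp
      finally show ?thesis by (simp only: two mult_1_right)
    qed
    finally show "weighted_sum n (\<lambda>k. (1 + ?S k) + 2 * ?T c k) \<le> ennreal ?Q" .
    have "2 ^ n * weighted_sum n (?T a) \<le> ennreal (2 ^ n) * (ennreal (6 * 16 ^ n) * weighted_sum n (\<lambda>k. ennreal (a k)))"
      unfolding two by (intro mult_left_mono wT) simp
    also have "\<dots> = ennreal (2 ^ n * (6 * 16 ^ n)) * weighted_sum n (\<lambda>k. ennreal (a k))"
      by (simp add: ennreal_mult' mult.assoc)
    also have "\<dots> \<le> ennreal ?Q * weighted_sum n (\<lambda>k. ennreal (a k))"
    proof (intro mult_right_mono ennreal_leI)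
      have "1 * (0 + 2 ^ n * (6 * 16 ^ n)) \<le> ?Q" by (intro mult_mono add_mono) auto
      then show "2 ^ n * (6 * 16 ^ n) \<le> ?Q" by simp
    qed simp
    finally show "2 ^ n * weighted_sum n (?T a) \<le> ennreal ?Q * weighted_sum n (\<lambda>k. ennreal (a k))" .
  qed simp_all
  also have "\<dots> = (ennreal C * 2) ^ n * ennreal ?Q * (ennreal \<Lambda> ^ n + weighted_sum n (\<lambda>k. ennreal (a k)))"
  proof -
    have "x ^ n * (2 ^ n * (l * q + q * w)) = (x * 2) ^ n * q * (l + w)" for x l q w :: ennreal
      by (simp only: power_mult_distrib distrib_left distrib_right mult_ac)
    then show ?thesis .
  qed
  finally show ?thesis .
qed

text \<open>With the total masses as scales, both rearrangements are sampled at the dyadic points of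
  their norms. The boundary levels are the values of the boundary rearrangement itself, which
  satisfy the required measure bounds because the infimum is attained.\<close>

lemma lorentz_zygmund_estimate:
  assumes dim: "2 \<le> CARD('n::finite)" and \<alpha>: "real CARD('n) - 1 < \<alpha>" and C\<mu>: "0 < C\<^sub>\<mu>"
    and V: "0 \<le> V" and M: "0 \<le> M" and R: "0 \<le> R"
  shows "\<exists>C::real. 0 < C \<and> (\<forall>(\<Omega>::(real^'n) set) \<mu> u.
      open \<Omega> \<longrightarrow> sets \<mu> = sets (restrict_space borel \<Omega>) \<longrightarrow>
      (\<forall>x\<in>\<Omega>. \<forall>r>0. emeasure \<mu> (ball x r \<inter> \<Omega>) \<le> ennreal (C\<^sub>\<mu> * r powr \<alpha>)) \<longrightarrow>
      emeasure lborel \<Omega> = ennreal V \<longrightarrow> emeasure \<mu> \<Omega> = ennreal M \<longrightarrow>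
      emeasure (hausdorff (CARD('n) - 1)) (frontier \<Omega>) = ennreal R \<longrightarrow>
      u \<in> E1 (real CARD('n)) \<Omega> \<inter> C_b (closure \<Omega>) \<longrightarrow>
      lorentz_zygmund_norm (real CARD('n)) \<mu> u
        \<le> ennreal C * (sym_grad_norm (real CARD('n)) \<Omega> u
             + lorentz_zygmund_norm (real CARD('n)) (boundary_measure \<Omega>) u))"
proof -
  define n where "n = CARD('n)"
  have n: "2 \<le> n" "0 < n" using dim by (auto simp: n_def)
  \<comment> \<open>\<open>rearrangement_estimate\<close> needs a positive scale; when
    \<open>R = 0\<close> all boundary levels vanish and any positive number serves.\<close>
  define A where "A = (if R = 0 then 1 else R)"
  have A: "0 < A" using R by (simp add: A_def)
  define C1 where "C1 = max 1 (key_const CARD('n) (C\<^sub>\<mu> * 2 powr \<alpha>) \<alpha> V M A M)"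
  have C1: "1 \<le> C1" "key_const CARD('n) (C\<^sub>\<mu> * 2 powr \<alpha>) \<alpha> V M A M \<le> C1" by (auto simp: C1_def)
  define Q where "Q = (2 ^ n * (2 ^ n * (2 + 4 ^ n) + 2 ^ n * (6 * 16 ^ n)) :: real)"
  have Q: "1 \<le> Q"
  proof -
    have "1 * (1 * (1 + 0) + 0) \<le> Q" unfolding Q_def by (intro mult_mono add_mono) auto
    then show ?thesis by simp
  qed
  \<comment> \<open>4 stems from \<open>lorentz_zygmund_norm_upper\<close> and \<open>C1 * 2\<close>
    from \<open>weighted_sum_estimate\<close>. The last factor is at least 1, so it may be replaced
    by its \<open>n\<close>-th power before the \<open>n\<close>-th root is taken.\<close>
  define C where "C = 4 * (C1 * 2) * (2 * (Q * 4 ^ n))"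
  have C: "0 < C" using C1(1) Q by (simp add: C_def)
  show ?thesis
  proof (intro exI[of _ "max 1 C"] conjI allI impI)
    fix \<Omega> :: "(real^'n) set" and \<mu> u
    assume \<Omega>: "open \<Omega>" and sets: "sets \<mu> = sets (restrict_space borel \<Omega>)"
      and growth: "\<forall>x\<in>\<Omega>. \<forall>r>0. emeasure \<mu> (ball x r \<inter> \<Omega>) \<le> ennreal (C\<^sub>\<mu> * r powr \<alpha>)"
      and vol: "emeasure lborel \<Omega> = ennreal V" and mass: "emeasure \<mu> \<Omega> = ennreal M"
      and area: "emeasure (hausdorff (CARD('n) - 1)) (frontier \<Omega>) = ennreal R"
      and u: "u \<in> E1 (real CARD('n)) \<Omega> \<inter> C_b (closure \<Omega>)"
    let ?s = "sym_grad_norm (real CARD('n)) \<Omega> u" and ?H = "boundary_measure \<Omega>"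
    let ?N\<mu> = "lorentz_zygmund_norm (real CARD('n)) \<mu> u" and ?NH = "lorentz_zygmund_norm (real CARD('n)) ?H u"
    have sp: "space \<mu> = \<Omega>" using sets_eq_imp_space_eq[OF sets] by (simp add: space_restrict_space)
    have m\<mu>: "measure \<mu> (space \<mu>) = M" unfolding sp measure_def mass using M by simp
    have Yb: "{y \<in> frontier \<Omega>. t < norm (u y)} \<in> sets borel" for t
      using u by (intro C_b_measurable[of u "closure \<Omega>"]) (auto simp: frontier_def)
    then have Y: "{y \<in> space ?H. t < norm (u y)} \<in> sets ?H" for t
      unfolding boundary_measure_def by (simp add: sets_restrict_space_iff space_restrict_space)
    have eH: "emeasure ?H (space ?H) = ennreal R"
      using area unfolding boundary_measure_def by (simp add: emeasure_restrict_space space_restrict_space)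
    have mH: "measure ?H (space ?H) = R" unfolding measure_def eH using R by simp
    have sfin: "?s < top" using u by (simp add: E1_def)
    have main: "?N\<mu> \<le> ennreal C * (ennreal \<Lambda> + ?NH)" if \<Lambda>: "0 < \<Lambda>" "?s \<le> ennreal \<Lambda>" for \<Lambda>
    \<comment> \<open>For \<open>M = 0\<close> the norm is an integral over an empty
      interval.\<close>
    proof (cases "M = 0")
      case True
      have "?N\<mu> ^ n = 0"
        unfolding n_def lorentz_zygmund_norm_power[OF n(2)[unfolded n_def]] m\<mu> True by simp
      also have "\<dots> \<le> 0 ^ n" by simp
      finally have "?N\<mu> \<le> 0" by (rule power_le_imp_le_ennreal[OF n(2)])
      then show ?thesis by simp
    next
      case False
      then have M0: "0 < M" using M by simp
      define d where "d j = decreasing_rearrangement ?H u (A * (1/2) ^ j)" for j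
      define a where "a j = enn2real (d j)" for j
      have uC: "u \<in> C_b (closure \<Omega>)" using u by simp
      obtain U where U: "0 \<le> U" "\<And>y. y \<in> closure \<Omega> \<Longrightarrow> norm (u y) \<le> U"
        by (rule C_b_bounded[OF uC]) blast
      \<comment> \<open>Boundedness of \<open>u\<close> makes the rearrangement finite, so that its
        values form a real sequence.\<close>
      have dfin: "d j < top" for j
      proof -
        have e: "{y \<in> space ?H. U < norm (u y)} = {}" using U(2) by (fastforce simp: frontier_def)
        have "emeasure ?H {y \<in> space ?H. U < norm (u y)} \<le> ennreal (A * (1/2) ^ j)"
          unfolding e by simp
        then have "d j \<le> ennreal U"
          unfolding d_def decreasing_rearrangement_def using U(1) by (intro Inf_lower) blast
        then show ?thesis by (rule le_less_trans) simp
      qed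
      have a0: "0 \<le> a j" for j by (simp add: a_def)
      have da: "d j = ennreal (a j)" for j using dfin[of j] by (simp add: a_def)
      have aH: "emeasure ?H {y \<in> frontier \<Omega>. a j < norm (u y)} \<le> ennreal (A * (1/2) ^ j)" for j
        using decreasing_rearrangement_attained[OF Y dfin[of j, unfolded d_def]] by (simp add: a_def d_def)
      obtain c where c0: "\<forall>j. 0 \<le> c j" and c1: "(\<Sum>j. ennreal (c j ^ CARD('n))) \<le> 1"
        and est: "\<forall>t k. 0 \<le> t \<longrightarrow> ennreal (M * (1/2) ^ k) \<le> emeasure \<mu> {x \<in> \<Omega>. t < norm (u x)} \<longrightarrow>
         ennreal t \<le> ennreal (key_const CARD('n) (C\<^sub>\<mu> * 2 powr \<alpha>) \<alpha> V M A M) * level_bound \<Lambda> c a k"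
        using rearrangement_estimate[OF dim \<alpha> C\<mu> V M A M0 \<Omega> sets growth vol mass u \<Lambda> a0 aH]
        by blast
      have D: "decreasing_rearrangement \<mu> u (M * (1/2) ^ k) \<le> ennreal C1 * level_bound \<Lambda> c a k" for k
      proof (rule decreasing_rearrangement_leI)
        fix t :: real
        assume "0 \<le> t" "ennreal (M * (1/2) ^ k) \<le> emeasure \<mu> {x \<in> space \<mu>. t < norm (u x)}"
        then have "ennreal t \<le> ennreal (key_const CARD('n) (C\<^sub>\<mu> * 2 powr \<alpha>) \<alpha> V M A M) * level_bound \<Lambda> c a k"
          unfolding sp by (rule est[rule_format])
        also have "\<dots> \<le> ennreal C1 * level_bound \<Lambda> c a k"
          by (intro mult_right_mono ennreal_leI C1(2)) simp
        finally show "ennreal t \<le> \<dots>" .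
      qed
      have wa: "weighted_sum n (\<lambda>k. ennreal (a k)) \<le> ennreal (4 ^ n) * ?NH ^ n"
      proof (cases "R = 0")
        case True
        have "d j \<le> 0" for j
        proof -
          have "emeasure ?H {y \<in> space ?H. 0 < norm (u y)} \<le> emeasure ?H (space ?H)"
            by (intro emeasure_mono sets.top) auto
          then have "emeasure ?H {y \<in> space ?H. 0 < norm (u y)} \<le> ennreal (A * (1/2) ^ j)"
            unfolding eH True by simp
          then have "d j \<le> ennreal 0"
            unfolding d_def decreasing_rearrangement_def by (intro Inf_lower) blast
          then show ?thesis by simp
        qed
        then have "a j = 0" for j by (simp add: a_def)
        then show ?thesis using n by (simp add: weighted_sum_def power_0_left)
      next
        case False
        then have "0 < measure ?H (space ?H)" "A = measure ?H (space ?H)"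
          unfolding mH A_def using R by simp_all
        then show ?thesis
          using lorentz_zygmund_norm_lower[of "CARD('n)" ?H u] n unfolding da[symmetric] d_def n_def by simp
      qed
      have "?N\<mu> ^ n \<le> ennreal (4 ^ n) * weighted_sum n (\<lambda>k. decreasing_rearrangement \<mu> u (M * (1/2) ^ Suc k))"
        using lorentz_zygmund_norm_upper[of "CARD('n)" \<mu> u] n M0 m\<mu> by (simp add: n_def)
      also have "\<dots> \<le> ennreal (4 ^ n) * ((ennreal C1 * 2) ^ n * ennreal Q * (ennreal \<Lambda> ^ n + weighted_sum n (\<lambda>k. ennreal (a k))))"
      proof (rule mult_left_mono)
        have c: "\<And>j. 0 \<le> c j" "(\<Sum>j. ennreal (c j ^ n)) \<le> 1" using c0 c1 by (simp_all add: n_def)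
        show "weighted_sum n (\<lambda>k. decreasing_rearrangement \<mu> u (M * (1/2) ^ Suc k))
          \<le> (ennreal C1 * 2) ^ n * ennreal Q * (ennreal \<Lambda> ^ n + weighted_sum n (\<lambda>k. ennreal (a k)))"
          unfolding Q_def by (rule weighted_sum_estimate[OF n(1) c a0]) (rule D)
      qed simp
      also have "\<dots> \<le> ennreal (4 ^ n) * ((ennreal C1 * 2) ^ n * ennreal Q * (ennreal (4 ^ n) * (2 * (ennreal \<Lambda> + ?NH) ^ n)))"
      proof (intro mult_left_mono)
        have "ennreal \<Lambda> ^ n + weighted_sum n (\<lambda>k. ennreal (a k)) \<le> ennreal (4 ^ n) * ennreal \<Lambda> ^ n + ennreal (4 ^ n) * ?NH ^ n"
        proof (rule add_mono[OF _ wa])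
          have "1 * ennreal \<Lambda> ^ n \<le> ennreal (4 ^ n) * ennreal \<Lambda> ^ n"
            by (intro mult_right_mono) (simp_all add: ennreal_1[symmetric] ennreal_leI del: ennreal_1)
          then show "ennreal \<Lambda> ^ n \<le> ennreal (4 ^ n) * ennreal \<Lambda> ^ n" by simp
        qed
        also have "\<dots> = ennreal (4 ^ n) * (ennreal \<Lambda> ^ n + ?NH ^ n)" by (rule distrib_left[symmetric])
        also have "\<dots> \<le> ennreal (4 ^ n) * ((ennreal \<Lambda> + ?NH) ^ n + (ennreal \<Lambda> + ?NH) ^ n)"
          by (intro mult_left_mono add_mono power_mono) simp_all
        finally show "ennreal \<Lambda> ^ n + weighted_sum n (\<lambda>k. ennreal (a k)) \<le> ennreal (4 ^ n) * (2 * (ennreal \<Lambda> + ?NH) ^ n)"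
          by (simp only: mult_2)
      qed simp_all
      also have "\<dots> = ennreal (4 ^ n) * (ennreal C1 * 2) ^ n * ennreal (2 * (Q * 4 ^ n)) * (ennreal \<Lambda> + ?NH) ^ n"
      proof -
        have "ennreal (2 * (Q * 4 ^ n)) = 2 * (ennreal Q * ennreal (4 ^ n))"
          using Q by (simp add: ennreal_mult)
        then show ?thesis by (simp only: mult_ac)
      qed
      also have "\<dots> \<le> ennreal (4 ^ n) * (ennreal C1 * 2) ^ n * ennreal ((2 * (Q * 4 ^ n)) ^ n) * (ennreal \<Lambda> + ?NH) ^ n"
      proof (intro mult_left_mono mult_right_mono ennreal_leI)
        have "1 * (1 * 1) \<le> 2 * (Q * 4 ^ n)" using Q by (intro mult_mono) auto
        then have "(2 * (Q * 4 ^ n)) ^ 1 \<le> (2 * (Q * 4 ^ n)) ^ n" using n by (intro power_increasing) auto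
        then show "2 * (Q * 4 ^ n) \<le> (2 * (Q * 4 ^ n)) ^ n" by simp
      qed simp_all
      also have "\<dots> = (ennreal C * (ennreal \<Lambda> + ?NH)) ^ n"
      proof -
        have "ennreal C ^ n = ennreal (4 ^ n) * (ennreal C1 * 2) ^ n * ennreal ((2 * (Q * 4 ^ n)) ^ n)"
        proof -
          have "ennreal (C1 * 2) = ennreal C1 * 2" using C1(1) by (simp add: ennreal_mult)
          moreover have "ennreal C = ennreal (4 * (C1 * 2)) * ennreal (2 * (Q * 4 ^ n))"
            unfolding C_def using Q by (intro ennreal_mult'') simp
          moreover have "ennreal (4 * (C1 * 2)) = ennreal 4 * ennreal (C1 * 2)"
            by (intro ennreal_mult') simp
          moreover have "ennreal 4 ^ n = ennreal (4 ^ n)" by (rule ennreal_power) simp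
          moreover have "ennreal (2 * (Q * 4 ^ n)) ^ n = ennreal ((2 * (Q * 4 ^ n)) ^ n)" using Q by (intro ennreal_power) simp
          ultimately show ?thesis by (simp only: power_mult_distrib)
        qed
        then show ?thesis by (simp only: power_mult_distrib[of "ennreal C"])
      qed
      finally show ?thesis by (rule power_le_imp_le_ennreal[OF n(2)])
    qed
    show "?N\<mu> \<le> ennreal (max 1 C) * (?s + ?NH)"
    proof (rule ennreal_le_of_approx[OF less_imp_le[OF C] _ sfin])
      fix \<Lambda> l :: real
      assume \<Lambda>: "0 < \<Lambda>" "?s \<le> ennreal \<Lambda>" and l: "?NH \<le> ennreal l" "0 < l"
      have "?N\<mu> \<le> ennreal C * (ennreal \<Lambda> + ennreal l)"
        by (rule order_trans[OF main[OF \<Lambda>]]) (intro mult_left_mono add_left_mono l, simp)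
      also have "\<dots> = ennreal (C * (\<Lambda> + l))" using C \<Lambda> l by (simp add: ennreal_mult)
      finally show "?N\<mu> \<le> ennreal (C * (\<Lambda> + l))" .
    qed
  qed simp
qed

text \<open>\<open>A\<close> and \<open>B\<close> vary independently among the Young functions of
  one exponential class, so every equivalent choice of the two norms is covered.\<close>

theorem theorem4p3:
  fixes \<alpha> C\<^sub>\<mu> vol_\<Omega> mass_\<mu> area_\<Omega> :: real
  assumes "2 \<le> CARD('n::finite)"
    and "real CARD('n) - 1 < \<alpha>" and "\<alpha> \<le> real CARD('n)"
    and "0 < C\<^sub>\<mu>"
    and "0 \<le> vol_\<Omega>" and "0 \<le> mass_\<mu>" and "0 \<le> area_\<Omega>"
  shows
    "(\<forall>A B. exp_young (real CARD('n) / (real CARD('n) - 1)) A \<longrightarrow>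
            exp_young (real CARD('n) / (real CARD('n) - 1)) B \<longrightarrow>
       (\<exists>C::real. 0 < C \<and>
         (\<forall>(\<Omega>::(real^'n) set) \<mu> u.
            open \<Omega> \<longrightarrow>
            sets \<mu> = sets (restrict_space borel \<Omega>) \<longrightarrow>
            (\<forall>x\<in>\<Omega>. \<forall>r>0. emeasure \<mu> (ball x r \<inter> \<Omega>) \<le> ennreal (C\<^sub>\<mu> * r powr \<alpha>)) \<longrightarrow>
            emeasure lborel \<Omega> = ennreal vol_\<Omega> \<longrightarrow>
            emeasure \<mu> \<Omega> = ennreal mass_\<mu> \<longrightarrow>
            emeasure (hausdorff (CARD('n) - 1)) (frontier \<Omega>) = ennreal area_\<Omega> \<longrightarrow>
            u \<in> E1 (real CARD('n)) \<Omega> \<inter> C_b (closure \<Omega>) \<longrightarrow>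
            luxemburg_norm A \<mu> u
              \<le> ennreal C * (sym_grad_norm (real CARD('n)) \<Omega> u
                              + luxemburg_norm B (boundary_measure \<Omega>) u)))) \<and>
     (\<exists>C::real. 0 < C \<and>
        (\<forall>(\<Omega>::(real^'n) set) \<mu> u.
            open \<Omega> \<longrightarrow>
            sets \<mu> = sets (restrict_space borel \<Omega>) \<longrightarrow>
            (\<forall>x\<in>\<Omega>. \<forall>r>0. emeasure \<mu> (ball x r \<inter> \<Omega>) \<le> ennreal (C\<^sub>\<mu> * r powr \<alpha>)) \<longrightarrow>
            emeasure lborel \<Omega> = ennreal vol_\<Omega> \<longrightarrow>
            emeasure \<mu> \<Omega> = ennreal mass_\<mu> \<longrightarrow>
            emeasure (hausdorff (CARD('n) - 1)) (frontier \<Omega>) = ennreal area_\<Omega> \<longrightarrow>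
            u \<in> E1 (real CARD('n)) \<Omega> \<inter> C_b (closure \<Omega>) \<longrightarrow>
            lorentz_zygmund_norm (real CARD('n)) \<mu> u
              \<le> ennreal C * (sym_grad_norm (real CARD('n)) \<Omega> u
                              + lorentz_zygmund_norm (real CARD('n)) (boundary_measure \<Omega>) u)))"
proof (intro conjI allI impI)
  fix A B
  assume "exp_young (real CARD('n) / (real CARD('n) - 1)) A" "exp_young (real CARD('n) / (real CARD('n) - 1)) B"
  from exp_orlicz_estimate[OF assms(1,2,4,5,6) this] show "\<exists>C::real. 0 < C \<and>
         (\<forall>(\<Omega>::(real^'n) set) \<mu> u.
            open \<Omega> \<longrightarrow>
            sets \<mu> = sets (restrict_space borel \<Omega>) \<longrightarrow>
            (\<forall>x\<in>\<Omega>. \<forall>r>0. emeasure \<mu> (ball x r \<inter> \<Omega>) \<le> ennreal (C\<^sub>\<mu> * r powr \<alpha>)) \<longrightarrow>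
            emeasure lborel \<Omega> = ennreal vol_\<Omega> \<longrightarrow>
            emeasure \<mu> \<Omega> = ennreal mass_\<mu> \<longrightarrow>
            emeasure (hausdorff (CARD('n) - 1)) (frontier \<Omega>) = ennreal area_\<Omega> \<longrightarrow>
            u \<in> E1 (real CARD('n)) \<Omega> \<inter> C_b (closure \<Omega>) \<longrightarrow>
            luxemburg_norm A \<mu> u
              \<le> ennreal C * (sym_grad_norm (real CARD('n)) \<Omega> u
                              + luxemburg_norm B (boundary_measure \<Omega>) u))"
    by (elim ex_forward conj_forward all_forward) iprover+
qed (rule lorentz_zygmund_estimate[OF assms(1,2,4,5,6,7)])

end
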